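(* Any flat rank 2 distribution with growth vector $(2,1,2,\dots)$ (whether it is represented by a nondegenerate single Monge equation or by an underdetermined system of ODEs) is, locally, the result of successive integrable extensions of the Hilbert--Cartan equation $y'=(z'')^2$.
   Context: All considerations are local. For a distribution $\Delta\subset TM$ the weak derived flag is defined by $\Delta_1=\Delta$, $\Gamma(\Delta_{i+1})=[\Gamma(\Delta),\Gamma(\Delta_i)]$; it is assumed that all $\Delta_i$ have constant rank and that $\Delta$ is completely non-holonomic, i.e. $\Delta_s=TM$ for some $s$. The Carnot algebra of $\Delta$ at $x\in M$ is the graded nilpotent Lie algebra $\mathfrak{m}(x)=\bigoplus_{i<0}g_i$, $g_{-1}=\Delta_x$, $g_{-i}=(\Delta_i/\Delta_{i-1})_x$, with bracket induced by the commutator of vector fields. The growth vector is $(\dim g_{-1},\dim g_{-2},\dots)$. The distribution is flat if its Carnot algebra is (up to isomorphism) a fixed $\mathfrak{m}$ at all points and $(M,\Delta)$ is locally diffeomorphic to the simply connected nilpotent Lie group with Lie algebra $\mathfrak{m}$ equipped with the left-invariant distribution determined by $g_{-1}\subset\mathfrak{m}$. The Hilbert--Cartan equation is identified with the rank 2 distribution on $\mathbb{R}^5(x,y,z,z_1,z_2)$ spanned by $\partial_x+z_2^2\,\partial_y+z_1\,\partial_z+z_2\,\partial_{z_1}$ and $\partial_{z_2}$ (growth vector $(2,1,2)$). An integrable extension of $(M,\Delta)$ is a submersion $\pi:(\tilde M,\tilde\Delta)\to(M,\Delta)$ such that (i) $d_x\pi:\tilde\Delta_x\to\Delta_{\pi(x)}$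 is an isomorphism for all $x\in\tilde M$, and (ii) $\tilde\Delta_2\cap\operatorname{Ker}d\pi=0$. "Result of successive integrable extensions" means: there is a finite (possibly empty) chain of integrable extensions $(M_r,\Delta_r)\to\cdots\to(M_1,\Delta_1)\to(M_0,\Delta_0)$ starting from the Hilbert--Cartan equation $(M_0,\Delta_0)$ and with $(M_r,\Delta_r)$ locally equivalent to the given distribution (the subscripts here number the members of the chain). *)

theory Defs
  imports "HOL-Analysis.Analysis" "HOL-Library.Function_Algebras" "HOL-Algebra.Group"
begin

text \<open>
  Dimensions vary along a chain of extensions, so \<open>\<real>\<^sup>n\<close> is the carrier of the library's
  \<^const>\<open>Euclidean_space\<close> \<open>n\<close>: functions \<open>nat \<Rightarrow> real\<close> vanishing at all indices \<open>\<ge> n\<close>. Tangent vectors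
  are represented in the same way. Linear algebra (\<^const>\<open>span\<close>, \<^const>\<open>dim\<close>, \<^const>\<open>subspace\<close>)
  is the library's, through the pointwise vector space structure.
\<close>

instantiation "fun" :: (type, real_vector) real_vector
begin

definition scaleR_fun :: "real \<Rightarrow> ('a \<Rightarrow> 'b) \<Rightarrow> 'a \<Rightarrow> 'b"
  where "scaleR_fun c f = (\<lambda>i. c *\<^sub>R f i)"

instance
  by standard (auto simp: scaleR_fun_def fun_eq_iff algebra_simps)

end

type_synonym pt = "nat \<Rightarrow> real"

type_synonym dist = "pt \<Rightarrow> pt set"

abbreviation Rn :: "nat \<Rightarrow> pt set"
  where "Rn n \<equiv> topspace (Euclidean_space n)"

definition pd :: "nat \<Rightarrow> (pt \<Rightarrow> real) \<Rightarrow> pt \<Rightarrow> real"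
  where "pd i f x = deriv (\<lambda>t. f (x(i := t))) (x i)"

definition iterated_pd :: "nat list \<Rightarrow> (pt \<Rightarrow> real) \<Rightarrow> pt \<Rightarrow> real"
  where "iterated_pd is f = foldr pd is f"

definition smooth_fun :: "nat \<Rightarrow> pt set \<Rightarrow> (pt \<Rightarrow> real) \<Rightarrow> bool"
  where "smooth_fun n U f \<longleftrightarrow>
    (\<forall>is \<in> lists {..<n}.
       continuous_map (subtopology (Euclidean_space n) U) euclideanreal (iterated_pd is f) \<and>
       (\<forall>i<n. \<forall>x\<in>U. (\<lambda>t. iterated_pd is f (x(i := t))) differentiable (at (x i))))"

definition smooth_map :: "nat \<Rightarrow> pt set \<Rightarrow> nat \<Rightarrow> (pt \<Rightarrow> pt) \<Rightarrow> bool"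
  where "smooth_map n U m \<phi> \<longleftrightarrow> \<phi> ` U \<subseteq> Rn m \<and> (\<forall>k<m. smooth_fun n U (\<lambda>x. \<phi> x k))"

definition differential :: "nat \<Rightarrow> (pt \<Rightarrow> pt) \<Rightarrow> pt \<Rightarrow> pt \<Rightarrow> pt"
  where "differential n \<phi> x v = (\<lambda>k. \<Sum>i<n. v i * pd i (\<lambda>y. \<phi> y k) x)"

definition diffeomorphism :: "nat \<Rightarrow> pt set \<Rightarrow> nat \<Rightarrow> pt set \<Rightarrow> (pt \<Rightarrow> pt) \<Rightarrow> bool"
  where "diffeomorphism n U m V \<phi> \<longleftrightarrow>
    bij_betw \<phi> U V \<and> smooth_map n U m \<phi> \<and> smooth_map m V n (inv_into U \<phi>)"

abbreviation vector_field :: "nat \<Rightarrow> pt set \<Rightarrow> (pt \<Rightarrow> pt) \<Rightarrow> bool"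
  where "vector_field n U X \<equiv> smooth_map n U n X"

definition lie_bracket :: "nat \<Rightarrow> (pt \<Rightarrow> pt) \<Rightarrow> (pt \<Rightarrow> pt) \<Rightarrow> pt \<Rightarrow> pt"
  where "lie_bracket n X Y x = differential n Y x (X x) - differential n X x (Y x)"

definition distribution :: "nat \<Rightarrow> pt set \<Rightarrow> nat \<Rightarrow> dist \<Rightarrow> bool"
  where "distribution n M k D \<longleftrightarrow>
    openin (Euclidean_space n) M \<and>
    (\<forall>x\<in>M. \<exists>W X. openin (Euclidean_space n) W \<and> x \<in> W \<and> W \<subseteq> M \<and>
       (\<forall>i<k. vector_field n W (X i)) \<and>
       (\<forall>y\<in>W. D y = span ((\<lambda>i. X i y) ` {..<k}) \<and> dim (D y) = k))"

definition sections :: "nat \<Rightarrow> pt set \<Rightarrow> dist \<Rightarrow> (pt \<Rightarrow> pt) set"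
  where "sections n W D = {X. vector_field n W X \<and> (\<forall>y\<in>W. X y \<in> D y)}"

text \<open>
  The fibre of \<open>\<Delta>\<^sub>i\<^sub>+\<^sub>1\<close> at \<open>x\<close> is spanned by the values at \<open>x\<close> of commutators of local sections of
  \<open>\<Delta>\<close> and \<open>\<Delta>\<^sub>i\<close>. It contains the fibre of \<open>\<Delta>\<^sub>i\<close>: take \<open>[X, f Y]\<close> with \<open>f x = 0\<close>, \<open>(X f) x = 1\<close>.
  By convention \<open>\<Delta>\<^sub>0 = 0\<close>, so that \<open>g\<^sub>-\<^sub>i = \<Delta>\<^sub>i / \<Delta>\<^sub>i\<^sub>-\<^sub>1\<close> also for \<open>i = 1\<close>.
\<close>

fun weak_flag :: "nat \<Rightarrow> pt set \<Rightarrow> dist \<Rightarrow> nat \<Rightarrow> dist" where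
  "weak_flag n M D 0 = (\<lambda>x. {0})"
| "weak_flag n M D (Suc 0) = D"
| "weak_flag n M D (Suc (Suc i)) = (\<lambda>x.
     span {lie_bracket n X Y x | X Y W.
       openin (Euclidean_space n) W \<and> x \<in> W \<and> W \<subseteq> M \<and>
       X \<in> sections n W D \<and> Y \<in> sections n W (weak_flag n M D (Suc i))})"

definition nonholonomic_distribution :: "nat \<Rightarrow> pt set \<Rightarrow> nat \<Rightarrow> dist \<Rightarrow> bool"
  where "nonholonomic_distribution n M k D \<longleftrightarrow>
    distribution n M k D \<and>
    (\<forall>i. \<exists>r. \<forall>x\<in>M. dim (weak_flag n M D i x) = r) \<and>
    (\<exists>s. \<forall>x\<in>M. weak_flag n M D s x = Rn n)"

text \<open>The entry \<open>dim g\<^sub>-\<^sub>i\<close> (\<open>i \<ge> 1\<close>) of the growth vector at \<open>x\<close>.\<close>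

definition growth :: "nat \<Rightarrow> pt set \<Rightarrow> dist \<Rightarrow> pt \<Rightarrow> nat \<Rightarrow> nat"
  where "growth n M D x i = dim (weak_flag n M D i x) - dim (weak_flag n M D (i - 1) x)"

definition locally_equivalent_at ::
    "pt \<Rightarrow> nat \<Rightarrow> pt set \<Rightarrow> dist \<Rightarrow> nat \<Rightarrow> pt set \<Rightarrow> dist \<Rightarrow> bool"
  where "locally_equivalent_at x n M D m N E \<longleftrightarrow>
    (\<exists>U V \<phi>. openin (Euclidean_space n) U \<and> x \<in> U \<and> U \<subseteq> M \<and>
       openin (Euclidean_space m) V \<and> V \<subseteq> N \<and>
       diffeomorphism n U m V \<phi> \<and>
       (\<forall>y\<in>U. differential n \<phi> y ` D y = E (\<phi> y)))"

definition coset :: "pt set \<Rightarrow> pt \<Rightarrow> pt set"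
  where "coset S v = (\<lambda>w. v + w) ` S"

text \<open>
  \<open>carnot_space n M D x i\<close> is \<open>g\<^sub>-\<^sub>i = (\<Delta>\<^sub>i / \<Delta>\<^sub>i\<^sub>-\<^sub>1)\<^sub>x\<close> for \<open>i \<ge> 1\<close>. In the bracket of two classes, the
  union ranges over all extensions of their representatives to local sections; all of them give the
  same class when the flag has constant ranks.
\<close>

definition carnot_space :: "nat \<Rightarrow> pt set \<Rightarrow> dist \<Rightarrow> pt \<Rightarrow> nat \<Rightarrow> pt set set"
  where "carnot_space n M D x i = coset (weak_flag n M D (i - 1) x) ` weak_flag n M D i x"

definition carnot_bracket ::
    "nat \<Rightarrow> pt set \<Rightarrow> dist \<Rightarrow> pt \<Rightarrow> nat \<Rightarrow> nat \<Rightarrow> pt set \<Rightarrow> pt set \<Rightarrow> pt set"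
  where "carnot_bracket n M D x i j A B =
    \<Union>{coset (weak_flag n M D (i + j - 1) x) (lie_bracket n X Y x) | X Y W.
        openin (Euclidean_space n) W \<and> x \<in> W \<and> W \<subseteq> M \<and>
        X \<in> sections n W (weak_flag n M D i) \<and> Y \<in> sections n W (weak_flag n M D j) \<and>
        X x \<in> A \<and> Y x \<in> B}"

definition lie_algebra :: "nat \<Rightarrow> (pt \<Rightarrow> pt \<Rightarrow> pt) \<Rightarrow> bool"
  where "lie_algebra n br \<longleftrightarrow>
    bilinear br \<and>
    (\<forall>u\<in>Rn n. \<forall>v\<in>Rn n. br u v \<in> Rn n) \<and>
    (\<forall>u\<in>Rn n. br u u = 0) \<and>
    (\<forall>u\<in>Rn n. \<forall>v\<in>Rn n. \<forall>w\<in>Rn n. br u (br v w) + br v (br w u) + br w (br u v) = 0)"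

text \<open>
  A grading of a Lie algebra by negative degrees: \<open>g i\<close> is the component of degree \<open>-i\<close>.
  Nilpotency is automatic, the dimension being finite.
\<close>

definition graded_nilpotent_lie_algebra ::
    "nat \<Rightarrow> (nat \<Rightarrow> pt set) \<Rightarrow> (pt \<Rightarrow> pt \<Rightarrow> pt) \<Rightarrow> bool"
  where "graded_nilpotent_lie_algebra n g br \<longleftrightarrow>
    lie_algebra n br \<and>
    g 0 = {0} \<and> (\<forall>i. subspace (g i) \<and> g i \<subseteq> Rn n) \<and>
    (\<forall>v\<in>Rn n. \<exists>!c. (\<forall>i. c i \<in> g i) \<and> finite {i. c i \<noteq> 0} \<and> v = (\<Sum>i\<in>{i. c i \<noteq> 0}. c i)) \<and>
    (\<forall>i j. \<forall>u\<in>g i. \<forall>v\<in>g j. br u v \<in> g (i + j))"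

definition carnot_algebra_isomorphic ::
    "nat \<Rightarrow> pt set \<Rightarrow> dist \<Rightarrow> pt \<Rightarrow> (nat \<Rightarrow> pt set) \<Rightarrow> (pt \<Rightarrow> pt \<Rightarrow> pt) \<Rightarrow> bool"
  where "carnot_algebra_isomorphic n M D x g br \<longleftrightarrow>
    (\<exists>\<theta> :: nat \<Rightarrow> pt set \<Rightarrow> pt.
      (\<forall>i\<ge>1. bij_betw (\<theta> i) (carnot_space n M D x i) (g i)) \<and>
      (\<forall>i\<ge>1. \<forall>v \<in> weak_flag n M D i x. \<forall>w \<in> weak_flag n M D i x. \<forall>a b.
         \<theta> i (coset (weak_flag n M D (i - 1) x) (a *\<^sub>R v + b *\<^sub>R w)) =
           a *\<^sub>R \<theta> i (coset (weak_flag n M D (i - 1) x) v) +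
           b *\<^sub>R \<theta> i (coset (weak_flag n M D (i - 1) x) w)) \<and>
      (\<forall>i\<ge>1. \<forall>j\<ge>1. \<forall>A \<in> carnot_space n M D x i. \<forall>B \<in> carnot_space n M D x j.
         \<theta> (i + j) (carnot_bracket n M D x i j A B) = br (\<theta> i A) (\<theta> j B)))"

text \<open>
  Only Lie groups whose underlying manifold is \<open>\<real>\<^sup>n\<close> are needed: these are simply connected, and every
  simply connected nilpotent Lie group is of this form, by its exponential map. In the smoothness
  of the multiplication, a pair of points of \<open>\<real>\<^sup>n\<close> is a point of \<open>\<real>\<^sup>2\<^sup>n\<close>.
\<close>

definition lie_group :: "nat \<Rightarrow> pt monoid \<Rightarrow> bool"
  where "lie_group n G \<longleftrightarrow>
    group G \<and> carrier G = Rn n \<and>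
    smooth_map (n + n) (Rn (n + n)) n
      (\<lambda>z. (\<lambda>i. if i < n then z i else 0) \<otimes>\<^bsub>G\<^esub> (\<lambda>i. if i < n then z (n + i) else 0)) \<and>
    smooth_map n (Rn n) n (\<lambda>a. inv\<^bsub>G\<^esub> a)"

definition left_invariant_field :: "nat \<Rightarrow> pt monoid \<Rightarrow> pt \<Rightarrow> pt \<Rightarrow> pt"
  where "left_invariant_field n G u a = differential n (\<lambda>b. a \<otimes>\<^bsub>G\<^esub> b) \<one>\<^bsub>G\<^esub> u"

definition left_invariant_distribution :: "nat \<Rightarrow> pt monoid \<Rightarrow> pt set \<Rightarrow> dist"
  where "left_invariant_distribution n G S a = (\<lambda>u. left_invariant_field n G u a) ` S"

definition group_bracket :: "nat \<Rightarrow> pt monoid \<Rightarrow> pt \<Rightarrow> pt \<Rightarrow> pt"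
  where "group_bracket n G u v =
    lie_bracket n (left_invariant_field n G u) (left_invariant_field n G v) \<one>\<^bsub>G\<^esub>"

definition lie_algebra_isomorphism :: "nat \<Rightarrow> pt monoid \<Rightarrow> (pt \<Rightarrow> pt \<Rightarrow> pt) \<Rightarrow> (pt \<Rightarrow> pt) \<Rightarrow> bool"
  where "lie_algebra_isomorphism n G br \<psi> \<longleftrightarrow>
    linear \<psi> \<and> bij_betw \<psi> (Rn n) (Rn n) \<and>
    (\<forall>u\<in>Rn n. \<forall>v\<in>Rn n. \<psi> (group_bracket n G u v) = br (\<psi> u) (\<psi> v))"

definition flat :: "nat \<Rightarrow> pt set \<Rightarrow> dist \<Rightarrow> bool"
  where "flat n M D \<longleftrightarrow>
    (\<exists>g br. graded_nilpotent_lie_algebra n g br \<and>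
       (\<forall>x\<in>M. carnot_algebra_isomorphic n M D x g br) \<and>
       (\<exists>G \<psi>. lie_group n G \<and> lie_algebra_isomorphism n G br \<psi> \<and>
          (\<forall>x\<in>M. locally_equivalent_at x n M D n (carrier G)
             (left_invariant_distribution n G {u \<in> Rn n. \<psi> u \<in> g 1}))))"

text \<open>The coordinates \<open>x, y, z, z\<^sub>1, z\<^sub>2\<close> have the indices \<open>0, 1, 2, 3, 4\<close>.\<close>

definition hilbert_cartan :: dist
  where "hilbert_cartan p = span
    {(\<lambda>_. 0)(0 := 1, 1 := (p 4)\<^sup>2, 2 := p 3, 3 := p 4), (\<lambda>_. 0)(4 := 1)}"

definition integrable_extension ::
    "nat \<Rightarrow> pt set \<Rightarrow> dist \<Rightarrow> nat \<Rightarrow> pt set \<Rightarrow> dist \<Rightarrow> (pt \<Rightarrow> pt) \<Rightarrow> bool"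
  where "integrable_extension n' M' D' n M D \<pi> \<longleftrightarrow>
    (\<exists>k. nonholonomic_distribution n' M' k D') \<and>
    (\<exists>k. nonholonomic_distribution n M k D) \<and>
    smooth_map n' M' n \<pi> \<and> \<pi> ` M' \<subseteq> M \<and>
    (\<forall>x\<in>M'. differential n' \<pi> x ` Rn n' = Rn n) \<and>
    (\<forall>x\<in>M'. bij_betw (differential n' \<pi> x) (D' x) (D (\<pi> x))) \<and>
    (\<forall>x\<in>M'. weak_flag n' M' D' 2 x \<inter> {v \<in> Rn n'. differential n' \<pi> x v = 0} = {0})"

inductive successive_extension :: "nat \<Rightarrow> pt set \<Rightarrow> dist \<Rightarrow> bool" where
  base: "successive_extension 5 (Rn 5) hilbert_cartan"
| step: "successive_extension n M D \<Longrightarrow> integrable_extension n' M' D' n M D \<pi> \<Longrightarrow>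
    successive_extension n' M' D'"

end

theory Submission
  imports Defs
begin

text \<open>
  Near a given point the flat distribution is carried to a left-invariant one on a Lie group \<open>G\<close> whose
  Lie algebra \<open>m = g\<^sub>-\<^sub>1 + g\<^sub>-\<^sub>2 + \<dots>\<close> is graded. Pulling back the left-invariant fields gives a frame near the
  point with constant structure functions, in which the distribution is spanned by the fields with
  coefficient vectors in \<open>g\<^sub>-\<^sub>1\<close>.

  In such a frame a bracket of two sections is controlled by the algebra alone, up to derivatives of
  coefficient functions, which stay in any linear subspace that contains the coefficients
  (\<open>weak_flag_step\<close>). Hence \<open>\<Delta>\<^sub>2\<close> and \<open>\<Delta>\<^sub>3\<close> are spanned by the fields belonging to
  \<open>e\<^sub>1, e\<^sub>2, e\<^sub>3 = [e\<^sub>2, e\<^sub>1]\<close>, respectively to these and \<open>e\<^sub>4 = [e\<^sub>2, e\<^sub>3], e\<^sub>5 = [e\<^sub>1, e\<^sub>3]\<close>, where \<open>e\<^sub>1, e\<^sub>2\<close> span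
  \<open>g\<^sub>-\<^sub>1\<close>. The ranks 3 and 5 force these vectors to be independent, and complete non-holonomicity forces
  \<open>g\<^sub>-\<^sub>2\<close> and \<open>g\<^sub>-\<^sub>3\<close> to be spanned by \<open>e\<^sub>3\<close> and by \<open>e\<^sub>4, e\<^sub>5\<close>. So the quotient of \<open>m\<close> by the ideal of
  all lower degrees is the five-dimensional algebra with the basis \<open>e\<^sub>1, \<dots>, e\<^sub>5\<close> (\<open>hilbert_cartan_quotient\<close>). The
  Hilbert--Cartan distribution has a frame on \<open>\<real>\<^sup>5\<close> with these structure constants (\<open>hc_frame\<close>).

  The quotient homomorphism integrates to a map \<open>P\<close> from \<open>G\<close> to \<open>\<real>\<^sup>5\<close> that relates the left-invariant
  frame to the Hilbert--Cartan frame (\<open>homomorphism_integrates\<close>). No differential equation has to be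
  solved: the coordinates \<open>x, z\<^sub>2, z\<^sub>1, z, y\<close> of \<open>P\<close> have, one after the other, derivatives along the frame
  that are expressed by the previous coordinates, the Maurer--Cartan equations say that the
  corresponding one-forms are closed, and closed one-forms on \<open>\<real>\<^sup>n\<close>, which is the manifold underlying
  \<open>G\<close>, are exact (\<open>potential\<close>, \<open>closed_form_exact\<close>).

  Composed with the local equivalence, \<open>P\<close> becomes a submersion from a neighbourhood of the given point
  to \<open>\<real>\<^sup>5\<close>. Its differential is injective on the fields belonging to \<open>e\<^sub>1, e\<^sub>2, e\<^sub>3\<close>, that is, on \<open>\<Delta>\<^sub>2\<close>, and
  maps \<open>\<Delta>\<close> isomorphically to the Hilbert--Cartan distribution, so it is an integrable extension
  (\<open>integrable_extension_hilbert_cartan\<close>). Thus a single extension always suffices: the dimension of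
  the fibres is not restricted, and in dimension 5 the submersion is a local diffeomorphism.
\<close>

section \<open>Calculus on open subsets of coordinate spaces\<close>

abbreviation open_Rn :: "nat \<Rightarrow> pt set \<Rightarrow> bool"
  where "open_Rn n \<equiv> openin (Euclidean_space n)"

lemma Rn_iff: "x \<in> Rn n \<longleftrightarrow> (\<forall>i\<ge>n. x i = 0)"
  by (simp add: topspace_Euclidean_space)

lemma upd_in_Rn: "x \<in> Rn n \<Longrightarrow> i < n \<Longrightarrow> x(i := t) \<in> Rn n"
  by (auto simp: Rn_iff)

lemma openin_in_Rn: "open_Rn n U \<Longrightarrow> x \<in> U \<Longrightarrow> x \<in> Rn n"
  using openin_subset by blast

lemma Euclidean_space_top_of_set: "Euclidean_space n = top_of_set {x. \<forall>i\<ge>n. x i = 0}"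
  by (simp add: Euclidean_space_def euclidean_product_topology)

lemma continuous_map_Euclidean_iff:
  assumes "open_Rn n U"
  shows "continuous_map (subtopology (Euclidean_space n) U) euclideanreal f \<longleftrightarrow> continuous_on U f"
proof -
  have "{x. \<forall>i\<ge>n. x i = 0} \<inter> U = U"
    using openin_subset[OF assms] by (auto simp: Rn_iff)
  then show ?thesis
    by (simp add: Euclidean_space_top_of_set subtopology_subtopology)
qed

lemma openin_contains_box:
  assumes "open_Rn n U" "p \<in> U"
  obtains d where "d > 0" "\<And>q. q \<in> Rn n \<Longrightarrow> (\<And>k. k < n \<Longrightarrow> \<bar>q k - p k\<bar> < d) \<Longrightarrow> q \<in> U"
proof -
  obtain T where T: "open T" "U = {x. \<forall>i\<ge>n. x i = 0} \<inter> T"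
    using assms(1) unfolding Euclidean_space_top_of_set openin_open by blast
  have "openin (product_topology (\<lambda>i. euclidean) UNIV) T"
    using T(1) unfolding open_fun_def .
  moreover have "p \<in> T"
    using T(2) assms(2) by blast
  ultimately have "\<exists>X. p \<in> (\<Pi>\<^sub>E i\<in>UNIV. X i) \<and> (\<forall>i. openin euclidean (X i)) \<and>
      finite {i. X i \<noteq> topspace euclidean} \<and> (\<Pi>\<^sub>E i\<in>UNIV. X i) \<subseteq> T"
    by (rule product_topology_open_contains_basis)
  then obtain X where X: "p \<in> (\<Pi>\<^sub>E i\<in>UNIV. X i)" "\<And>i. openin euclidean (X i)"
      "(\<Pi>\<^sub>E i\<in>UNIV. X i) \<subseteq> T"
    by (elim exE conjE) blast
  have "\<exists>d>0. \<forall>k<m. \<forall>t. \<bar>t - p k\<bar> < d \<longrightarrow> t \<in> X k" for m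
  proof (induction m)
    case 0
    show ?case by (intro exI[of _ 1]) auto
  next
    case (Suc m)
    then obtain d where d: "d > 0" "\<forall>k<m. \<forall>t. \<bar>t - p k\<bar> < d \<longrightarrow> t \<in> X k" by blast
    have "open (X m)" "p m \<in> X m" using X by auto
    then obtain e where e: "e > 0" "\<And>t. dist t (p m) < e \<Longrightarrow> t \<in> X m"
      by (meson open_dist)
    show ?case
      using d e by (intro exI[of _ "min d e"]) (auto simp: less_Suc_eq dist_real_def)
  qed
  then obtain d where d: "d > 0" "\<forall>k<n. \<forall>t. \<bar>t - p k\<bar> < d \<longrightarrow> t \<in> X k" by blast
  show thesis
  proof (rule that[OF d(1)])
    fix q assume q: "q \<in> Rn n" "\<And>k. k < n \<Longrightarrow> \<bar>q k - p k\<bar> < d"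
    have "q k \<in> X k" for k
    proof (cases "k < n")
      case True then show ?thesis using q d by auto
    next
      case False
      then have "q k = p k" using q(1) openin_in_Rn[OF assms] by (simp add: Rn_iff)
      then show ?thesis using X(1) by auto
    qed
    then have "q \<in> T" using X(3) by blast
    then show "q \<in> U" using T(2) q(1) by (simp add: Rn_iff)
  qed
qed

lemma openin_preimage:
  assumes U: "open_Rn n U" and "continuous_on U g" "open T"
  shows "open_Rn n (U \<inter> g -` T)"
proof -
  have "openin (top_of_set U) (U \<inter> g -` T)"
    using assms(2,3) by (rule continuous_openin_preimage_gen)
  then show ?thesis
    using U unfolding Euclidean_space_top_of_set by (rule openin_trans)
qed

lemma openin_Rn: "open_Rn n (Rn n)"
  by simp

lemma tendsto_coordinate: "((\<lambda>q. q k) \<longlongrightarrow> p k) (at p within U)" for p :: pt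
proof -
  have "continuous_on UNIV (\<lambda>q::pt. q k)" by simp
  then show ?thesis
    by (metis UNIV_I continuous_on tendsto_within_subset top_greatest)
qed

lemma eventually_in_open_Rn:
  assumes "open_Rn n U" "p \<in> U"
    and "\<And>k. k < n \<Longrightarrow> ((\<lambda>t. \<gamma> t k) \<longlongrightarrow> p k) F" "\<forall>\<^sub>F t in F. \<gamma> t \<in> Rn n"
  shows "\<forall>\<^sub>F t in F. \<gamma> t \<in> U"
proof -
  obtain d where d: "d > 0" "\<And>q. q \<in> Rn n \<Longrightarrow> (\<And>k. k < n \<Longrightarrow> \<bar>q k - p k\<bar> < d) \<Longrightarrow> q \<in> U"
    using openin_contains_box[OF assms(1,2)] by blast
  have "\<forall>\<^sub>F t in F. \<forall>k\<in>{..<n}. \<bar>\<gamma> t k - p k\<bar> < d"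
    using assms(3) d(1) by (intro eventually_ball_finite) (auto simp: tendsto_iff dist_real_def)
  then show ?thesis using assms(4) by eventually_elim (auto intro: d(2))
qed

lemma eventually_slice_in:
  assumes "open_Rn n U" "x(i := t0) \<in> U" "i < n"
  shows "\<forall>\<^sub>F t in nhds t0. x(i := t) \<in> U"
proof (rule eventually_in_open_Rn[OF assms(1,2)])
  show "((\<lambda>t. (x(i := t)) k) \<longlongrightarrow> (x(i := t0)) k) (nhds t0)" for k
    by (cases "k = i") (auto simp: filterlim_ident)
  show "\<forall>\<^sub>F t in nhds t0. x(i := t) \<in> Rn n"
  proof (rule always_eventually, rule allI)
    fix t
    have "x(i := t) = (x(i := t0))(i := t)" by simp
    then show "x(i := t) \<in> Rn n"
      using openin_in_Rn[OF assms(1,2)] assms(3) upd_in_Rn by metis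
  qed
qed

lemma pd_cong:
  assumes "open_Rn n U" "x \<in> U" "i < n" "\<And>y. y \<in> U \<Longrightarrow> f y = g y"
  shows "pd i f x = pd i g x"
  unfolding pd_def
proof (rule deriv_cong_ev)
  have "\<forall>\<^sub>F t in nhds (x i). x(i := t) \<in> U"
    using assms eventually_slice_in[of n U x i "x i"] by simp
  then show "\<forall>\<^sub>F t in nhds (x i). f (x(i := t)) = g (x(i := t))"
    by eventually_elim (rule assms(4))
qed simp

subsection \<open>Smooth functions\<close>

lemma smooth_fun_continuous:
  assumes "smooth_fun n U f" "open_Rn n U"
  shows "continuous_on U f"
proof -
  have "continuous_map (subtopology (Euclidean_space n) U) euclideanreal (iterated_pd [] f)"
    using assms(1) unfolding smooth_fun_def by (metis lists.Nil)
  then show ?thesis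
    by (simp add: iterated_pd_def continuous_map_Euclidean_iff[OF assms(2)])
qed

lemma smooth_fun_deriv:
  assumes "smooth_fun n U f" "i < n" "x \<in> U"
  shows "((\<lambda>t. f (x(i := t))) has_real_derivative pd i f x) (at (x i))"
proof -
  have "(\<lambda>t. iterated_pd [] f (x(i := t))) differentiable (at (x i))"
    using assms unfolding smooth_fun_def by (metis lists.Nil)
  then show ?thesis
    by (simp add: iterated_pd_def pd_def DERIV_deriv_iff_real_differentiable)
qed

lemma smooth_fun_deriv_at:
  assumes "smooth_fun n U f" "i < n" "x(i := t0) \<in> U"
  shows "((\<lambda>t. f (x(i := t))) has_real_derivative pd i f (x(i := t0))) (at t0)"
  using smooth_fun_deriv[OF assms] by simp

lemma smooth_fun_pd:
  assumes "smooth_fun n U f" "i < n"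
  shows "smooth_fun n U (pd i f)"
  unfolding smooth_fun_def
proof
  fix js assume js: "js \<in> lists {..<n}"
  have "iterated_pd js (pd i f) = iterated_pd (js @ [i]) f"
    by (simp add: iterated_pd_def)
  moreover have "js @ [i] \<in> lists {..<n}" using js assms(2) by simp
  ultimately show "continuous_map (subtopology (Euclidean_space n) U) euclideanreal (iterated_pd js (pd i f)) \<and>
       (\<forall>k<n. \<forall>x\<in>U. (\<lambda>t. iterated_pd js (pd i f) (x(k := t))) differentiable (at (x k)))"
    using assms(1) unfolding smooth_fun_def by metis
qed

text \<open>Smoothness is the greatest predicate closed under taking partial derivatives, up to equality
  on the open set in question.\<close>

lemma smooth_fun_coinduct:
  assumes U: "open_Rn n U" and "P f"
    and cont: "\<And>f. P f \<Longrightarrow> continuous_on U f"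
    and deriv: "\<And>f i. P f \<Longrightarrow> i < n \<Longrightarrow>
      \<exists>g. P g \<and> (\<forall>x\<in>U. ((\<lambda>t. f (x(i := t))) has_real_derivative g x) (at (x i)))"
  shows "smooth_fun n U f"
proof -
  have *: "\<exists>g. P g \<and> (\<forall>x\<in>U. iterated_pd js f x = g x)" if "js \<in> lists {..<n}" for js
    using that
  proof (induction js)
    case Nil
    then show ?case using \<open>P f\<close> by (auto simp: iterated_pd_def)
  next
    case (Cons i js)
    then obtain g where g: "P g" "\<And>x. x \<in> U \<Longrightarrow> iterated_pd js f x = g x" by auto
    have i: "i < n" using Cons.hyps by simp
    from deriv[OF g(1) i] obtain h where h: "P h"
      "\<And>x. x \<in> U \<Longrightarrow> ((\<lambda>t. g (x(i := t))) has_real_derivative h x) (at (x i))" by auto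
    have "iterated_pd (i # js) f x = h x" if x: "x \<in> U" for x
    proof -
      have "iterated_pd (i # js) f x = pd i (iterated_pd js f) x" by (simp add: iterated_pd_def)
      also have "\<dots> = pd i g x" by (rule pd_cong[OF U x i]) (rule g(2))
      also have "\<dots> = h x" unfolding pd_def using h(2)[OF x] by (rule DERIV_imp_deriv)
      finally show ?thesis .
    qed
    then show ?case using h(1) by blast
  qed
  show ?thesis unfolding smooth_fun_def
  proof (intro ballI conjI allI impI)
    fix js assume "js \<in> lists {..<n}"
    from *[OF this] obtain g where g: "P g" "\<And>x. x \<in> U \<Longrightarrow> iterated_pd js f x = g x" by auto
    show "continuous_map (subtopology (Euclidean_space n) U) euclideanreal (iterated_pd js f)"
      using cont[OF g(1)] g(2) by (simp add: continuous_map_Euclidean_iff[OF U] cong: continuous_on_cong)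
    fix i x assume i: "i < n" and x: "x \<in> U"
    from deriv[OF g(1) i] obtain h where "((\<lambda>t. g (x(i := t))) has_real_derivative h x) (at (x i))"
      using x by auto
    moreover have "\<forall>\<^sub>F t in nhds (x i). iterated_pd js f (x(i := t)) = g (x(i := t))"
    proof -
      have "\<forall>\<^sub>F t in nhds (x i). x(i := t) \<in> U"
        using U x i eventually_slice_in[of n U x i "x i"] by simp
      then show ?thesis by eventually_elim (rule g(2))
    qed
    ultimately have "((\<lambda>t. iterated_pd js f (x(i := t))) has_real_derivative h x) (at (x i))"
      by (subst DERIV_cong_ev[OF refl _ refl])
    then show "(\<lambda>t. iterated_pd js f (x(i := t))) differentiable (at (x i))"
      using real_differentiable_def by blast
  qed
qed

lemma smooth_funI:
  assumes U: "open_Rn n U" and "continuous_on U f"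
    and "\<And>i x. i < n \<Longrightarrow> x \<in> U \<Longrightarrow> ((\<lambda>t. f (x(i := t))) has_real_derivative g i x) (at (x i))"
    and "\<And>i. i < n \<Longrightarrow> smooth_fun n U (g i)"
  shows "smooth_fun n U f"
proof (rule smooth_fun_coinduct[where P = "\<lambda>h. h = f \<or> smooth_fun n U h"])
  show "continuous_on U h" if "h = f \<or> smooth_fun n U h" for h
    using that assms(2) smooth_fun_continuous U by blast
  show "\<exists>g. (g = f \<or> smooth_fun n U g) \<and> (\<forall>x\<in>U. ((\<lambda>t. h (x(i := t))) has_real_derivative g x) (at (x i)))"
    if "h = f \<or> smooth_fun n U h" "i < n" for h i
    using that assms(3,4) smooth_fun_deriv smooth_fun_pd by metis
qed (use U in auto)

lemma smooth_fun_cong: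
  assumes U: "open_Rn n U" and "smooth_fun n U f" "\<And>x. x \<in> U \<Longrightarrow> f x = g x"
  shows "smooth_fun n U g"
proof (rule smooth_fun_coinduct[where P = "\<lambda>h. \<exists>f. smooth_fun n U f \<and> (\<forall>x\<in>U. f x = h x)"])
  show "continuous_on U h" if "\<exists>f. smooth_fun n U f \<and> (\<forall>x\<in>U. f x = h x)" for h
    using that smooth_fun_continuous[OF _ U] continuous_on_cong by metis
  fix h i assume "\<exists>f. smooth_fun n U f \<and> (\<forall>x\<in>U. f x = h x)" and i: "i < n"
  then obtain f where f: "smooth_fun n U f" "\<And>x. x \<in> U \<Longrightarrow> f x = h x" by blast
  have "((\<lambda>t. h (x(i := t))) has_real_derivative pd i f x) (at (x i))" if x: "x \<in> U" for x
  proof -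
    have "\<forall>\<^sub>F t in nhds (x i). x(i := t) \<in> U"
      using U x i eventually_slice_in[of n U x i "x i"] by simp
    then have "\<forall>\<^sub>F t in nhds (x i). f (x(i := t)) = h (x(i := t))"
      by eventually_elim (rule f(2))
    from DERIV_cong_ev[OF refl this refl] show ?thesis using smooth_fun_deriv[OF f(1) i x] by blast
  qed
  moreover have "smooth_fun n U (pd i f)" by (rule smooth_fun_pd[OF f(1) i])
  ultimately show "\<exists>g. (\<exists>f. smooth_fun n U f \<and> (\<forall>x\<in>U. f x = g x)) \<and>
      (\<forall>x\<in>U. ((\<lambda>t. h (x(i := t))) has_real_derivative g x) (at (x i)))" by blast
qed (use assms in auto)

lemma smooth_fun_subset:
  assumes "smooth_fun n U f" "open_Rn n U" "open_Rn n W" "W \<subseteq> U"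
  shows "smooth_fun n W f"
proof (rule smooth_fun_coinduct[where P = "smooth_fun n U"])
  show "continuous_on W h" if "smooth_fun n U h" for h
    using that smooth_fun_continuous assms continuous_on_subset by metis
  show "\<exists>g. smooth_fun n U g \<and> (\<forall>x\<in>W. ((\<lambda>t. h (x(i := t))) has_real_derivative g x) (at (x i)))"
    if "smooth_fun n U h" "i < n" for h i
    using that assms(4) smooth_fun_deriv smooth_fun_pd by blast
qed (use assms in auto)

lemma smooth_fun_const: 
  assumes U: "open_Rn n U" 
  shows "smooth_fun n U (\<lambda>x. c)"
proof (rule smooth_fun_coinduct[where P = "\<lambda>h. \<exists>c. h = (\<lambda>x. c)"])
  show "\<exists>g. (\<exists>c. g = (\<lambda>x. c)) \<and> (\<forall>x\<in>U. ((\<lambda>t. h (x(i := t))) has_real_derivative g x) (at (x i)))"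
    if "\<exists>c. h = (\<lambda>x. c)" for h :: "pt \<Rightarrow> real" and i
    using that by (intro exI[of _ "\<lambda>x. 0"]) auto
qed (use U in auto)

lemma smooth_fun_coordinate:
  assumes U: "open_Rn n U" 
  shows "smooth_fun n U (\<lambda>x. x k)"
proof (rule smooth_funI[OF U, where g = "\<lambda>i x. if i = k then 1 else 0"])
  show "continuous_on U (\<lambda>x. x k)"
    by (rule continuous_on_subset[OF continuous_on_product_coordinates]) simp
  show "((\<lambda>t. (x(i := t)) k) has_real_derivative (if i = k then 1 else 0)) (at (x i))" for i x
    by (cases "i = k") auto
qed (simp add: smooth_fun_const[OF U])

subsection \<open>Differentiability along curves and the chain rule\<close>

text \<open>A function with continuous partial derivatives is differentiable; the norm is the sum of the
  absolute values of the coordinates.\<close>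

lemma linear_approximation:
  assumes U: "open_Rn n U" and p: "p \<in> U"
    and deriv: "\<And>i x. i < n \<Longrightarrow> x \<in> U \<Longrightarrow> ((\<lambda>t. f (x(i := t))) has_real_derivative g i x) (at (x i))"
    and cont: "\<And>i. i < n \<Longrightarrow> continuous_on U (g i)"
    and "e > 0"
  obtains d where "d > 0" "\<And>q. q \<in> Rn n \<Longrightarrow> (\<And>k. k < n \<Longrightarrow> \<bar>q k - p k\<bar> < d) \<Longrightarrow> 
    q \<in> U \<and> \<bar>f q - f p - (\<Sum>k<n. g k p * (q k - p k))\<bar> \<le> e * (\<Sum>k<n. \<bar>q k - p k\<bar>)"
proof -
  define V where "V = {x\<in>U. \<forall>i\<in>{..<n}. g i x \<in> {g i p - e <..< g i p + e}}"
  have "V = \<Inter> (insert U ((\<lambda>i. U \<inter> g i -` {g i p - e <..< g i p + e}) ` {..<n}))"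
    unfolding V_def by auto
  moreover have "open_Rn n (U \<inter> g i -` {g i p - e <..< g i p + e})" if "i < n" for i
    by (rule openin_preimage[OF U cont[OF that]]) simp
  ultimately have V: "open_Rn n V"
    using U by (simp only:) (rule openin_Inter, auto)
  have pV: "p \<in> V" using p \<open>e > 0\<close> by (simp add: V_def)
  obtain d where d: "d > 0" "\<And>q. q \<in> Rn n \<Longrightarrow> (\<And>k. k < n \<Longrightarrow> \<bar>q k - p k\<bar> < d) \<Longrightarrow> q \<in> V"
    using openin_contains_box[OF V pV] by blast
  show thesis
  proof (rule that[OF d(1)])
    fix q assume q: "q \<in> Rn n" "\<And>k. k < n \<Longrightarrow> \<bar>q k - p k\<bar> < d"
    have pR: "p \<in> Rn n" by (rule openin_in_Rn[OF U p])
    \<comment> \<open>Pass from \<open>p\<close> to \<open>q\<close> by changing one coordinate at a time.\<close>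
    define r where "r j = (\<lambda>k. if k < j then q k else p k)" for j
    have step: "\<bar>f (r (Suc j)) - f (r j) - g j p * (q j - p j)\<bar> \<le> e * \<bar>q j - p j\<bar>" if j: "j < n" for j
    proof -
      define h where "h t = f ((r j)(j := p j + t * (q j - p j)))" for t
      have inV: "(r j)(j := p j + t * (q j - p j)) \<in> V" if t: "0 \<le> t" "t \<le> 1" for t
      proof (rule d(2))
        show "(r j)(j := p j + t * (q j - p j)) \<in> Rn n"
          using q(1) pR j by (auto simp: Rn_iff r_def)
        show "\<bar>((r j)(j := p j + t * (q j - p j))) k - p k\<bar> < d" if k: "k < n" for k
        proof -
          have "\<bar>t * (q j - p j)\<bar> \<le> \<bar>q j - p j\<bar>"
            using t by (simp add: abs_mult mult_left_le_one_le)
          then show ?thesis using q(2)[OF k] q(2)[OF j] d(1) by (auto simp: r_def)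
        qed
      qed
      have hd: "(h has_real_derivative (g j ((r j)(j := p j + t * (q j - p j)))) * (q j - p j)) (at t)"
        if t: "0 \<le> t" "t \<le> 1" for t
      proof -
        let ?y = "(r j)(j := p j + t * (q j - p j))"
        have "?y \<in> U" using inV[OF t] by (simp add: V_def)
        from deriv[OF j this]
        have "((\<lambda>s. f ((r j)(j := s))) has_real_derivative g j ?y) (at (p j + t * (q j - p j)))" by simp
        moreover have "((\<lambda>t. p j + t * (q j - p j)) has_real_derivative (q j - p j)) (at t)"
          by (auto intro!: derivative_eq_intros)
        ultimately show ?thesis unfolding h_def by (rule DERIV_chain2)
      qed
      obtain z where z: "0 < z" "z < 1" "h 1 - h 0 = (1 - 0) * (g j ((r j)(j := p j + z * (q j - p j))) * (q j - p j))"
        using MVT2[of 0 1 h "\<lambda>t. g j ((r j)(j := p j + t * (q j - p j))) * (q j - p j)"] hd by auto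
      have "(r j)(j := p j + 1 * (q j - p j)) = r (Suc j)" "(r j)(j := p j + 0 * (q j - p j)) = r j"
        by (auto simp: r_def fun_eq_iff)
      then have "h 1 = f (r (Suc j))" "h 0 = f (r j)" by (simp_all only: h_def)
      with z(3) have "f (r (Suc j)) - f (r j) - g j p * (q j - p j) =
          (g j ((r j)(j := p j + z * (q j - p j))) - g j p) * (q j - p j)"
        by (simp add: algebra_simps)
      moreover have "\<bar>g j ((r j)(j := p j + z * (q j - p j))) - g j p\<bar> \<le> e"
      proof -
        have "(r j)(j := p j + z * (q j - p j)) \<in> V" using inV z(1,2) by simp
        then have "g j ((r j)(j := p j + z * (q j - p j))) \<in> {g j p - e <..< g j p + e}"
          unfolding V_def using j by blast
        then show ?thesis by (simp add: abs_le_iff)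
      qed
      ultimately show ?thesis
        by (simp add: abs_mult mult_right_mono)
    qed
    have "r n = q" using q(1) pR by (auto simp: r_def Rn_iff fun_eq_iff)
    moreover have "r 0 = p" by (simp add: r_def)
    ultimately have "f q - f p = (\<Sum>j<n. f (r (Suc j)) - f (r j))"
      using sum_lessThan_telescope[of "\<lambda>j. f (r j)" n] by simp
    then have "\<bar>f q - f p - (\<Sum>k<n. g k p * (q k - p k))\<bar> =
        \<bar>\<Sum>j<n. f (r (Suc j)) - f (r j) - g j p * (q j - p j)\<bar>"
      by (simp add: sum_subtractf)
    also have "\<dots> \<le> (\<Sum>j<n. e * \<bar>q j - p j\<bar>)"
      by (rule order_trans[OF sum_abs]) (rule sum_mono, simp add: step)
    finally show "q \<in> U \<and> \<bar>f q - f p - (\<Sum>k<n. g k p * (q k - p k))\<bar> \<le> e * (\<Sum>k<n. \<bar>q k - p k\<bar>)"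
      using d(2)[OF q] by (simp add: V_def sum_distrib_left)
  qed
qed

lemma continuous_on_of_partials:
  assumes U: "open_Rn n U"
    and deriv: "\<And>i x. i < n \<Longrightarrow> x \<in> U \<Longrightarrow> ((\<lambda>t. f (x(i := t))) has_real_derivative g i x) (at (x i))"
    and cont: "\<And>i. i < n \<Longrightarrow> continuous_on U (g i)"
  shows "continuous_on U f"
  unfolding continuous_on
proof
  fix p assume p: "p \<in> U"
  obtain d where d: "d > 0" "\<And>q. q \<in> Rn n \<Longrightarrow> (\<And>k. k < n \<Longrightarrow> \<bar>q k - p k\<bar> < d) \<Longrightarrow> 
    q \<in> U \<and> \<bar>f q - f p - (\<Sum>k<n. g k p * (q k - p k))\<bar> \<le> 1 * (\<Sum>k<n. \<bar>q k - p k\<bar>)"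
    using linear_approximation[OF U p deriv cont, of 1] by auto
  have "\<forall>\<^sub>F q in at p within U. q \<in> U"
    by (simp add: eventually_at_topological) blast
  moreover have "\<forall>\<^sub>F q in at p within U. \<forall>k\<in>{..<n}. \<bar>q k - p k\<bar> < d"
    using tendsto_coordinate d(1) by (intro eventually_ball_finite) (auto simp: tendsto_iff dist_real_def)
  ultimately have "\<forall>\<^sub>F q in at p within U. norm (f q - f p) \<le>
      (\<Sum>k<n. \<bar>q k - p k\<bar>) + \<bar>\<Sum>k<n. g k p * (q k - p k)\<bar>"
  proof eventually_elim
    case (elim q)
    then show ?case using d(2)[of q] openin_in_Rn[OF U] by fastforce
  qed
  moreover have "((\<lambda>q. (\<Sum>k<n. \<bar>q k - p k\<bar>) + \<bar>\<Sum>k<n. g k p * (q k - p k)\<bar>) \<longlongrightarrow>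
      (\<Sum>k<n. \<bar>p k - p k\<bar>) + \<bar>\<Sum>k<n. g k p * (p k - p k)\<bar>) (at p within U)"
    by (intro tendsto_intros tendsto_coordinate)
  ultimately have "((\<lambda>q. f q - f p) \<longlongrightarrow> 0) (at p within U)"
    by (rule Lim_null_comparison[OF _ tendsto_eq_rhs]) simp
  then show "(f \<longlongrightarrow> f p) (at p within U)"
    by (rule LIM_zero_cancel)
qed

lemma deriv_along_curve:
  assumes U: "open_Rn n U" and p: "\<gamma> t0 \<in> U"
    and deriv: "\<And>i x. i < n \<Longrightarrow> x \<in> U \<Longrightarrow> ((\<lambda>t. f (x(i := t))) has_real_derivative g i x) (at (x i))"
    and cont: "\<And>i. i < n \<Longrightarrow> continuous_on U (g i)"
    and inR: "\<forall>\<^sub>F t in at t0. \<gamma> t \<in> Rn n"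
    and \<gamma>: "\<And>k. k < n \<Longrightarrow> ((\<lambda>t. \<gamma> t k) has_real_derivative c k) (at t0)"
  shows "((\<lambda>t. f (\<gamma> t)) has_real_derivative (\<Sum>k<n. c k * g k (\<gamma> t0))) (at t0)"
proof -
  let ?p = "\<gamma> t0"
  define L where "L t = f (\<gamma> t) - f ?p - (\<Sum>k<n. g k ?p * (\<gamma> t k - ?p k))" for t
  define N where "N t = (\<Sum>k<n. \<bar>(\<gamma> t k - ?p k) / (t - t0)\<bar>)" for t
  have quot: "((\<lambda>t. (\<gamma> t k - ?p k) / (t - t0)) \<longlongrightarrow> c k) (at t0)" if "k < n" for k
    using \<gamma>[OF that] by (simp add: has_field_derivative_iff)
  have Nlim: "(N \<longlongrightarrow> (\<Sum>k<n. \<bar>c k\<bar>)) (at t0)"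
    unfolding N_def by (intro tendsto_intros quot) auto
  have clim: "((\<lambda>t. \<gamma> t k) \<longlongrightarrow> ?p k) (at t0)" if "k < n" for k
    using \<gamma>[OF that] DERIV_isCont isCont_def by blast
  have "((\<lambda>t. L t / (t - t0)) \<longlongrightarrow> 0) (at t0)"
    unfolding tendsto_iff
  proof (intro allI impI)
    fix e :: real assume e: "e > 0"
    define C where "C = (\<Sum>k<n. \<bar>c k\<bar>) + 1"
    have C: "C > 0" unfolding C_def by (simp add: add_nonneg_pos sum_nonneg)
    obtain d where d: "d > 0" "\<And>q. q \<in> Rn n \<Longrightarrow> (\<And>k. k < n \<Longrightarrow> \<bar>q k - ?p k\<bar> < d) \<Longrightarrow> 
      q \<in> U \<and> \<bar>f q - f ?p - (\<Sum>k<n. g k ?p * (q k - ?p k))\<bar> \<le> (e / C) * (\<Sum>k<n. \<bar>q k - ?p k\<bar>)"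
      using linear_approximation[OF U p deriv cont, of "e / C"] e C by auto
    have "\<forall>\<^sub>F t in at t0. \<forall>k\<in>{..<n}. \<bar>\<gamma> t k - ?p k\<bar> < d"
      using clim d(1) by (intro eventually_ball_finite) (auto simp: tendsto_iff dist_real_def)
    moreover have "\<forall>\<^sub>F t in at t0. N t < C"
      using order_tendstoD(2)[OF Nlim, of C] by (simp add: C_def)
    moreover have "\<forall>\<^sub>F t in at t0. t \<noteq> t0"
      by (simp add: eventually_at_filter)
    ultimately show "\<forall>\<^sub>F t in at t0. dist (L t / (t - t0)) 0 < e"
      using inR
    proof eventually_elim
      case (elim t)
      have "\<bar>L t\<bar> \<le> (e / C) * (\<Sum>k<n. \<bar>\<gamma> t k - ?p k\<bar>)"
        unfolding L_def using d(2)[of "\<gamma> t"] elim by auto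
      then have "\<bar>L t\<bar> / \<bar>t - t0\<bar> \<le> (e / C) * (\<Sum>k<n. \<bar>\<gamma> t k - ?p k\<bar>) / \<bar>t - t0\<bar>"
        by (rule divide_right_mono) simp
      also have "\<dots> = (e / C) * N t"
        by (simp only: N_def sum_divide_distrib abs_divide times_divide_eq_right [symmetric])
      also have "\<dots> < (e / C) * C"
        using elim e C by (intro mult_strict_left_mono) auto
      also have "\<dots> = e" using C by simp
      finally show ?case by (simp add: abs_divide)
    qed
  qed
  moreover have "((\<lambda>t. \<Sum>k<n. g k ?p * ((\<gamma> t k - ?p k) / (t - t0))) \<longlongrightarrow> (\<Sum>k<n. g k ?p * c k)) (at t0)"
    by (intro tendsto_intros quot) auto
  ultimately have "((\<lambda>t. L t / (t - t0) + (\<Sum>k<n. g k ?p * ((\<gamma> t k - ?p k) / (t - t0)))) \<longlongrightarrow>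
      0 + (\<Sum>k<n. g k ?p * c k)) (at t0)"
    by (rule tendsto_add)
  moreover have "L t / (t - t0) + (\<Sum>k<n. g k ?p * ((\<gamma> t k - ?p k) / (t - t0))) =
      (f (\<gamma> t) - f ?p) / (t - t0)" for t
  proof -
    have "(\<Sum>k<n. g k ?p * ((\<gamma> t k - ?p k) / (t - t0))) = (\<Sum>k<n. g k ?p * (\<gamma> t k - ?p k)) / (t - t0)"
      by (simp add: sum_divide_distrib)
    then show ?thesis by (simp add: L_def diff_divide_distrib)
  qed
  ultimately show ?thesis
    by (simp add: has_field_derivative_iff mult.commute)
qed

lemma smooth_fun_deriv_curve:
  assumes "open_Rn n U" "\<gamma> t0 \<in> U" "smooth_fun n U f"
    and "\<forall>\<^sub>F t in at t0. \<gamma> t \<in> Rn n"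
    and "\<And>k. k < n \<Longrightarrow> ((\<lambda>t. \<gamma> t k) has_real_derivative c k) (at t0)"
  shows "((\<lambda>t. f (\<gamma> t)) has_real_derivative (\<Sum>k<n. c k * pd k f (\<gamma> t0))) (at t0)"
  by (rule deriv_along_curve[OF assms(1,2) _ _ assms(4,5)])
    (simp_all add: smooth_fun_deriv[OF assms(3)] smooth_fun_continuous[OF smooth_fun_pd[OF assms(3)] assms(1)]
      del: fun_upd_apply)

subsection \<open>Mixed partial derivatives commute\<close>

lemma continuous_on_box:
  assumes U: "open_Rn n U" and p: "p \<in> U" and g: "continuous_on U g" and "e > (0::real)"
  obtains d where "d > 0" "\<And>q. q \<in> Rn n \<Longrightarrow> (\<And>k. k < n \<Longrightarrow> \<bar>q k - p k\<bar> < d) \<Longrightarrow> 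
    q \<in> U \<and> \<bar>g q - g p\<bar> < e"
proof -
  define W where "W = U \<inter> g -` {g p - e <..< g p + e}"
  have W: "open_Rn n W"
    unfolding W_def by (rule openin_preimage[OF U g]) simp
  have "p \<in> W" using p \<open>e > 0\<close> by (simp add: W_def)
  then obtain d where d: "d > 0" "\<And>q. q \<in> Rn n \<Longrightarrow> (\<And>k. k < n \<Longrightarrow> \<bar>q k - p k\<bar> < d) \<Longrightarrow> q \<in> W"
    using openin_contains_box[OF W] by blast
  show thesis
  proof (rule that[OF d(1)])
    fix q assume "q \<in> Rn n" "\<And>k. k < n \<Longrightarrow> \<bar>q k - p k\<bar> < d"
    then have "q \<in> W" by (rule d(2))
    then show "q \<in> U \<and> \<bar>g q - g p\<bar> < e" by (auto simp: W_def)
  qed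
qed

text \<open>The second difference over a square, expressed by two applications of the mean value theorem. Its
  symmetry in the two directions yields the symmetry of the second derivatives.\<close>

lemma mixed_difference:
  assumes f: "smooth_fun n U f" and ij: "i < n" "j < n" "i \<noteq> j" and h: "h > 0"
    and box: "\<And>s t. s \<in> {p i..p i + h} \<Longrightarrow> t \<in> {p j..p j + h} \<Longrightarrow> p(i := s, j := t) \<in> U"
  obtains s t where "s \<in> {p i..p i + h}" "t \<in> {p j..p j + h}"
    "f (p(i := p i + h, j := p j + h)) - f (p(i := p i + h)) - f (p(j := p j + h)) + f p =
      h * h * pd j (pd i f) (p(i := s, j := t))"
proof -
  have tw: "p(i := s, j := t) = p(j := t, i := s)" for s t
    using ij(3) by (rule fun_upd_twist)
  define g where "g s = f (p(i := s, j := p j + h)) - f (p(i := s, j := p j))" for s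
  have "(g has_real_derivative pd i f (p(i := s, j := p j + h)) - pd i f (p(i := s, j := p j))) (at s)"
    if s: "p i \<le> s" "s \<le> p i + h" for s
    unfolding g_def tw
  proof (rule DERIV_diff)
    show "((\<lambda>s. f (p(j := p j + h, i := s))) has_real_derivative pd i f (p(j := p j + h, i := s))) (at s)"
      using box[of s "p j + h"] s h by (intro smooth_fun_deriv_at[OF f ij(1)]) (simp add: tw)
    show "((\<lambda>s. f (p(j := p j, i := s))) has_real_derivative pd i f (p(j := p j, i := s))) (at s)"
      using box[of s "p j"] s h by (intro smooth_fun_deriv_at[OF f ij(1)]) (simp add: tw)
  qed
  then obtain s where s: "p i < s" "s < p i + h" "g (p i + h) - g (p i) =
      (p i + h - p i) * (pd i f (p(i := s, j := p j + h)) - pd i f (p(i := s, j := p j)))"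
    using MVT2[of "p i" "p i + h" g "\<lambda>s. pd i f (p(i := s, j := p j + h)) - pd i f (p(i := s, j := p j))"] h
    by auto
  have "((\<lambda>t. pd i f (p(i := s, j := t))) has_real_derivative pd j (pd i f) (p(i := s, j := t))) (at t)"
    if t: "p j \<le> t" "t \<le> p j + h" for t
    using box[of s t] s t by (intro smooth_fun_deriv_at[OF smooth_fun_pd[OF f ij(1)] ij(2)]) auto
  then obtain t where t: "p j < t" "t < p j + h" "pd i f (p(i := s, j := p j + h)) - pd i f (p(i := s, j := p j)) =
      (p j + h - p j) * pd j (pd i f) (p(i := s, j := t))"
    using MVT2[of "p j" "p j + h" "\<lambda>t. pd i f (p(i := s, j := t))" "\<lambda>t. pd j (pd i f) (p(i := s, j := t))"] h
    by auto
  have e: "p(i := p i + h, j := p j) = p(i := p i + h)" "p(i := p i, j := p j + h) = p(j := p j + h)"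
    "p(i := p i, j := p j) = p"
    using ij(3) by (auto simp: fun_eq_iff)
  have "g (p i + h) - g (p i) = f (p(i := p i + h, j := p j + h)) - f (p(i := p i + h)) - f (p(j := p j + h)) + f p"
    unfolding g_def e by simp
  with s(3) t(3) have "f (p(i := p i + h, j := p j + h)) - f (p(i := p i + h)) - f (p(j := p j + h)) + f p =
      h * h * pd j (pd i f) (p(i := s, j := t))"
    by simp
  then show thesis using that[of s t] s t by auto
qed

lemma pd_commute:
  assumes U: "open_Rn n U" and f: "smooth_fun n U f" and ij: "i < n" "j < n" and p: "p \<in> U"
  shows "pd i (pd j f) p = pd j (pd i f) p"
proof (cases "i = j")
  case False
  have pR: "p \<in> Rn n" by (rule openin_in_Rn[OF U p])
  have "\<bar>pd j (pd i f) p - pd i (pd j f) p\<bar> \<le> 0 + e" if e: "e > 0" for e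
  proof -
    have "continuous_on U (pd j (pd i f))" "continuous_on U (pd i (pd j f))"
      by (intro smooth_fun_continuous[OF _ U] smooth_fun_pd f ij)+
    from continuous_on_box[OF U p this(1), of "e/2"] continuous_on_box[OF U p this(2), of "e/2"] e
    obtain d1 d2 where 
      d1: "d1 > 0" "\<And>q. q \<in> Rn n \<Longrightarrow> (\<And>k. k < n \<Longrightarrow> \<bar>q k - p k\<bar> < d1) \<Longrightarrow> 
         q \<in> U \<and> \<bar>pd j (pd i f) q - pd j (pd i f) p\<bar> < e/2" and
      d2: "d2 > 0" "\<And>q. q \<in> Rn n \<Longrightarrow> (\<And>k. k < n \<Longrightarrow> \<bar>q k - p k\<bar> < d2) \<Longrightarrow> 
         q \<in> U \<and> \<bar>pd i (pd j f) q - pd i (pd j f) p\<bar> < e/2"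
      by (metis half_gt_zero)
    define h where "h = min d1 d2 / 2"
    have h: "h > 0" "h < d1" "h < d2" using d1(1) d2(1) by (auto simp: h_def min_def)
    have near: "p(i := s, j := t) \<in> Rn n" "\<bar>(p(i := s, j := t)) k - p k\<bar> < d1" 
        "\<bar>(p(i := s, j := t)) k - p k\<bar> < d2"
      if "s \<in> {p i..p i + h}" "t \<in> {p j..p j + h}" for s t k
      using that h d1(1) d2(1) pR ij by (auto simp: Rn_iff)
    have tw: "p(j := t, i := s) = p(i := s, j := t)" for s t
      using False by (intro fun_upd_twist) auto
    have box: "p(i := s, j := t) \<in> U" if "s \<in> {p i..p i + h}" "t \<in> {p j..p j + h}" for s t
      using d1(2)[of "p(i := s, j := t)"] near[OF that] by blast
    obtain s t where st: "s \<in> {p i..p i + h}" "t \<in> {p j..p j + h}"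
      "f (p(i := p i + h, j := p j + h)) - f (p(i := p i + h)) - f (p(j := p j + h)) + f p =
        h * h * pd j (pd i f) (p(i := s, j := t))"
      using mixed_difference[OF f ij False h(1) box] by blast
    obtain t' s' where st': "t' \<in> {p j..p j + h}" "s' \<in> {p i..p i + h}" 
      "f (p(j := p j + h, i := p i + h)) - f (p(j := p j + h)) - f (p(i := p i + h)) + f p =
        h * h * pd i (pd j f) (p(j := t', i := s'))"
      using mixed_difference[OF f ij(2,1) _ h(1), of p] box False tw by metis
    have "h * h * pd j (pd i f) (p(i := s, j := t)) = h * h * pd i (pd j f) (p(i := s', j := t'))"
      using st(3) st'(3) unfolding tw by linarith
    then have "pd j (pd i f) (p(i := s, j := t)) = pd i (pd j f) (p(i := s', j := t'))"
      using h(1) by simp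
    moreover have "\<bar>pd j (pd i f) (p(i := s, j := t)) - pd j (pd i f) p\<bar> < e/2"
      using d1(2) near[OF st(1,2)] by blast
    moreover have "\<bar>pd i (pd j f) (p(i := s', j := t')) - pd i (pd j f) p\<bar> < e/2"
      using d2(2) near[OF st'(2,1)] by blast
    ultimately show ?thesis by (simp only: abs_le_iff abs_less_iff) linarith
  qed
  then have "\<bar>pd j (pd i f) p - pd i (pd j f) p\<bar> \<le> 0" by (rule field_le_epsilon)
  then show ?thesis by simp
qed simp

subsection \<open>Sums, products and compositions of smooth functions\<close>

lemma smooth_map_component:
  assumes U: "open_Rn n U" and \<phi>: "smooth_map n U m \<phi>"
  shows "smooth_fun n U (\<lambda>x. \<phi> x k)"
proof (cases "k < m")
  case True
  then show ?thesis using \<phi> by (simp add: smooth_map_def)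
next
  case False
  then have "0 = \<phi> x k" if "x \<in> U" for x
    using \<phi> that by (auto simp: smooth_map_def Rn_iff image_subset_iff)
  then show ?thesis by (rule smooth_fun_cong[OF U smooth_fun_const[OF U]])
qed

lemma smooth_map_continuous:
  assumes U: "open_Rn n U" and \<phi>: "smooth_map n U m \<phi>"
  shows "continuous_on U \<phi>"
  by (intro continuous_on_coordinatewise_then_product smooth_fun_continuous[OF smooth_map_component[OF U \<phi>] U])

lemma smooth_map_in_Rn: "smooth_map n U m \<phi> \<Longrightarrow> x \<in> U \<Longrightarrow> \<phi> x \<in> Rn m"
  by (auto simp: smooth_map_def)

lemma deriv_compose:
  assumes U: "open_Rn n U" and V: "open_Rn m V"
    and \<phi>: "smooth_map n U m \<phi>" "\<phi> ` U \<subseteq> V" and f: "smooth_fun m V f" and i: "i < n" and x: "x \<in> U"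
  shows "((\<lambda>t. f (\<phi> (x(i := t)))) has_real_derivative (\<Sum>k<m. pd i (\<lambda>y. \<phi> y k) x * pd k f (\<phi> x))) (at (x i))"
proof -
  have "\<forall>\<^sub>F t in nhds (x i). x(i := t) \<in> U"
    using eventually_slice_in[OF U _ i, of x "x i"] x by simp
  then have "\<forall>\<^sub>F t in nhds (x i). \<phi> (x(i := t)) \<in> Rn m"
    by eventually_elim (rule smooth_map_in_Rn[OF \<phi>(1)])
  then have "\<forall>\<^sub>F t in at (x i). \<phi> (x(i := t)) \<in> Rn m"
    by (auto simp: eventually_at_filter elim: eventually_mono)
  from smooth_fun_deriv_curve[where \<gamma> = "\<lambda>t. \<phi> (x(i := t))", OF V _ f this]
  show ?thesis
    using smooth_fun_deriv[OF smooth_map_component[OF U \<phi>(1)] i x] x \<phi>(2) by auto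
qed

text \<open>The algebra generated by the smooth functions and the pullbacks of smooth functions under
  \<open>\<phi>\<close>. By the product and chain rules it is stable under partial differentiation, so that it
  consists of smooth functions.\<close>

inductive pullback_algebra :: "nat \<Rightarrow> pt set \<Rightarrow> nat \<Rightarrow> pt set \<Rightarrow> (pt \<Rightarrow> pt) \<Rightarrow> (pt \<Rightarrow> real) \<Rightarrow> bool"
  for n U m V \<phi> where
  base: "smooth_fun n U f \<Longrightarrow> pullback_algebra n U m V \<phi> f"
| pull: "smooth_fun m V f \<Longrightarrow> pullback_algebra n U m V \<phi> (\<lambda>x. f (\<phi> x))"
| add: "pullback_algebra n U m V \<phi> f \<Longrightarrow> pullback_algebra n U m V \<phi> g \<Longrightarrow>
    pullback_algebra n U m V \<phi> (\<lambda>x. f x + g x)"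
| mult: "pullback_algebra n U m V \<phi> f \<Longrightarrow> pullback_algebra n U m V \<phi> g \<Longrightarrow>
    pullback_algebra n U m V \<phi> (\<lambda>x. f x * g x)"

lemma pullback_algebra_sum:
  assumes U: "open_Rn n U" and "\<And>k. k < (l::nat) \<Longrightarrow> pullback_algebra n U m V \<phi> (f k)"
  shows "pullback_algebra n U m V \<phi> (\<lambda>x. \<Sum>k<l. f k x)"
  using assms(2)
proof (induction l)
  case 0
  show ?case using smooth_fun_const[OF U, of 0] by (simp add: pullback_algebra.base)
next
  case (Suc l)
  then show ?case by (simp add: pullback_algebra.add)
qed

lemma pullback_algebra_smooth:
  assumes U: "open_Rn n U" and V: "open_Rn m V"
    and \<phi>: "smooth_map n U m \<phi>" "\<phi> ` U \<subseteq> V" and "pullback_algebra n U m V \<phi> f"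
  shows "smooth_fun n U f"
proof (rule smooth_fun_coinduct[OF U, where P = "pullback_algebra n U m V \<phi>"])
  show "pullback_algebra n U m V \<phi> f" by fact
  show "continuous_on U f" if "pullback_algebra n U m V \<phi> f" for f
    using that
  proof induction
    case (base f)
    then show ?case by (rule smooth_fun_continuous[OF _ U])
  next
    case (pull f)
    show ?case
      by (rule continuous_on_compose2[OF smooth_fun_continuous[OF pull V] smooth_map_continuous[OF U \<phi>(1)] \<phi>(2)])
  qed (auto intro: continuous_intros)
  show "\<exists>g. pullback_algebra n U m V \<phi> g \<and> (\<forall>x\<in>U. ((\<lambda>t. f (x(i := t))) has_real_derivative g x) (at (x i)))"
    if "pullback_algebra n U m V \<phi> f" "i < n" for f i
    using that(1)
  proof induction
    case (base f)
    then show ?case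
      using smooth_fun_deriv[OF base that(2)] smooth_fun_pd[OF base that(2)] pullback_algebra.base by blast
  next
    case (pull f)
    have "pullback_algebra n U m V \<phi> (\<lambda>x. \<Sum>k<m. pd i (\<lambda>y. \<phi> y k) x * pd k f (\<phi> x))"
      by (intro pullback_algebra_sum[OF U] pullback_algebra.mult pullback_algebra.base pullback_algebra.pull
          smooth_fun_pd smooth_map_component[OF U \<phi>(1)] pull that(2))
    then show ?case using deriv_compose[OF U V \<phi> pull that(2)] by blast
  next
    case (add f g)
    then obtain f' g' where *: "pullback_algebra n U m V \<phi> f'" "pullback_algebra n U m V \<phi> g'"
      "\<And>x. x \<in> U \<Longrightarrow> ((\<lambda>t. f (x(i := t))) has_real_derivative f' x) (at (x i))"
      "\<And>x. x \<in> U \<Longrightarrow> ((\<lambda>t. g (x(i := t))) has_real_derivative g' x) (at (x i))" by blast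
    then show ?case
      by (intro exI[of _ "\<lambda>x. f' x + g' x"] conjI ballI pullback_algebra.add DERIV_add)
  next
    case (mult f g)
    then obtain f' g' where *: "pullback_algebra n U m V \<phi> f'" "pullback_algebra n U m V \<phi> g'"
      "\<And>x. x \<in> U \<Longrightarrow> ((\<lambda>t. f (x(i := t))) has_real_derivative f' x) (at (x i))"
      "\<And>x. x \<in> U \<Longrightarrow> ((\<lambda>t. g (x(i := t))) has_real_derivative g' x) (at (x i))" by blast
    have "((\<lambda>t. f (x(i := t)) * g (x(i := t))) has_real_derivative f' x * g x + g' x * f x) (at (x i))"
      if "x \<in> U" for x
      using DERIV_mult[OF *(3,4)[OF that]] by simp
    then show ?case
      using * mult.hyps by (intro exI[of _ "\<lambda>x. f' x * g x + g' x * f x"] conjI ballI pullback_algebra.add pullback_algebra.mult)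
  qed
qed

lemma smooth_fun_compose:
  assumes "open_Rn n U" "open_Rn m V"
    "smooth_map n U m \<phi>" "\<phi> ` U \<subseteq> V" "smooth_fun m V f"
  shows "smooth_fun n U (\<lambda>x. f (\<phi> x))"
  by (rule pullback_algebra_smooth[OF assms(1-4)]) (rule pullback_algebra.pull[OF assms(5)])

lemma smooth_map_id: "open_Rn n U \<Longrightarrow> smooth_map n U n (\<lambda>x. x)"
  using openin_subset by (auto simp: smooth_map_def smooth_fun_coordinate)

context
  fixes n U
  assumes U: "open_Rn n U"
begin

lemma smooth_fun_add:
  assumes "smooth_fun n U f" "smooth_fun n U g"
  shows "smooth_fun n U (\<lambda>x. f x + g x)"
  by (rule pullback_algebra_smooth[OF U U smooth_map_id[OF U]])
    (auto intro: pullback_algebra.add pullback_algebra.base assms)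

lemma smooth_fun_mult:
  assumes "smooth_fun n U f" "smooth_fun n U g"
  shows "smooth_fun n U (\<lambda>x. f x * g x)"
  by (rule pullback_algebra_smooth[OF U U smooth_map_id[OF U]])
    (auto intro: pullback_algebra.mult pullback_algebra.base assms)

lemma smooth_fun_sum:
  assumes "\<And>k. k < (l::nat) \<Longrightarrow> smooth_fun n U (f k)"
  shows "smooth_fun n U (\<lambda>x. \<Sum>k<l. f k x)"
  using assms by (induction l) (auto intro: smooth_fun_const[OF U] smooth_fun_add)

lemma smooth_fun_uminus:
  assumes "smooth_fun n U f"
  shows "smooth_fun n U (\<lambda>x. - f x)"
  using smooth_fun_mult[OF smooth_fun_const[OF U, of "-1"] assms] by simp

lemma smooth_fun_diff:
  assumes "smooth_fun n U f" "smooth_fun n U g"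
  shows "smooth_fun n U (\<lambda>x. f x - g x)"
  using smooth_fun_add[OF assms(1) smooth_fun_uminus[OF assms(2)]] by simp

lemma pd_add:
  assumes "smooth_fun n U f" "smooth_fun n U g" "i < n" "x \<in> U"
  shows "pd i (\<lambda>x. f x + g x) x = pd i f x + pd i g x"
  unfolding pd_def[of i "\<lambda>x. f x + g x"]
  by (intro DERIV_imp_deriv DERIV_add smooth_fun_deriv[where n = n and U = U] assms)

lemma pd_mult:
  assumes "smooth_fun n U f" "smooth_fun n U g" "i < n" "x \<in> U"
  shows "pd i (\<lambda>x. f x * g x) x = pd i f x * g x + f x * pd i g x"
proof -
  have "pd i (\<lambda>x. f x * g x) x = pd i f x * g (x(i := x i)) + pd i g x * f (x(i := x i))"
    unfolding pd_def[of i "\<lambda>x. f x * g x"]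
    by (intro DERIV_imp_deriv DERIV_mult smooth_fun_deriv[where n = n and U = U] assms)
  then show ?thesis by simp
qed

lemma pd_sum:
  assumes "\<And>k. k < (l::nat) \<Longrightarrow> smooth_fun n U (f k)" "i < n" "x \<in> U"
  shows "pd i (\<lambda>x. \<Sum>k<l. f k x) x = (\<Sum>k<l. pd i (f k) x)"
  unfolding pd_def[of i "\<lambda>x. \<Sum>k<l. f k x"]
  by (intro DERIV_imp_deriv DERIV_sum smooth_fun_deriv[where n = n and U = U] assms) simp

end

lemma pd_const: "pd i (\<lambda>x. c) x = 0"
  unfolding pd_def by simp

lemma pd_coordinate: "pd i (\<lambda>x. x k) x = (if i = k then 1 else 0)"
  unfolding pd_def by (auto intro!: DERIV_imp_deriv)

lemma pd_compose:
  assumes "open_Rn n U" "open_Rn m V"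
    "smooth_map n U m \<phi>" "\<phi> ` U \<subseteq> V" "smooth_fun m V f" "i < n" "x \<in> U"
  shows "pd i (\<lambda>x. f (\<phi> x)) x = (\<Sum>k<m. pd i (\<lambda>y. \<phi> y k) x * pd k f (\<phi> x))"
  unfolding pd_def[of i "\<lambda>x. f (\<phi> x)"] by (rule DERIV_imp_deriv[OF deriv_compose[OF assms]])

lemma smooth_map_compose:
  assumes U: "open_Rn n U" and V: "open_Rn m V"
    and "smooth_map n U m \<phi>" "\<phi> ` U \<subseteq> V" "smooth_map m V l \<psi>"
  shows "smooth_map n U l (\<lambda>x. \<psi> (\<phi> x))"
  using assms(4,5) smooth_fun_compose[OF assms(1-4) smooth_map_component[OF V assms(5)]]
  by (auto simp: smooth_map_def)

lemma smooth_map_subset: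
  assumes "smooth_map n U m \<phi>" "open_Rn n U" "open_Rn n W" "W \<subseteq> U"
  shows "smooth_map n W m \<phi>"
  using assms smooth_fun_subset[OF _ assms(2-4)] by (auto simp: smooth_map_def)

subsection \<open>Differentials\<close>

text \<open>The derivative of a function along a tangent vector; the components of
  \<^const>\<open>differential\<close> are of this form.\<close>

definition dird :: "nat \<Rightarrow> (pt \<Rightarrow> real) \<Rightarrow> pt \<Rightarrow> pt \<Rightarrow> real"
  where "dird n f x v = (\<Sum>i<n. v i * pd i f x)"

lemma differential_dird: "differential n \<phi> x v = (\<lambda>k. dird n (\<lambda>y. \<phi> y k) x v)"
  by (simp add: differential_def dird_def)

lemma lie_bracket_apply:
  "lie_bracket n X Y x k = dird n (\<lambda>y. Y y k) x (X x) - dird n (\<lambda>y. X y k) x (Y x)"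
  by (simp add: lie_bracket_def differential_dird)

lemma linear_dird: "linear (dird n f x)"
  by (rule linearI) (auto simp: dird_def scaleR_fun_def sum.distrib sum_distrib_left algebra_simps)

lemma linear_differential: "linear (differential n \<phi> x)"
  by (rule linearI) (auto simp: differential_def scaleR_fun_def fun_eq_iff sum.distrib sum_distrib_left algebra_simps)

lemma dird_cong:
  assumes "open_Rn n U" "x \<in> U" "\<And>y. y \<in> U \<Longrightarrow> f y = g y"
  shows "dird n f x v = dird n g x v"
  unfolding dird_def using pd_cong[OF assms(1,2) _ assms(3)] by (intro sum.cong) auto

lemma differential_cong:
  assumes "open_Rn n U" "x \<in> U" "\<And>y. y \<in> U \<Longrightarrow> \<phi> y = \<psi> y"
  shows "differential n \<phi> x v = differential n \<psi> x v"
  unfolding differential_dird using assms by (intro ext dird_cong) auto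

lemma differential_in_Rn:
  assumes U: "open_Rn n U" and "smooth_map n U m \<phi>" "x \<in> U"
  shows "differential n \<phi> x v \<in> Rn m"
proof -
  have "dird n (\<lambda>y. \<phi> y k) x v = 0" if "k \<ge> m" for k
  proof -
    have "dird n (\<lambda>y. \<phi> y k) x v = dird n (\<lambda>y. 0) x v"
      using smooth_map_in_Rn[OF assms(2)] that by (intro dird_cong[OF U assms(3)]) (auto simp: Rn_iff)
    also have "\<dots> = 0" unfolding dird_def pd_const by simp
    finally show ?thesis .
  qed
  then show ?thesis by (simp add: Rn_iff differential_dird)
qed

lemma dird_compose:
  assumes "open_Rn n U" "open_Rn m V"
    "smooth_map n U m \<phi>" "\<phi> ` U \<subseteq> V" "smooth_fun m V f" "x \<in> U"
  shows "dird n (\<lambda>x. f (\<phi> x)) x v = dird m f (\<phi> x) (differential n \<phi> x v)"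
proof -
  have "dird n (\<lambda>x. f (\<phi> x)) x v = (\<Sum>i<n. \<Sum>k<m. v i * pd i (\<lambda>y. \<phi> y k) x * pd k f (\<phi> x))"
    unfolding dird_def using pd_compose[OF assms(1-5) _ assms(6)]
    by (intro sum.cong) (auto simp: sum_distrib_left mult.assoc)
  also have "\<dots> = (\<Sum>k<m. \<Sum>i<n. v i * pd i (\<lambda>y. \<phi> y k) x * pd k f (\<phi> x))"
    by (rule sum.swap)
  finally show ?thesis by (simp add: dird_def differential_def sum_distrib_right)
qed

lemma differential_compose:
  assumes "open_Rn n U" "open_Rn m V"
    "smooth_map n U m \<phi>" "\<phi> ` U \<subseteq> V" "smooth_map m V l \<psi>" "x \<in> U"
  shows "differential n (\<lambda>x. \<psi> (\<phi> x)) x v = differential m \<psi> (\<phi> x) (differential n \<phi> x v)"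
  unfolding differential_dird[of n "\<lambda>x. \<psi> (\<phi> x)"] differential_dird[of m \<psi>]
  using dird_compose[OF assms(1-4) smooth_map_component[OF assms(2,5)] assms(6)] by simp

lemma differential_id: 
  assumes "v \<in> Rn n"
  shows "differential n (\<lambda>x. x) x v = v"
proof
  fix k
  have "differential n (\<lambda>x. x) x v k = (\<Sum>i<n. if i = k then v i else 0)"
    unfolding differential_def pd_coordinate by (intro sum.cong) auto
  also have "\<dots> = v k"
    using assms by (simp add: Rn_iff not_less)
  finally show "differential n (\<lambda>x. x) x v k = v k" .
qed

context
  fixes n U
  assumes U: "open_Rn n U"
begin

lemma dird_mult:
  assumes "smooth_fun n U f" "smooth_fun n U g" "x \<in> U"
  shows "dird n (\<lambda>x. f x * g x) x v = dird n f x v * g x + f x * dird n g x v"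
  using pd_mult[OF U assms(1,2) _ assms(3)]
  by (simp add: dird_def sum_distrib_left sum_distrib_right algebra_simps flip: sum.distrib)

lemma dird_add:
  assumes "smooth_fun n U f" "smooth_fun n U g" "x \<in> U"
  shows "dird n (\<lambda>x. f x + g x) x v = dird n f x v + dird n g x v"
  using pd_add[OF U assms(1,2) _ assms(3)]
  by (simp add: dird_def algebra_simps flip: sum.distrib)

lemma dird_sum:
  assumes "\<And>k. k < (l::nat) \<Longrightarrow> smooth_fun n U (f k)" "x \<in> U"
  shows "dird n (\<lambda>x. \<Sum>k<l. f k x) x v = (\<Sum>k<l. dird n (f k) x v)"
proof -
  have "dird n (\<lambda>x. \<Sum>k<l. f k x) x v = (\<Sum>i<n. \<Sum>k<l. v i * pd i (f k) x)"
    unfolding dird_def using pd_sum[OF U assms(1) _ assms(2), of l] by (intro sum.cong) (auto simp: sum_distrib_left)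
  also have "\<dots> = (\<Sum>k<l. \<Sum>i<n. v i * pd i (f k) x)" by (rule sum.swap)
  finally show ?thesis by (simp add: dird_def)
qed

lemma smooth_fun_dird:
  assumes "smooth_fun n U f" "vector_field n U X"
  shows "smooth_fun n U (\<lambda>x. dird n f x (X x))"
  unfolding dird_def
  by (intro smooth_fun_sum[OF U] smooth_fun_mult[OF U] smooth_fun_pd assms smooth_map_component[OF U assms(2)])

end

text \<open>The Lie bracket is natural under maps that relate vector fields.\<close>

lemma lie_bracket_related:
  assumes U: "open_Rn n U" and V: "open_Rn m V"
    and \<phi>: "smooth_map n U m \<phi>" "\<phi> ` U \<subseteq> V"
    and XY: "vector_field n U X" "vector_field n U Y" and XY': "vector_field m V X'" "vector_field m V Y'"
    and rel: "\<And>y. y \<in> U \<Longrightarrow> X' (\<phi> y) = differential n \<phi> y (X y)"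
      "\<And>y. y \<in> U \<Longrightarrow> Y' (\<phi> y) = differential n \<phi> y (Y y)" and x: "x \<in> U"
  shows "lie_bracket m X' Y' (\<phi> x) = differential n \<phi> x (lie_bracket n X Y x)"
proof
  fix k
  define p where "p i = pd i (\<lambda>y. \<phi> y k)" for i
  have p: "smooth_fun n U (p i)" if "i < n" for i
    unfolding p_def by (rule smooth_fun_pd[OF smooth_map_component[OF U \<phi>(1)] that])
  have half: "dird m (\<lambda>y. Y' y k) (\<phi> x) (X' (\<phi> x)) =
      (\<Sum>i<n. dird n (\<lambda>y. Y y i) x (X x) * p i x) + (\<Sum>i<n. \<Sum>l<n. Y x i * X x l * pd l (p i) x)"
    if XY: "vector_field n U X" "vector_field n U Y" and XY': "vector_field m V X'" "vector_field m V Y'"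
    and rel: "\<And>y. y \<in> U \<Longrightarrow> X' (\<phi> y) = differential n \<phi> y (X y)"
      "\<And>y. y \<in> U \<Longrightarrow> Y' (\<phi> y) = differential n \<phi> y (Y y)" for X Y X' Y'
  proof -
    have "dird m (\<lambda>y. Y' y k) (\<phi> x) (X' (\<phi> x)) = dird n (\<lambda>y. Y' (\<phi> y) k) x (X x)"
      using dird_compose[OF U V \<phi> smooth_map_component[OF V XY'(2)] x] rel(1)[OF x] by simp
    also have "\<dots> = dird n (\<lambda>y. \<Sum>i<n. Y y i * p i y) x (X x)"
      by (rule dird_cong[OF U x]) (simp add: rel(2) differential_def p_def)
    also have "\<dots> = (\<Sum>i<n. dird n (\<lambda>y. Y y i * p i y) x (X x))"
      by (rule dird_sum[OF U _ x]) (intro smooth_fun_mult[OF U] p smooth_map_component[OF U XY(2)])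
    also have "\<dots> = (\<Sum>i<n. dird n (\<lambda>y. Y y i) x (X x) * p i x + Y x i * dird n (p i) x (X x))"
      using dird_mult[OF U smooth_map_component[OF U XY(2)] p x] by (intro sum.cong) auto
    also have "\<dots> = (\<Sum>i<n. dird n (\<lambda>y. Y y i) x (X x) * p i x) + (\<Sum>i<n. \<Sum>l<n. Y x i * X x l * pd l (p i) x)"
      by (simp add: sum.distrib dird_def[of n "p _"] sum_distrib_left mult.assoc)
    finally show ?thesis .
  qed
  have "(\<Sum>i<n. \<Sum>l<n. Y x i * X x l * pd l (p i) x) = (\<Sum>l<n. \<Sum>i<n. Y x i * X x l * pd l (p i) x)"
    by (rule sum.swap)
  also have "\<dots> = (\<Sum>i<n. \<Sum>l<n. X x i * Y x l * pd l (p i) x)"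
    unfolding p_def using pd_commute[OF U smooth_map_component[OF U \<phi>(1)] _ _ x]
    by (intro sum.cong refl) (simp add: mult.commute)
  finally have sym: "(\<Sum>i<n. \<Sum>l<n. Y x i * X x l * pd l (p i) x) = (\<Sum>i<n. \<Sum>l<n. X x i * Y x l * pd l (p i) x)" .
  have "lie_bracket m X' Y' (\<phi> x) k =
      (\<Sum>i<n. dird n (\<lambda>y. Y y i) x (X x) * p i x) - (\<Sum>i<n. dird n (\<lambda>y. X y i) x (Y x) * p i x)"
    using half[where X = X and Y = Y and X' = X' and Y' = Y', OF XY XY' rel]
      half[where X = Y and Y = X and X' = Y' and Y' = X', OF XY(2,1) XY'(2,1) rel(2,1)] sym
    by (simp add: lie_bracket_apply)
  also have "\<dots> = differential n \<phi> x (lie_bracket n X Y x) k"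
    by (simp add: differential_def p_def lie_bracket_apply left_diff_distrib flip: sum_subtractf)
  finally show "lie_bracket m X' Y' (\<phi> x) k = differential n \<phi> x (lie_bracket n X Y x) k" .
qed

subsection \<open>Closed one-forms on the whole space are exact\<close>

text \<open>The primitive is the integral along the segments from the origin.\<close>

lemma closed_form_exact:
  assumes \<alpha>: "\<And>i. i < n \<Longrightarrow> smooth_fun n (Rn n) (\<alpha> i)"
    and closed: "\<And>i j x. i < n \<Longrightarrow> j < n \<Longrightarrow> x \<in> Rn n \<Longrightarrow> pd i (\<alpha> j) x = pd j (\<alpha> i) x"
  obtains f where "smooth_fun n (Rn n) f" "\<And>i x. i < n \<Longrightarrow> x \<in> Rn n \<Longrightarrow> pd i f x = \<alpha> i x"
proof -
  define f where "f x = integral (cbox 0 (1::real)) (\<lambda>t. \<Sum>i<n. x i * \<alpha> i (\<lambda>k. t * x k))" for x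
  have scale: "(\<lambda>k. t * x k) \<in> Rn n" if "x \<in> Rn n" for t :: real and x
    using that by (simp add: Rn_iff)
  have deriv: "((\<lambda>s. f (x(j := s))) has_real_derivative \<alpha> j x) (at (x j))" if j: "j < n" and x: "x \<in> Rn n" for j x
  proof -
    define fs where "fs s t = (\<Sum>i<n. (if i = j then 1 else 0) * \<alpha> i (\<lambda>k. t * (x(j := s)) k) +
      (x(j := s)) i * (t * pd j (\<alpha> i) (\<lambda>k. t * (x(j := s)) k)))" for s t :: real
    have y: "(\<lambda>k. t * (x(j := s)) k) \<in> Rn n" for s t :: real
      by (rule scale[OF upd_in_Rn[OF x j]])
    have curve: "((\<lambda>s. \<alpha> i (\<lambda>k. t * (x(j := s)) k)) has_real_derivative
        t * pd j (\<alpha> i) (\<lambda>k. t * (x(j := s)) k)) (at s)" if i: "i < n" for i s t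
    proof -
      have "((\<lambda>s. \<alpha> i (\<lambda>k. t * (x(j := s)) k)) has_real_derivative
         (\<Sum>k<n. (if k = j then t else 0) * pd k (\<alpha> i) (\<lambda>k. t * (x(j := s)) k))) (at s)"
      proof (rule smooth_fun_deriv_curve[OF openin_Rn, where \<gamma> = "\<lambda>s k. t * (x(j := s)) k"])
        show "((\<lambda>s. t * (x(j := s)) k) has_real_derivative (if k = j then t else 0)) (at s)" for k
          by (cases "k = j") (auto intro!: derivative_eq_intros)
      qed (use y \<alpha>[OF i] in auto)
      moreover have "(\<Sum>k<n. (if k = j then t else 0) * pd k (\<alpha> i) (\<lambda>k. t * (x(j := s)) k)) =
         (\<Sum>k<n. if k = j then t * pd k (\<alpha> i) (\<lambda>k. t * (x(j := s)) k) else 0)"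
        by (intro sum.cong) auto
      ultimately show ?thesis using j by simp
    qed
    have mapcont: "continuous_on A (\<lambda>z. (\<lambda>k. snd z * (x(j := fst z)) k))" for A :: "(real \<times> real) set"
    proof (rule continuous_on_coordinatewise_then_product)
      show "continuous_on A (\<lambda>z. snd z * (x(j := fst z)) k)" for k
        by (cases "k = j") (auto intro!: continuous_intros)
    qed
    have cont2: "continuous_on A (\<lambda>z. h (\<lambda>k. snd z * (x(j := fst z)) k))" 
      if h: "smooth_fun n (Rn n) h" for h and A :: "(real \<times> real) set"
      by (rule continuous_on_compose2[OF smooth_fun_continuous[OF h openin_Rn] mapcont]) (use y in blast)
    have coord: "continuous_on A (\<lambda>z. (x(j := fst z)) i)" for i and A :: "(real \<times> real) set"
      by (cases "i = j") (auto intro!: continuous_intros)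
    have "((\<lambda>s. integral (cbox 0 1) (\<lambda>t. \<Sum>i<n. (x(j := s)) i * \<alpha> i (\<lambda>k. t * (x(j := s)) k)))
        has_real_derivative integral (cbox 0 1) (fs (x j))) (at (x j) within UNIV)"
    proof (rule leibniz_rule_field_derivative)
      fix s t :: real
      show "((\<lambda>s. \<Sum>i<n. (x(j := s)) i * \<alpha> i (\<lambda>k. t * (x(j := s)) k)) has_real_derivative fs s t) (at s within UNIV)"
        unfolding fs_def
      proof (rule DERIV_sum)
        fix i assume i: "i \<in> {..<n}"
        have "((\<lambda>s. (x(j := s)) i) has_real_derivative (if i = j then 1 else 0)) (at s)"
          by (cases "i = j") auto
        from DERIV_mult[OF this curve, of i t] i
        show "((\<lambda>s. (x(j := s)) i * \<alpha> i (\<lambda>k. t * (x(j := s)) k)) has_real_derivative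
          (if i = j then 1 else 0) * \<alpha> i (\<lambda>k. t * (x(j := s)) k) +
          (x(j := s)) i * (t * pd j (\<alpha> i) (\<lambda>k. t * (x(j := s)) k))) (at s)"
          by (simp add: mult.commute)
      qed
    next
      fix s :: real
      have "continuous_on {0..1} (\<lambda>t. \<alpha> i (\<lambda>k. snd (s, t) * (x(j := fst (s, t))) k))" if "i < n" for i
        by (rule continuous_on_compose2[OF cont2[OF \<alpha>[OF that], of UNIV]]) (auto intro!: continuous_intros)
      then have "continuous_on {0..1} (\<lambda>t. \<Sum>i<n. (x(j := s)) i * \<alpha> i (\<lambda>k. t * (x(j := s)) k))"
        unfolding fst_conv snd_conv by (intro continuous_on_sum continuous_on_mult continuous_on_const) auto
      then show "(\<lambda>t. \<Sum>i<n. (x(j := s)) i * \<alpha> i (\<lambda>k. t * (x(j := s)) k)) integrable_on cbox 0 1"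
        unfolding cbox_interval by (rule integrable_continuous_interval)
    next
      have "continuous_on (UNIV \<times> cbox 0 1) (\<lambda>z. fs (fst z) (snd z))"
        unfolding fs_def
        by (intro continuous_on_sum continuous_on_add continuous_on_mult continuous_on_const continuous_on_snd
          continuous_on_id cont2 coord smooth_fun_pd \<alpha> j) auto
      then show "continuous_on (UNIV \<times> cbox 0 1) (\<lambda>(s, t). fs s t)"
        by (simp add: case_prod_unfold)
    qed auto
    moreover have "integral (cbox 0 1) (fs (x j)) = \<alpha> j x"
    proof -
      have fsx: "fs (x j) t = \<alpha> j (\<lambda>k. t * x k) + t * (\<Sum>i<n. x i * pd i (\<alpha> j) (\<lambda>k. t * x k))" for t
      proof -
        have "fs (x j) t = (\<Sum>i<n. (if i = j then \<alpha> i (\<lambda>k. t * x k) else 0) +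
            x i * (t * pd j (\<alpha> i) (\<lambda>k. t * x k)))"
          unfolding fs_def fun_upd_triv by (intro sum.cong) auto
        also have "\<dots> = (\<Sum>i<n. if i = j then \<alpha> i (\<lambda>k. t * x k) else 0) +
            (\<Sum>i<n. x i * (t * pd j (\<alpha> i) (\<lambda>k. t * x k)))"
          by (rule sum.distrib)
        also have "(\<Sum>i<n. x i * (t * pd j (\<alpha> i) (\<lambda>k. t * x k))) =
            (\<Sum>i<n. x i * (t * pd i (\<alpha> j) (\<lambda>k. t * x k)))"
          using closed[OF j _ scale[OF x]] by (intro sum.cong) auto
        finally show ?thesis using j by (simp add: sum_distrib_left mult.left_commute)
      qed
      have "((\<lambda>t. t * \<alpha> j (\<lambda>k. t * x k)) has_real_derivative fs (x j) t) (at t)" for t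
      proof -
        have "((\<lambda>t. \<alpha> j (\<lambda>k. t * x k)) has_real_derivative
          (\<Sum>k<n. x k * pd k (\<alpha> j) (\<lambda>k. t * x k))) (at t)"
          by (rule smooth_fun_deriv_curve[OF openin_Rn, where \<gamma> = "\<lambda>t k. t * x k"])
            (auto intro!: derivative_eq_intros always_eventually scale[OF x] \<alpha>[OF j])
        from DERIV_mult[OF DERIV_ident this] show ?thesis
          unfolding fsx by (simp add: mult.commute)
      qed
      then have "((\<lambda>t. t * \<alpha> j (\<lambda>k. t * x k)) has_vector_derivative fs (x j) t) (at t within {0..1})" for t
        by (metis has_field_derivative_at_within has_real_derivative_iff_has_vector_derivative)
      then have "(fs (x j) has_integral (1 * \<alpha> j (\<lambda>k. 1 * x k) - 0 * \<alpha> j (\<lambda>k. 0 * x k))) {0..1}"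
        by (intro fundamental_theorem_of_calculus) auto
      then show ?thesis by (simp add: integral_unique)
    qed
    ultimately show ?thesis by (simp add: f_def)
  qed
  have "smooth_fun n (Rn n) f"
    by (rule smooth_funI[OF openin_Rn continuous_on_of_partials[OF openin_Rn]])
      (use deriv \<alpha> smooth_fun_continuous[OF _ openin_Rn] in blast)+
  moreover have "pd i f x = \<alpha> i x" if "i < n" "x \<in> Rn n" for i x
    unfolding pd_def using deriv[OF that] by (rule DERIV_imp_deriv)
  ultimately show thesis by (rule that)
qed

section \<open>Frames with constant structure functions\<close>

text \<open>The standard basis vectors, with indices from 0.\<close>

definition unitv :: "nat \<Rightarrow> pt"
  where "unitv i = (\<lambda>k. if k = i then 1 else 0)"

lemma unitv_in_Rn: "i < n \<Longrightarrow> unitv i \<in> Rn n"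
  by (simp add: unitv_def Rn_iff)

lemma sum_fun_apply: "(\<Sum>i\<in>A. f i) x = (\<Sum>i\<in>A. f i x)" for f :: "'a \<Rightarrow> pt"
  by (induction A rule: infinite_finite_induct) auto

lemma unitv_expansion:
  assumes "v \<in> Rn n"
  shows "v = (\<Sum>i<n. v i *\<^sub>R unitv i)"
proof
  fix k
  have "(\<Sum>i<n. v i *\<^sub>R unitv i) k = (\<Sum>i<n. if i = k then v i else 0)"
    unfolding sum_fun_apply by (intro sum.cong) (auto simp: scaleR_fun_def unitv_def)
  also have "\<dots> = v k"
    using assms by (simp add: Rn_iff not_less)
  finally show "v k = (\<Sum>i<n. v i *\<^sub>R unitv i) k" ..
qed

lemma linear_expansion:
  assumes "linear f" "v \<in> Rn n"
  shows "f v = (\<Sum>i<n. v i *\<^sub>R f (unitv i))"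
  by (subst unitv_expansion[OF assms(2)]) (simp add: linear_sum[OF assms(1)] linear_scale[OF assms(1)])

lemma linear_expansion_apply:
  fixes f :: "pt \<Rightarrow> pt"
  assumes "linear f" "v \<in> Rn n"
  shows "f v k = (\<Sum>i<n. v i * f (unitv i) k)"
  by (subst linear_expansion[OF assms]) (simp add: sum_fun_apply scaleR_fun_def)

lemma subspace_Rn: "subspace (Rn n)"
  by (auto simp: subspace_def Rn_iff scaleR_fun_def)

lemma dird_unitv: "i < n \<Longrightarrow> dird n f x (unitv i) = pd i f x"
proof -
  assume "i < n"
  have "dird n f x (unitv i) = (\<Sum>l<n. if l = i then pd l f x else 0)"
    unfolding dird_def unitv_def by (intro sum.cong) auto
  then show ?thesis using \<open>i < n\<close> by simp
qed

lemma vector_field_differential: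
  assumes U: "open_Rn n U" and \<phi>: "smooth_map n U m \<phi>" and X: "vector_field n U X"
  shows "smooth_map n U m (\<lambda>x. differential n \<phi> x (X x))"
  using differential_in_Rn[OF U \<phi>] smooth_fun_dird[OF U smooth_map_component[OF U \<phi>] X]
  by (auto simp: smooth_map_def differential_dird)

text \<open>A map with values in a linear subspace has its derivatives there: a linear functional that
  vanishes on the subspace vanishes on them.\<close>

lemma differential_in_subspace:
  assumes U: "open_Rn n U" and \<eta>: "smooth_map n U m \<eta>" and x: "x \<in> U"
    and K: "subspace K" and in_K: "\<And>y. y \<in> U \<Longrightarrow> \<eta> y \<in> K"
  shows "differential n \<eta> x v \<in> K"
proof (rule ccontr)
  let ?w = "differential n \<eta> x v"
  assume w: "?w \<notin> K"
  obtain C where C: "C \<subseteq> K" "independent C" "K \<subseteq> span C" "card C = dim K"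
    by (rule basis_exists)
  have "span C \<subseteq> K" by (rule span_minimal[OF C(1) K])
  then have "?w \<notin> span C" using w by blast
  then have "independent (insert ?w C)" using C(2) by (rule independent_insertI)
  from linear_independent_extend[OF this, of "\<lambda>u. if u = ?w then 1 else 0 :: real"]
  obtain l where "linear l \<and> (\<forall>u\<in>insert ?w C. l u = (if u = ?w then 1 else 0 :: real))" ..
  then have l: "linear l" "\<forall>u\<in>insert ?w C. l u = (if u = ?w then 1 else 0)" by (rule conjunct1, rule conjunct2)
  have "l u = 0" if "u \<in> C" for u
    using l(2) that w C(1) by auto
  then have vanish: "l u = 0" if "u \<in> K" for u
    using linear_eq_0_on_span[OF l(1), of C u] that C(3) by blast
  have "0 = dird n (\<lambda>y. 0) x v"
    unfolding dird_def pd_const by simp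
  also have "\<dots> = dird n (\<lambda>y. \<Sum>k<m. \<eta> y k * l (unitv k)) x v"
  proof (rule dird_cong[OF U x])
    fix y assume y: "y \<in> U"
    have "l (\<eta> y) = (\<Sum>k<m. \<eta> y k *\<^sub>R l (unitv k))"
      by (rule linear_expansion[OF l(1) smooth_map_in_Rn[OF \<eta> y]])
    then show "0 = (\<Sum>k<m. \<eta> y k * l (unitv k))"
      using vanish[OF in_K[OF y]] by simp
  qed
  also have "\<dots> = (\<Sum>k<m. dird n (\<lambda>y. \<eta> y k * l (unitv k)) x v)"
    by (intro dird_sum[OF U _ x] smooth_fun_mult[OF U] smooth_fun_const[OF U] smooth_map_component[OF U \<eta>])
  also have "\<dots> = (\<Sum>k<m. ?w k *\<^sub>R l (unitv k))"
  proof (intro sum.cong refl)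
    fix k
    have "dird n (\<lambda>y. l (unitv k)) x v = 0" unfolding dird_def pd_const by simp
    then show "dird n (\<lambda>y. \<eta> y k * l (unitv k)) x v = ?w k *\<^sub>R l (unitv k)"
      using dird_mult[OF U smooth_map_component[OF U \<eta>, of k] smooth_fun_const[OF U, of "l (unitv k)"] x, of v]
      by (simp add: differential_dird)
  qed
  also have "\<dots> = l ?w"
    by (rule linear_expansion[OF l(1) differential_in_Rn[OF U \<eta> x], symmetric])
  also have "\<dots> = 1" using l(2) by simp
  finally show False by simp
qed

lemma lie_bracket_in_Rn:
  assumes U: "open_Rn n U" and "vector_field n U X" "vector_field n U Y" "x \<in> U"
  shows "lie_bracket n X Y x \<in> Rn n"
  unfolding lie_bracket_def
  by (intro subspace_diff[OF subspace_Rn] differential_in_Rn[OF U] assms)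

text \<open>A frame, parametrised linearly by its constant coefficient vectors: \<open>F u\<close> is the vector field
  with coefficient vector \<open>u\<close>, \<open>\<Theta> y\<close> gives the coefficient vector of a tangent vector at \<open>y\<close>, and the
  commutator of two such fields has the coefficient vector \<open>B u v\<close>.\<close>

locale lie_frame =
  fixes n :: nat and U :: "pt set" and F :: "pt \<Rightarrow> pt \<Rightarrow> pt" and \<Theta> :: "pt \<Rightarrow> pt \<Rightarrow> pt"
    and B :: "pt \<Rightarrow> pt \<Rightarrow> pt"
  assumes open_U: "open_Rn n U"
    and linear_F: "y \<in> U \<Longrightarrow> linear (\<lambda>u. F u y)"
    and linear_\<Theta>: "y \<in> U \<Longrightarrow> linear (\<Theta> y)"
    and field: "u \<in> Rn n \<Longrightarrow> vector_field n U (F u)"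
    and coframe: "i < n \<Longrightarrow> smooth_map n U n (\<lambda>y. \<Theta> y (unitv i))"
    and \<Theta>_F: "y \<in> U \<Longrightarrow> u \<in> Rn n \<Longrightarrow> \<Theta> y (F u y) = u"
    and F_\<Theta>: "y \<in> U \<Longrightarrow> v \<in> Rn n \<Longrightarrow> F (\<Theta> y v) y = v"
    and B_in_Rn: "u \<in> Rn n \<Longrightarrow> v \<in> Rn n \<Longrightarrow> B u v \<in> Rn n"
    and bracket: "y \<in> U \<Longrightarrow> u \<in> Rn n \<Longrightarrow> v \<in> Rn n \<Longrightarrow> lie_bracket n (F u) (F v) y = F (B u v) y"
begin

lemma F_in_Rn: "u \<in> Rn n \<Longrightarrow> y \<in> U \<Longrightarrow> F u y \<in> Rn n"
  using field smooth_map_in_Rn by blast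

lemma smooth_coefficients:
  assumes W: "open_Rn n W" "W \<subseteq> U" and X: "vector_field n W X"
  shows "smooth_map n W n (\<lambda>y. \<Theta> y (X y))"
proof -
  have eq: "\<Theta> y (X y) k = (\<Sum>i<n. X y i * \<Theta> y (unitv i) k)" if "y \<in> W" for y k
    using linear_expansion_apply[OF linear_\<Theta> smooth_map_in_Rn[OF X that]] that W(2) by blast
  have \<Theta>R: "\<Theta> y (unitv i) \<in> Rn n" if "y \<in> W" "i < n" for y i
    using coframe[OF that(2)] that(1) W(2) smooth_map_in_Rn by blast
  have "\<Theta> y (X y) \<in> Rn n" if "y \<in> W" for y
    unfolding Rn_iff using eq[OF that] \<Theta>R[OF that] by (simp add: Rn_iff)
  moreover have "smooth_fun n W (\<lambda>y. \<Theta> y (X y) k)" for k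
  proof (rule smooth_fun_cong[OF W(1)])
    show "smooth_fun n W (\<lambda>y. \<Sum>i<n. X y i * \<Theta> y (unitv i) k)"
      by (intro smooth_fun_sum smooth_fun_mult smooth_map_component[OF W(1) X] W(1)
          smooth_map_component[OF W(1) smooth_map_subset[OF coframe open_U W]])
  qed (simp add: eq)
  ultimately show ?thesis by (auto simp: smooth_map_def)
qed

lemma coefficients_in_Rn:
  assumes "y \<in> U" "v \<in> Rn n"
  shows "\<Theta> y v \<in> Rn n"
proof -
  have "smooth_map n U n (\<lambda>_. v)"
    using assms(2) by (auto simp: smooth_map_def smooth_fun_const[OF open_U])
  from smooth_map_in_Rn[OF smooth_coefficients[OF open_U order_refl this] assms(1)] show ?thesis .
qed

text \<open>The coefficients of \<open>X\<close> and \<open>Y\<close> in the frame are \<open>\<xi>\<close> and \<open>\<eta>\<close>; the bracket is expanded by the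
  Leibniz rule.\<close>

lemma bracket_expansion:
  assumes W: "open_Rn n W" "W \<subseteq> U"
    and \<xi>: "smooth_map n W n \<xi>" and \<eta>: "smooth_map n W n \<eta>"
    and X: "\<And>y. y \<in> W \<Longrightarrow> X y = F (\<xi> y) y" and Y: "\<And>y. y \<in> W \<Longrightarrow> Y y = F (\<eta> y) y" and y: "y \<in> W"
  shows "lie_bracket n X Y y k = F (differential n \<eta> y (X y) - differential n \<xi> y (Y y)) y k +
    (\<Sum>i<n. \<Sum>j<n. \<xi> y i * \<eta> y j * lie_bracket n (F (unitv i)) (F (unitv j)) y k)"
proof -
  let ?E = "\<lambda>i z. F (unitv i) z k"
  have yU: "y \<in> U" using y W(2) by blast
  have exp: "F (\<xi> z) z l = (\<Sum>i<n. \<xi> z i * F (unitv i) z l)" if "z \<in> W" "smooth_map n W n \<xi>" for \<xi> z l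
    using linear_expansion_apply[OF linear_F smooth_map_in_Rn[OF that(2,1)]] that(1) W(2) by blast
  have E: "smooth_fun n W (?E i)" if "i < n" for i
    by (rule smooth_map_component[OF W(1) smooth_map_subset[OF field[OF unitv_in_Rn[OF that]] open_U W]])
  have half: "dird n (\<lambda>z. Y z k) y (X y) = F (differential n \<eta> y (X y)) y k +
      (\<Sum>i<n. \<Sum>j<n. \<xi> y i * \<eta> y j * dird n (?E j) y (F (unitv i) y))"
    if \<xi>: "smooth_map n W n \<xi>" and \<eta>: "smooth_map n W n \<eta>"
    and X: "\<And>y. y \<in> W \<Longrightarrow> X y = F (\<xi> y) y" and Y: "\<And>y. y \<in> W \<Longrightarrow> Y y = F (\<eta> y) y" for X Y \<xi> \<eta>
  proof -
    have "dird n (\<lambda>z. Y z k) y (X y) = dird n (\<lambda>z. \<Sum>j<n. \<eta> z j * ?E j z) y (X y)"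
      by (rule dird_cong[OF W(1) y]) (simp add: Y exp[OF _ \<eta>])
    also have "\<dots> = (\<Sum>j<n. dird n (\<lambda>z. \<eta> z j * ?E j z) y (X y))"
      by (intro dird_sum[OF W(1) _ y] smooth_fun_mult[OF W(1)] E smooth_map_component[OF W(1) \<eta>])
    also have "\<dots> = (\<Sum>j<n. dird n (\<lambda>z. \<eta> z j) y (X y) * ?E j y + \<eta> y j * dird n (?E j) y (X y))"
      using dird_mult[OF W(1) smooth_map_component[OF W(1) \<eta>] E y] by (intro sum.cong) auto
    also have "\<dots> = (\<Sum>j<n. dird n (\<lambda>z. \<eta> z j) y (X y) * ?E j y) + (\<Sum>j<n. \<eta> y j * dird n (?E j) y (X y))"
      by (rule sum.distrib)
    also have "(\<Sum>j<n. dird n (\<lambda>z. \<eta> z j) y (X y) * ?E j y) = F (differential n \<eta> y (X y)) y k"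
      using linear_expansion_apply[OF linear_F[OF yU] differential_in_Rn[OF W(1) \<eta> y]]
      by (simp add: differential_dird)
    also have "(\<Sum>j<n. \<eta> y j * dird n (?E j) y (X y)) =
        (\<Sum>j<n. \<Sum>i<n. \<xi> y i * \<eta> y j * dird n (?E j) y (F (unitv i) y))"
    proof (intro sum.cong refl)
      fix j
      have "X y = (\<Sum>i<n. \<xi> y i *\<^sub>R F (unitv i) y)"
        using linear_expansion[OF linear_F[OF yU] smooth_map_in_Rn[OF \<xi> y]] X[OF y] by simp
      then have "dird n (?E j) y (X y) = (\<Sum>i<n. \<xi> y i * dird n (?E j) y (F (unitv i) y))"
        by (simp add: linear_sum[OF linear_dird] linear_scale[OF linear_dird])
      then show "\<eta> y j * dird n (?E j) y (X y) = (\<Sum>i<n. \<xi> y i * \<eta> y j * dird n (?E j) y (F (unitv i) y))"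
        by (simp add: sum_distrib_left mult.left_commute mult.assoc)
    qed
    also have "\<dots> = (\<Sum>i<n. \<Sum>j<n. \<xi> y i * \<eta> y j * dird n (?E j) y (F (unitv i) y))"
      by (rule sum.swap)
    finally show ?thesis .
  qed
  have "(\<Sum>i<n. \<Sum>j<n. \<eta> y i * \<xi> y j * dird n (?E j) y (F (unitv i) y)) =
      (\<Sum>i<n. \<Sum>j<n. \<xi> y i * \<eta> y j * dird n (?E i) y (F (unitv j) y))"
    by (subst sum.swap) (simp add: mult.commute)
  with half[where X = X and Y = Y, OF \<xi> \<eta> X Y] half[where X = Y and Y = X, OF \<eta> \<xi> Y X] show ?thesis
    unfolding lie_bracket_apply linear_diff[OF linear_F[OF yU]] right_diff_distrib sum_subtractf by simp
qed

text \<open>Applied to constant coefficients, the expansion identifies its double sum with the field that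
  belongs to \<open>B (\<xi> y) (\<eta> y)\<close>.\<close>

lemma bracket_formula:
  assumes W: "open_Rn n W" "W \<subseteq> U"
    and \<xi>: "smooth_map n W n \<xi>" and \<eta>: "smooth_map n W n \<eta>"
    and X: "\<And>y. y \<in> W \<Longrightarrow> X y = F (\<xi> y) y" and Y: "\<And>y. y \<in> W \<Longrightarrow> Y y = F (\<eta> y) y" and y: "y \<in> W"
  shows "lie_bracket n X Y y =
    F (differential n \<eta> y (X y) - differential n \<xi> y (Y y) + B (\<xi> y) (\<eta> y)) y"
proof
  fix k
  have yU: "y \<in> U" using y W(2) by blast
  have R: "\<xi> y \<in> Rn n" "\<eta> y \<in> Rn n" using \<xi> \<eta> y smooth_map_in_Rn by blast+
  have c: "smooth_map n W n (\<lambda>_. u)" if "u \<in> Rn n" for u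
    using that by (auto simp: smooth_map_def smooth_fun_const[OF W(1)])
  have d0: "differential n (\<lambda>_. u) y v = 0" for u v
    by (simp add: differential_def pd_const fun_eq_iff)
  have "F (B (\<xi> y) (\<eta> y)) y k = lie_bracket n (F (\<xi> y)) (F (\<eta> y)) y k"
    using bracket[OF yU R] by simp
  also have "\<dots> = (\<Sum>i<n. \<Sum>j<n. \<xi> y i * \<eta> y j * lie_bracket n (F (unitv i)) (F (unitv j)) y k)"
    using bracket_expansion[OF W c[OF R(1)] c[OF R(2)] refl refl y, of k]
    by (simp add: d0 linear_0[OF linear_F[OF yU]])
  finally show "lie_bracket n X Y y k =
    F (differential n \<eta> y (X y) - differential n \<xi> y (Y y) + B (\<xi> y) (\<eta> y)) y k"
    using bracket_expansion[where X = X and Y = Y and \<xi> = \<xi> and \<eta> = \<eta>, OF assms, of k]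
    by (simp add: linear_add[OF linear_F[OF yU]])
qed

text \<open>An upper bound for one step of the weak derived flag: the derivatives of coefficients in \<open>S\<close> and
  \<open>K\<close> stay in these subspaces, and only the algebraic bracket may leave them.\<close>

lemma weak_flag_step:
  assumes S: "S \<subseteq> Rn n" and D: "\<And>y. y \<in> U \<Longrightarrow> D y \<subseteq> (\<lambda>u. F u y) ` S"
    and K: "K \<subseteq> Rn n" and D_i: "\<And>y. y \<in> U \<Longrightarrow> weak_flag n U D (Suc i) y \<subseteq> (\<lambda>u. F u y) ` K"
    and sub: "subspace S" "subspace K" "subspace K'" and K': "S \<subseteq> K'" "K \<subseteq> K'"
    and B: "\<And>u v. u \<in> S \<Longrightarrow> v \<in> K \<Longrightarrow> B u v \<in> K'"
    and x: "x \<in> U"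
  shows "weak_flag n U D (Suc (Suc i)) x \<subseteq> (\<lambda>u. F u x) ` K'"
  unfolding weak_flag.simps
proof (rule span_minimal)
  show "subspace ((\<lambda>u. F u x) ` K')"
    by (rule linear_subspace_image[OF linear_F[OF x] sub(3)])
  show "{lie_bracket n X Y x | X Y W. open_Rn n W \<and> x \<in> W \<and> W \<subseteq> U \<and>
      X \<in> sections n W D \<and> Y \<in> sections n W (weak_flag n U D (Suc i))} \<subseteq> (\<lambda>u. F u x) ` K'"
  proof clarify
    fix X Y W assume W: "open_Rn n W" "W \<subseteq> U" and xW: "x \<in> W"
      and X: "X \<in> sections n W D" and Y: "Y \<in> sections n W (weak_flag n U D (Suc i))"
    define \<xi> where "\<xi> = (\<lambda>y. \<Theta> y (X y))"
    define \<eta> where "\<eta> = (\<lambda>y. \<Theta> y (Y y))"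
    have vf: "vector_field n W X" "vector_field n W Y" using X Y by (auto simp: sections_def)
    have sm: "smooth_map n W n \<xi>" "smooth_map n W n \<eta>"
      unfolding \<xi>_def \<eta>_def by (intro smooth_coefficients W vf)+
    have F: "X y = F (\<xi> y) y" "Y y = F (\<eta> y) y" if "y \<in> W" for y
      using F_\<Theta>[of y] that W(2) smooth_map_in_Rn vf unfolding \<xi>_def \<eta>_def by (metis subsetD)+
    have coeff: "\<Theta> y v \<in> L" if "v \<in> (\<lambda>u. F u y) ` L" "L \<subseteq> Rn n" "y \<in> W" for y v L
    proof -
      from that(1) obtain u where "u \<in> L" "v = F u y" by blast
      moreover have "u \<in> Rn n" "y \<in> U" using calculation that(2,3) W(2) by blast+
      ultimately show ?thesis by (simp add: \<Theta>_F)
    qed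
    have \<xi>S: "\<xi> y \<in> S" if "y \<in> W" for y
    proof -
      have "X y \<in> D y" using X that by (simp add: sections_def)
      then show ?thesis unfolding \<xi>_def using D[of y] that W(2) by (intro coeff[OF _ S that]) blast
    qed
    have \<eta>K: "\<eta> y \<in> K" if "y \<in> W" for y
    proof -
      have "Y y \<in> weak_flag n U D (Suc i) y" using Y that by (simp add: sections_def)
      then show ?thesis unfolding \<eta>_def using D_i[of y] that W(2) by (intro coeff[OF _ K that]) blast
    qed
    have "differential n \<eta> x (X x) \<in> K" "differential n \<xi> x (Y x) \<in> S"
      using differential_in_subspace[OF W(1) _ xW] sm sub \<xi>S \<eta>K by blast+
    then have "differential n \<eta> x (X x) - differential n \<xi> x (Y x) + B (\<xi> x) (\<eta> x) \<in> K'"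
      using K' B[OF \<xi>S[OF xW] \<eta>K[OF xW]] by (intro subspace_add[OF sub(3)] subspace_diff[OF sub(3)]) auto
    then show "lie_bracket n X Y x \<in> (\<lambda>u. F u x) ` K'"
      using bracket_formula[OF W sm F xW] by blast
  qed
qed

end

text \<open>A function with prescribed derivatives along the frame exists as soon as the Maurer--Cartan
  integrability condition holds, because the prescribed derivatives are those of a closed one-form.\<close>

lemma (in lie_frame) potential:
  assumes all: "U = Rn n"
    and \<beta>: "\<And>u. u \<in> Rn n \<Longrightarrow> smooth_fun n U (\<beta> u)"
    and lin: "\<And>y. y \<in> U \<Longrightarrow> linear (\<lambda>u. \<beta> u y)"
    and integrable: "\<And>u v y. u \<in> Rn n \<Longrightarrow> v \<in> Rn n \<Longrightarrow> y \<in> U \<Longrightarrow>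
      dird n (\<beta> v) y (F u y) - dird n (\<beta> u) y (F v y) = \<beta> (B u v) y"
  obtains f where "smooth_fun n U f" "\<And>u y. u \<in> Rn n \<Longrightarrow> y \<in> U \<Longrightarrow> dird n f y (F u y) = \<beta> u y"
proof -
  define \<alpha> where "\<alpha> i y = \<beta> (\<Theta> y (unitv i)) y" for i y
  have \<alpha>_eq: "\<alpha> i y = (\<Sum>k<n. \<Theta> y (unitv i) k * \<beta> (unitv k) y)" if "i < n" "y \<in> U" for i y
    unfolding \<alpha>_def
    using linear_expansion[OF lin[OF that(2)] coefficients_in_Rn[OF that(2) unitv_in_Rn[OF that(1)]]] by simp
  have \<alpha>: "smooth_fun n U (\<alpha> i)" if "i < n" for i
  proof (rule smooth_fun_cong[OF open_U])
    show "smooth_fun n U (\<lambda>y. \<Sum>k<n. \<Theta> y (unitv i) k * \<beta> (unitv k) y)"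
      by (intro smooth_fun_sum smooth_fun_mult open_U \<beta> unitv_in_Rn smooth_map_component[OF open_U coframe] that)
  qed (simp add: \<alpha>_eq[OF that])
  have \<beta>\<Theta>: "\<beta> (\<Theta> y v) y = (\<Sum>i<n. v i * \<alpha> i y)" if "y \<in> U" "v \<in> Rn n" for y v
  proof -
    have "linear (\<lambda>v. \<beta> (\<Theta> y v) y)"
      using linear_compose[OF linear_\<Theta>[OF that(1)] lin[OF that(1)]] by (simp add: o_def)
    from linear_expansion[OF this that(2)] show ?thesis by (simp add: \<alpha>_def)
  qed
  have \<beta>_eq: "\<beta> u y = (\<Sum>i<n. F u y i * \<alpha> i y)" if "y \<in> U" "u \<in> Rn n" for y u
    using \<beta>\<Theta>[OF that(1) F_in_Rn[OF that(2,1)]] \<Theta>_F[OF that] by simp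
  have half: "dird n (\<beta> v) y (F u y) = (\<Sum>i<n. dird n (\<lambda>y. F v y i) y (F u y) * \<alpha> i y) +
      (\<Sum>i<n. F v y i * dird n (\<alpha> i) y (F u y))" if y: "y \<in> U" and uv: "u \<in> Rn n" "v \<in> Rn n" for u v y
  proof -
    have "dird n (\<beta> v) y (F u y) = dird n (\<lambda>y. \<Sum>i<n. F v y i * \<alpha> i y) y (F u y)"
      by (rule dird_cong[OF open_U y]) (rule \<beta>_eq[OF _ uv(2)])
    also have "\<dots> = (\<Sum>i<n. dird n (\<lambda>y. F v y i * \<alpha> i y) y (F u y))"
      by (intro dird_sum[OF open_U _ y] smooth_fun_mult[OF open_U] \<alpha> smooth_map_component[OF open_U field[OF uv(2)]])
    also have "\<dots> = (\<Sum>i<n. dird n (\<lambda>y. F v y i) y (F u y) * \<alpha> i y + F v y i * dird n (\<alpha> i) y (F u y))"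
      using dird_mult[OF open_U smooth_map_component[OF open_U field[OF uv(2)]] \<alpha> y] by (intro sum.cong) auto
    finally show ?thesis by (simp add: sum.distrib)
  qed
  have closed: "pd a (\<alpha> b) y = pd b (\<alpha> a) y" if ab: "a < n" "b < n" and y: "y \<in> U" for a b y
  proof -
    define u where "u = \<Theta> y (unitv a)"
    define v where "v = \<Theta> y (unitv b)"
    have R: "u \<in> Rn n" "v \<in> Rn n"
      unfolding u_def v_def using coefficients_in_Rn[OF y unitv_in_Rn] ab by auto
    have Fuv: "F u y = unitv a" "F v y = unitv b"
      unfolding u_def v_def using F_\<Theta>[OF y unitv_in_Rn] ab by auto
    have "dird n (\<beta> v) y (F u y) - dird n (\<beta> u) y (F v y) =
        (\<Sum>i<n. lie_bracket n (F u) (F v) y i * \<alpha> i y)"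
      using integrable[OF R y] bracket[OF y R] \<beta>_eq[OF y B_in_Rn[OF R]] by simp
    moreover have "(\<Sum>i<n. lie_bracket n (F u) (F v) y i * \<alpha> i y) =
        (\<Sum>i<n. dird n (\<lambda>y. F v y i) y (F u y) * \<alpha> i y) - (\<Sum>i<n. dird n (\<lambda>y. F u y i) y (F v y) * \<alpha> i y)"
      by (simp add: lie_bracket_apply left_diff_distrib sum_subtractf)
    ultimately have "(\<Sum>i<n. F v y i * dird n (\<alpha> i) y (F u y)) = (\<Sum>i<n. F u y i * dird n (\<alpha> i) y (F v y))"
      using half[OF y R] half[OF y R(2,1)] by simp
    moreover have "(\<Sum>i<n. F v y i * dird n (\<alpha> i) y (F u y)) = pd a (\<alpha> b) y"
    proof -
      have "(\<Sum>i<n. F v y i * dird n (\<alpha> i) y (F u y)) = (\<Sum>i<n. if i = b then pd a (\<alpha> i) y else 0)"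
        unfolding Fuv by (intro sum.cong) (auto simp: unitv_def[of b] dird_unitv[OF ab(1)])
      then show ?thesis using ab by simp
    qed
    moreover have "(\<Sum>i<n. F u y i * dird n (\<alpha> i) y (F v y)) = pd b (\<alpha> a) y"
    proof -
      have "(\<Sum>i<n. F u y i * dird n (\<alpha> i) y (F v y)) = (\<Sum>i<n. if i = a then pd b (\<alpha> i) y else 0)"
        unfolding Fuv by (intro sum.cong) (auto simp: unitv_def[of a] dird_unitv[OF ab(2)])
      then show ?thesis using ab by simp
    qed
    ultimately show ?thesis by simp
  qed
  obtain f where f: "smooth_fun n (Rn n) f" "\<And>i x. i < n \<Longrightarrow> x \<in> Rn n \<Longrightarrow> pd i f x = \<alpha> i x"
    using closed_form_exact[of n \<alpha>] \<alpha> closed unfolding all by blast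
  show thesis
  proof (rule that)
    show "smooth_fun n U f" using f(1) all by simp
    show "dird n f y (F u y) = \<beta> u y" if "u \<in> Rn n" "y \<in> U" for u y
      using f(2) that(2) \<beta>_eq[OF that(2,1)] all by (simp add: dird_def)
  qed
qed

subsection \<open>Lower bounds for the weak derived flag\<close>

lemma dird_coordinate_function:
  assumes "k < n" "(g has_real_derivative g') (at (p k))"
  shows "dird n (\<lambda>p. g (p k)) p w = w k * g'"
proof -
  have "pd i (\<lambda>p. g (p k)) p = (if i = k then g' else 0)" for i
    unfolding pd_def using assms(2) by (cases "i = k") (auto intro: DERIV_imp_deriv)
  then have "dird n (\<lambda>p. g (p k)) p w = (\<Sum>i<n. if i = k then w i * g' else 0)"
    unfolding dird_def by (intro sum.cong) auto
  then show ?thesis using assms(1) by simp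
qed

lemma dird_const: "dird n (\<lambda>p. c) p w = 0"
  unfolding dird_def pd_const by simp

lemma (in lie_frame) weak_flag_bracket:
  assumes S: "S \<subseteq> Rn n" "\<And>y. y \<in> U \<Longrightarrow> (\<lambda>u. F u y) ` S \<subseteq> D y"
    and K: "K \<subseteq> Rn n" "\<And>y. y \<in> U \<Longrightarrow> (\<lambda>u. F u y) ` K \<subseteq> weak_flag n U D (Suc i) y"
    and uv: "u \<in> S" "v \<in> K" and x: "x \<in> U"
  shows "F (B u v) x \<in> weak_flag n U D (Suc (Suc i)) x"
proof -
  have R: "u \<in> Rn n" "v \<in> Rn n" using S K uv by auto
  have "F u \<in> sections n U D"
    using S(2) uv(1) field[OF R(1)] by (auto simp: sections_def)
  moreover have "F v \<in> sections n U (weak_flag n U D (Suc i))"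
    using K(2) uv(2) field[OF R(2)] by (auto simp: sections_def)
  ultimately have "lie_bracket n (F u) (F v) x \<in> weak_flag n U D (Suc (Suc i)) x"
    using open_U x by (auto intro!: span_base)
  then show ?thesis using bracket[OF x R] by simp
qed

text \<open>The bracket of \<open>F u\<close> and \<open>f F v\<close> at \<open>x\<close> is \<open>F v x\<close> if \<open>f\<close> vanishes at \<open>x\<close> and has derivative 1 along
  \<open>F u\<close> there. So the fibre of the next member of the flag contains that of the previous one.\<close>

lemma (in lie_frame) weak_flag_increasing:
  assumes S: "S \<subseteq> Rn n" "\<And>y. y \<in> U \<Longrightarrow> (\<lambda>u. F u y) ` S \<subseteq> D y"
    and K: "K \<subseteq> Rn n" "\<And>y. y \<in> U \<Longrightarrow> (\<lambda>u. F u y) ` K \<subseteq> weak_flag n U D (Suc i) y" "subspace K"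
    and uv: "u \<in> S" "u \<noteq> 0" "v \<in> K" and x: "x \<in> U"
  shows "F v x \<in> weak_flag n U D (Suc (Suc i)) x"
proof -
  have R: "u \<in> Rn n" "v \<in> Rn n" using S K uv by auto
  have "F u x \<noteq> 0"
    using \<Theta>_F[OF x R(1)] uv(2) linear_0[OF linear_\<Theta>[OF x]] by metis
  then obtain k where k: "F u x k \<noteq> 0" by (auto simp: fun_eq_iff)
  then have kn: "k < n" using F_in_Rn[OF R(1) x] by (auto simp: Rn_iff not_le[symmetric])
  define f where "f y = (y k - x k) / F u x k" for y
  define \<eta> where "\<eta> y = f y *\<^sub>R v" for y
  have f: "smooth_fun n U f"
  proof (rule smooth_fun_cong[OF open_U])
    show "smooth_fun n U (\<lambda>y. (y k - x k) * (1 / F u x k))"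
      by (intro smooth_fun_mult[OF open_U] smooth_fun_diff[OF open_U] smooth_fun_coordinate[OF open_U]
        smooth_fun_const[OF open_U])
  qed (simp add: f_def)
  have \<eta>: "smooth_map n U n \<eta>"
    using R(2) by (auto simp: smooth_map_def \<eta>_def scaleR_fun_def Rn_iff
        intro!: smooth_fun_mult[OF open_U] f smooth_fun_const[OF open_U])
  have \<eta>K: "\<eta> y \<in> K" for y
    unfolding \<eta>_def by (rule subspace_scale[OF K(3) uv(3)])
  have c: "smooth_map n U n (\<lambda>_. u)"
    using R(1) by (auto simp: smooth_map_def smooth_fun_const[OF open_U])
  define Y where "Y y = F (\<eta> y) y" for y
  have "vector_field n U Y"
  proof -
    have "smooth_fun n U (\<lambda>y. Y y i)" for i
    proof (rule smooth_fun_cong[OF open_U])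
      show "smooth_fun n U (\<lambda>y. f y * F v y i)"
        by (intro smooth_fun_mult[OF open_U] f smooth_map_component[OF open_U field[OF R(2)]])
      show "f y * F v y i = Y y i" if "y \<in> U" for y
        unfolding Y_def \<eta>_def linear_scale[OF linear_F[OF that]] by (simp add: scaleR_fun_def)
    qed
    moreover have "Y y \<in> Rn n" if "y \<in> U" for y
      unfolding Y_def using F_in_Rn \<eta>K K(1) that by blast
    ultimately show ?thesis by (auto simp: smooth_map_def)
  qed
  then have "Y \<in> sections n U (weak_flag n U D (Suc i))"
    using K(2) \<eta>K by (auto simp: sections_def Y_def)
  moreover have "F u \<in> sections n U D"
    using S(2) uv(1) field[OF R(1)] by (auto simp: sections_def)
  ultimately have "lie_bracket n (F u) Y x \<in> weak_flag n U D (Suc (Suc i)) x"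
    using open_U x by (auto intro!: span_base)
  moreover have "lie_bracket n (F u) Y x = F v x"
  proof -
    have df: "dird n f x (F u x) = 1"
    proof -
      have "((\<lambda>t. (t - x k) / F u x k) has_real_derivative 1 / F u x k) (at (x k))"
        using k by (auto intro!: derivative_eq_intros)
      from dird_coordinate_function[where p = x and g = "\<lambda>t. (t - x k) / F u x k", OF kn this, of "F u x"] k
      show ?thesis by (simp add: f_def[abs_def])
    qed
    have "differential n \<eta> x (F u x) = v"
      using dird_mult[OF open_U f smooth_fun_const[OF open_U] x, of _ "F u x"]
      by (simp add: differential_dird \<eta>_def scaleR_fun_def df dird_const)
    moreover have "differential n (\<lambda>_. u) x w = 0" for w
      by (simp add: differential_dird dird_const fun_eq_iff)
    moreover have "\<eta> x = 0" by (simp add: \<eta>_def f_def)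
    moreover have "B u 0 = 0"
    proof -
      have z: "0 \<in> Rn n" by (simp add: Rn_iff)
      have F0: "F 0 y = 0" if "y \<in> U" for y by (rule linear_0[OF linear_F[OF that]])
      have "lie_bracket n (F u) (F 0) x k = 0" for k
      proof -
        have "dird n (\<lambda>y. F 0 y k) x (F u x) = dird n (\<lambda>y. 0) x (F u x)"
          by (rule dird_cong[OF open_U x]) (simp add: F0)
        moreover have "dird n (\<lambda>y. F u y k) x (F 0 x) = 0"
          using linear_0[OF linear_dird] F0[OF x] by simp
        ultimately show ?thesis by (simp add: lie_bracket_apply dird_const)
      qed
      then have "F (B u 0) x = 0" using bracket[OF x R(1) z] by (simp add: fun_eq_iff)
      then show ?thesis
        using \<Theta>_F[OF x B_in_Rn[OF R(1) z]] linear_0[OF linear_\<Theta>[OF x]] by simp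
    qed
    ultimately show ?thesis
      using bracket_formula[OF open_U order_refl c \<eta> refl Y_def x] by simp
  qed
  ultimately show ?thesis by simp
qed

subsection \<open>Restriction and pullback of a frame\<close>

lemma (in lie_frame) restrict:
  assumes V: "open_Rn n V" "V \<subseteq> U"
  shows "lie_frame n V F \<Theta> B"
proof (rule lie_frame.intro)
  show "vector_field n V (F u)" if "u \<in> Rn n" for u
    by (rule smooth_map_subset[OF field[OF that] open_U V])
  show "smooth_map n V n (\<lambda>y. \<Theta> y (unitv i))" if "i < n" for i
    by (rule smooth_map_subset[OF coframe[OF that] open_U V])
  have VU: "y \<in> U" if "y \<in> V" for y
    using V(2) that by blast
  show "linear (\<lambda>u. F u y)" "linear (\<Theta> y)" if "y \<in> V" for y
    by (rule linear_F[OF VU[OF that]], rule linear_\<Theta>[OF VU[OF that]])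
qed (simp_all add: V(1) \<Theta>_F F_\<Theta> B_in_Rn bracket subsetD[OF V(2)])

lemma diffeomorphism_inverse:
  assumes "diffeomorphism n W m U \<phi>" and W: "open_Rn n W" and U: "open_Rn m U"
  shows "\<And>y. y \<in> W \<Longrightarrow> \<phi> y \<in> U" "\<And>y. y \<in> W \<Longrightarrow> inv_into W \<phi> (\<phi> y) = y"
    "\<And>y v. y \<in> W \<Longrightarrow> v \<in> Rn n \<Longrightarrow> differential m (inv_into W \<phi>) (\<phi> y) (differential n \<phi> y v) = v"
    "\<And>y v. y \<in> W \<Longrightarrow> v \<in> Rn m \<Longrightarrow> differential n \<phi> y (differential m (inv_into W \<phi>) (\<phi> y) v) = v"
proof -
  let ?\<chi> = "inv_into W \<phi>"
  have bij: "bij_betw \<phi> W U" and \<phi>: "smooth_map n W m \<phi>" and \<chi>: "smooth_map m U n ?\<chi>"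
    using assms(1) by (auto simp: diffeomorphism_def)
  have im: "\<phi> ` W \<subseteq> U" "?\<chi> ` U \<subseteq> W"
    using bij bij_betw_inv_into[OF bij] by (auto simp: bij_betw_def)
  have left: "?\<chi> (\<phi> y) = y" if "y \<in> W" for y
    by (rule bij_betw_inv_into_left[OF bij that])
  have right: "\<phi> (?\<chi> z) = z" if "z \<in> U" for z
    by (rule bij_betw_inv_into_right[OF bij that])
  show "\<phi> y \<in> U" if "y \<in> W" for y using im that by blast
  show "?\<chi> (\<phi> y) = y" if "y \<in> W" for y by (rule left[OF that])
  show "differential m ?\<chi> (\<phi> y) (differential n \<phi> y v) = v" if "y \<in> W" "v \<in> Rn n" for y v
  proof -
    have "differential m ?\<chi> (\<phi> y) (differential n \<phi> y v) = differential n (\<lambda>y. ?\<chi> (\<phi> y)) y v"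
      by (rule differential_compose[OF W U \<phi> im(1) \<chi> that(1), symmetric])
    also have "\<dots> = differential n (\<lambda>y. y) y v"
      by (rule differential_cong[OF W that(1) left])
    finally show ?thesis using differential_id[OF that(2)] by simp
  qed
  show "differential n \<phi> y (differential m ?\<chi> (\<phi> y) v) = v" if "y \<in> W" "v \<in> Rn m" for y v
  proof -
    have yU: "\<phi> y \<in> U" using im that by blast
    have "differential n \<phi> (?\<chi> (\<phi> y)) (differential m ?\<chi> (\<phi> y) v) = differential m (\<lambda>z. \<phi> (?\<chi> z)) (\<phi> y) v"
      by (rule differential_compose[OF U W \<chi> im(2) \<phi> yU, symmetric])
    also have "\<dots> = differential m (\<lambda>z. z) (\<phi> y) v"
      by (rule differential_cong[OF U yU right])
    finally show ?thesis using differential_id[OF that(2)] left[OF that(1)] by simp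
  qed
qed

lemma (in lie_frame) pullback:
  assumes \<phi>: "diffeomorphism n W n U \<phi>" and W: "open_Rn n W"
  shows "lie_frame n W (\<lambda>u y. differential n (inv_into W \<phi>) (\<phi> y) (F u (\<phi> y)))
    (\<lambda>y v. \<Theta> (\<phi> y) (differential n \<phi> y v)) B"
proof (rule lie_frame.intro)
  let ?\<chi> = "inv_into W \<phi>"
  let ?F = "\<lambda>u y. differential n ?\<chi> (\<phi> y) (F u (\<phi> y))"
  note inv = diffeomorphism_inverse[OF \<phi> W open_U]
  have sm: "smooth_map n W n \<phi>" "smooth_map n U n ?\<chi>"
    using \<phi> by (auto simp: diffeomorphism_def)
  have im: "\<phi> ` W \<subseteq> U" using inv(1) by blast
  show "open_Rn n W" by (rule W)
  show "linear (\<lambda>u. ?F u y)" if "y \<in> W" for y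
    using linear_compose[OF linear_F[OF inv(1)[OF that]] linear_differential] by (simp add: o_def)
  show lin\<Theta>: "linear (\<lambda>v. \<Theta> (\<phi> y) (differential n \<phi> y v))" if "y \<in> W" for y
    using linear_compose[OF linear_differential linear_\<Theta>[OF inv(1)[OF that]]] by (simp add: o_def)
  show field': "vector_field n W (?F u)" if "u \<in> Rn n" for u
    by (rule smooth_map_compose[OF W open_U sm(1) im vector_field_differential[OF open_U sm(2) field[OF that]]])
  show "\<Theta> (\<phi> y) (differential n \<phi> y (?F u y)) = u" if "y \<in> W" "u \<in> Rn n" for y u
    using inv(1,4)[OF that(1)] F_in_Rn[OF that(2)] \<Theta>_F[OF _ that(2)] by simp
  show "differential n ?\<chi> (\<phi> y) (F (\<Theta> (\<phi> y) (differential n \<phi> y v)) (\<phi> y)) = v" if "y \<in> W" "v \<in> Rn n" for y v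
    using inv(1,3)[OF that(1)] that(2) F_\<Theta>[OF _ differential_in_Rn[OF W sm(1) that(1)]] by simp
  show "B u v \<in> Rn n" if "u \<in> Rn n" "v \<in> Rn n" for u v by (rule B_in_Rn[OF that])
  show "smooth_map n W n (\<lambda>y. \<Theta> (\<phi> y) (differential n \<phi> y (unitv i)))" if i: "i < n" for i
  proof -
    have d: "differential n \<phi> y (unitv i) k = pd i (\<lambda>y. \<phi> y k) y" for y k
      by (simp add: differential_dird dird_unitv[OF i])
    have eq: "(\<Sum>k<n. pd i (\<lambda>y. \<phi> y k) y * \<Theta> (\<phi> y) (unitv k) l) = \<Theta> (\<phi> y) (differential n \<phi> y (unitv i)) l"
      if "y \<in> W" for y l
      using linear_expansion_apply[OF linear_\<Theta>[OF inv(1)[OF that]] differential_in_Rn[OF W sm(1) that, of "unitv i"]]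
      by (simp add: d)
    have "smooth_fun n W (\<lambda>y. \<Theta> (\<phi> y) (differential n \<phi> y (unitv i)) l)" for l
    proof (rule smooth_fun_cong[OF W _ eq])
      show "smooth_fun n W (\<lambda>y. \<Sum>k<n. pd i (\<lambda>y. \<phi> y k) y * \<Theta> (\<phi> y) (unitv k) l)"
        by (intro smooth_fun_sum[OF W] smooth_fun_mult[OF W] smooth_fun_pd[OF smooth_map_component[OF W sm(1)]] i
            smooth_fun_compose[OF W open_U sm(1) im] smooth_map_component[OF open_U coframe])
    qed
    moreover have "\<Theta> (\<phi> y) (differential n \<phi> y (unitv i)) \<in> Rn n" if "y \<in> W" for y
      by (rule coefficients_in_Rn[OF inv(1)[OF that] differential_in_Rn[OF W sm(1) that]])
    ultimately show ?thesis by (auto simp: smooth_map_def)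
  qed
  show "lie_bracket n (?F u) (?F v) y = ?F (B u v) y" if y: "y \<in> W" and uv: "u \<in> Rn n" "v \<in> Rn n" for y u v
  proof -
    have rel: "F u (\<phi> y) = differential n \<phi> y (?F u y)" if "y \<in> W" "u \<in> Rn n" for y u
      using inv(4)[OF that(1) F_in_Rn[OF that(2) inv(1)[OF that(1)]]] by simp
    have "lie_bracket n (F u) (F v) (\<phi> y) = differential n \<phi> y (lie_bracket n (?F u) (?F v) y)"
      by (rule lie_bracket_related[OF W open_U sm(1) im field' field' field field])
        (use rel y uv in auto)
    then show ?thesis
      using inv(3)[OF y lie_bracket_in_Rn[OF W field'[OF uv(1)] field'[OF uv(2)] y]] bracket[OF inv(1)[OF y] uv]
      by simp
  qed
qed

section \<open>The left-invariant frame of a Lie group\<close>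

text \<open>A pair of points of \<open>\<real>\<^sup>n\<close> as a point of \<open>\<real>\<^sup>2\<^sup>n\<close>.\<close>

definition pair_pt :: "nat \<Rightarrow> pt \<Rightarrow> pt \<Rightarrow> pt"
  where "pair_pt n a b = (\<lambda>i. if i < n then a i else if i < n + n then b (i - n) else 0)"

context
  fixes n :: nat and G :: "pt monoid" (structure)
  assumes G: "lie_group n G"
begin

lemma group_G: "group G" and carrier_G: "carrier G = Rn n"
  and smooth_inverse: "smooth_map n (Rn n) n (\<lambda>a. inv a)"
  using G by (auto simp: lie_group_def)

lemma smooth_pair_mult:
  "smooth_map (n + n) (Rn (n + n)) n
    (\<lambda>z. (\<lambda>i. if i < n then z i else 0) \<otimes> (\<lambda>i. if i < n then z (n + i) else 0))"
  using G by (simp add: lie_group_def)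

lemma pair_pt_in_Rn: "pair_pt n a b \<in> Rn (n + n)"
  by (auto simp: pair_pt_def Rn_iff)

lemma pair_pt_mult:
  assumes "a \<in> Rn n" "b \<in> Rn n"
  shows "(\<lambda>i. if i < n then pair_pt n a b i else 0) \<otimes> (\<lambda>i. if i < n then pair_pt n a b (n + i) else 0) = a \<otimes> b"
proof -
  have "(\<lambda>i. if i < n then pair_pt n a b i else 0) = a" "(\<lambda>i. if i < n then pair_pt n a b (n + i) else 0) = b"
    using assms by (auto simp: pair_pt_def Rn_iff fun_eq_iff)
  then show ?thesis by simp
qed

lemma smooth_pair:
  assumes U: "open_Rn m U" and "smooth_map m U n f" "smooth_map m U n g"
  shows "smooth_map m U (n + n) (\<lambda>x. pair_pt n (f x) (g x))"
proof -
  have "smooth_fun m U (\<lambda>x. pair_pt n (f x) (g x) k)" for k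
    unfolding pair_pt_def
    by (cases "k < n"; cases "k < n + n")
      (auto intro: smooth_map_component[OF U] assms smooth_fun_const[OF U])
  then show ?thesis using pair_pt_in_Rn by (auto simp: smooth_map_def)
qed

lemma smooth_mult:
  assumes U: "open_Rn m U" and f: "smooth_map m U n f" and g: "smooth_map m U n g"
  shows "smooth_map m U n (\<lambda>x. f x \<otimes> g x)"
proof -
  have "smooth_fun m U (\<lambda>x. (f x \<otimes> g x) k)" for k
  proof (rule smooth_fun_cong[OF U])
    show "smooth_fun m U (\<lambda>x. ((\<lambda>i. if i < n then pair_pt n (f x) (g x) i else 0) \<otimes>
        (\<lambda>i. if i < n then pair_pt n (f x) (g x) (n + i) else 0)) k)"
      by (rule smooth_fun_compose[OF U openin_Rn smooth_pair[OF U f g]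
          _ smooth_map_component[OF openin_Rn smooth_pair_mult]])
        (use pair_pt_in_Rn in blast)
  qed (simp add: pair_pt_mult[OF smooth_map_in_Rn[OF f] smooth_map_in_Rn[OF g]])
  moreover have "f x \<otimes> g x \<in> Rn n" if "x \<in> U" for x
    using monoid.m_closed[OF group.is_monoid[OF group_G]] smooth_map_in_Rn[OF f that] smooth_map_in_Rn[OF g that]
    by (simp add: carrier_G)
  ultimately show ?thesis by (auto simp: smooth_map_def)
qed

lemma smooth_map_const: "open_Rn m U \<Longrightarrow> c \<in> Rn n \<Longrightarrow> smooth_map m U n (\<lambda>_. c)"
  by (auto simp: smooth_map_def smooth_fun_const)

lemma smooth_translation: "a \<in> Rn n \<Longrightarrow> smooth_map n (Rn n) n (\<lambda>b. a \<otimes> b)"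
  by (intro smooth_mult openin_Rn smooth_map_const smooth_map_id)

text \<open>A partial derivative of a left translation is one of the multiplication map in its second
  argument, hence depends smoothly on both arguments.\<close>

lemma pd_translation:
  assumes "a \<in> Rn n" "b \<in> Rn n" "i < n"
  shows "pd i (\<lambda>b. (a \<otimes> b) k) b = pd (n + i) (\<lambda>z. ((\<lambda>i. if i < n then z i else 0) \<otimes>
    (\<lambda>i. if i < n then z (n + i) else 0)) k) (pair_pt n a b)"
proof -
  have "(pair_pt n a b)(n + i := t) = pair_pt n a (b(i := t))" for t
    using assms(3) by (auto simp: pair_pt_def fun_eq_iff)
  moreover have "pair_pt n a b (n + i) = b i"
    using assms(3) by (simp add: pair_pt_def)
  ultimately show ?thesis
    unfolding pd_def by (simp only: pair_pt_mult[OF assms(1) upd_in_Rn[OF assms(2,3)]])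
qed

lemma smooth_differential_translation:
  assumes U: "open_Rn m U" and f: "smooth_map m U n f" and g: "smooth_map m U n g"
  shows "smooth_map m U n (\<lambda>x. differential n (\<lambda>b. f x \<otimes> b) (g x) v)"
proof -
  have "smooth_fun m U (\<lambda>x. differential n (\<lambda>b. f x \<otimes> b) (g x) v k)" for k
  proof (rule smooth_fun_cong[OF U])
    show "smooth_fun m U (\<lambda>x. \<Sum>i<n. v i * pd (n + i) (\<lambda>z. ((\<lambda>i. if i < n then z i else 0) \<otimes>
        (\<lambda>i. if i < n then z (n + i) else 0)) k) (pair_pt n (f x) (g x)))"
    proof (intro smooth_fun_sum[OF U] smooth_fun_mult[OF U] smooth_fun_const[OF U])
      fix i assume i: "i < n"
      show "smooth_fun m U (\<lambda>x. pd (n + i) (\<lambda>z. ((\<lambda>i. if i < n then z i else 0) \<otimes>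
          (\<lambda>i. if i < n then z (n + i) else 0)) k) (pair_pt n (f x) (g x)))"
      proof (rule smooth_fun_compose[OF U openin_Rn smooth_pair[OF U f g]])
        show "smooth_fun (n + n) (Rn (n + n)) (pd (n + i) (\<lambda>z. ((\<lambda>i. if i < n then z i else 0) \<otimes>
            (\<lambda>i. if i < n then z (n + i) else 0)) k))"
          by (rule smooth_fun_pd[OF smooth_map_component[OF openin_Rn smooth_pair_mult]]) (use i in simp)
      qed (use pair_pt_in_Rn in blast)
    qed
  qed (simp add: differential_def pd_translation[OF smooth_map_in_Rn[OF f] smooth_map_in_Rn[OF g]])
  moreover have "differential n (\<lambda>b. f x \<otimes> b) (g x) v \<in> Rn n" if "x \<in> U" for x
    by (rule differential_in_Rn[OF openin_Rn smooth_translation[OF smooth_map_in_Rn[OF f that]] smooth_map_in_Rn[OF g that]])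
  ultimately show ?thesis by (auto simp: smooth_map_def)
qed

text \<open>The bracket of two left-invariant fields is left-invariant because the left translations relate
  the fields to themselves; so it is determined by its value at the unit.\<close>

lemma left_invariant_frame:
  "lie_frame n (Rn n) (left_invariant_field n G) (\<lambda>a. differential n (\<lambda>b. inv a \<otimes> b) a) (group_bracket n G)"
proof (rule lie_frame.intro)
  interpret group G by (rule group_G)
  have one: "\<one> \<in> Rn n" and invR: "\<And>a. a \<in> Rn n \<Longrightarrow> inv a \<in> Rn n"
    and multR: "\<And>a b. a \<in> Rn n \<Longrightarrow> b \<in> Rn n \<Longrightarrow> a \<otimes> b \<in> Rn n"
    using one_closed inv_closed m_closed by (auto simp: carrier_G)
  have comp: "differential n (\<lambda>b. a \<otimes> b) (c \<otimes> x) (differential n (\<lambda>b. c \<otimes> b) x v) =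
      differential n (\<lambda>b. (a \<otimes> c) \<otimes> b) x v" if "a \<in> Rn n" "c \<in> Rn n" "x \<in> Rn n" for a c x v
  proof -
    have "differential n (\<lambda>b. (a \<otimes> c) \<otimes> b) x v = differential n (\<lambda>b. a \<otimes> (c \<otimes> b)) x v"
      by (rule differential_cong[OF openin_Rn that(3)]) (use that in \<open>simp add: m_assoc carrier_G\<close>)
    also have "\<dots> = differential n (\<lambda>b. a \<otimes> b) (c \<otimes> x) (differential n (\<lambda>b. c \<otimes> b) x v)"
      by (rule differential_compose[OF openin_Rn openin_Rn smooth_translation[OF that(2)] _ smooth_translation[OF that(1)] that(3)])
        (use multR that(2) in blast)
    finally show ?thesis ..
  qed
  have unit: "differential n (\<lambda>b. \<one> \<otimes> b) x v = v" if "x \<in> Rn n" "v \<in> Rn n" for x v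
  proof -
    have "differential n (\<lambda>b. \<one> \<otimes> b) x v = differential n (\<lambda>b. b) x v"
      by (rule differential_cong[OF openin_Rn that(1)]) (simp add: carrier_G)
    then show ?thesis using differential_id[OF that(2)] by simp
  qed
  show "open_Rn n (Rn n)" by (rule openin_Rn)
  show "linear (\<lambda>u. left_invariant_field n G u y)" for y
    unfolding left_invariant_field_def by (rule linear_differential)
  show "linear (differential n (\<lambda>b. inv y \<otimes> b) y)" for y
    by (rule linear_differential)
  show field: "vector_field n (Rn n) (left_invariant_field n G u)" if "u \<in> Rn n" for u
    unfolding left_invariant_field_def
    by (rule smooth_differential_translation[OF openin_Rn smooth_map_id[OF openin_Rn] smooth_map_const[OF openin_Rn one]])
  show "smooth_map n (Rn n) n (\<lambda>y. differential n (\<lambda>b. inv y \<otimes> b) y (unitv i))" for i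
    by (rule smooth_differential_translation[OF openin_Rn smooth_inverse smooth_map_id[OF openin_Rn]])
  show "differential n (\<lambda>b. inv y \<otimes> b) y (left_invariant_field n G u y) = u" if "y \<in> Rn n" "u \<in> Rn n" for y u
    using comp[OF invR[OF that(1)] that(1) one, of u] that unit[OF one that(2)]
    by (simp add: left_invariant_field_def l_inv carrier_G)
  show "left_invariant_field n G (differential n (\<lambda>b. inv y \<otimes> b) y v) y = v" if "y \<in> Rn n" "v \<in> Rn n" for y v
    using comp[OF that(1) invR[OF that(1)] that(1), of v] that unit[OF that]
    by (simp add: left_invariant_field_def l_inv r_inv carrier_G)
  show "group_bracket n G u v \<in> Rn n" if "u \<in> Rn n" "v \<in> Rn n" for u v
    unfolding group_bracket_def by (rule lie_bracket_in_Rn[OF openin_Rn field[OF that(1)] field[OF that(2)] one])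
  show "lie_bracket n (left_invariant_field n G u) (left_invariant_field n G v) y =
      left_invariant_field n G (group_bracket n G u v) y"
    if y: "y \<in> Rn n" and uv: "u \<in> Rn n" "v \<in> Rn n" for y u v
  proof -
    have inv: "left_invariant_field n G u (y \<otimes> a) = differential n (\<lambda>b. y \<otimes> b) a (left_invariant_field n G u a)"
      if "a \<in> Rn n" for u a
      using comp[OF y that one, of u] that by (simp add: left_invariant_field_def carrier_G)
    have "lie_bracket n (left_invariant_field n G u) (left_invariant_field n G v) (y \<otimes> \<one>) =
      differential n (\<lambda>b. y \<otimes> b) \<one> (lie_bracket n (left_invariant_field n G u) (left_invariant_field n G v) \<one>)"
      by (rule lie_bracket_related[OF openin_Rn openin_Rn smooth_translation[OF y] _ field field field field])
        (use inv one uv multR[OF y] in auto)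
    then show ?thesis
      using y by (simp add: left_invariant_field_def group_bracket_def carrier_G)
  qed
qed

end

section \<open>The Hilbert--Cartan distribution\<close>

text \<open>The frame consisting of \<open>X = \<partial>\<^sub>x + z\<^sub>2\<^sup>2 \<partial>\<^sub>y + z\<^sub>1 \<partial>\<^sub>z + z\<^sub>2 \<partial>\<^sub>z\<^sub>1\<close>, \<open>Y = \<partial>\<^sub>z\<^sub>2\<close>, \<open>[Y, X]\<close>, \<open>[Y, [Y, X]]\<close>, \<open>[X, [Y, X]]\<close>
  has constant structure functions, given by \<open>hc_bracket\<close> below. The field with the coefficient vector
  \<open>u\<close> in this frame is \<open>hc_field u\<close>.\<close>

definition hc_field :: "pt \<Rightarrow> pt \<Rightarrow> pt"
  where "hc_field u p = (\<lambda>_. 0)(0 := u 0, 1 := u 0 * (p 4)\<^sup>2 + 2 * u 2 * p 4 + 2 * u 3,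
    2 := u 0 * p 3 - u 4, 3 := u 0 * p 4 + u 2, 4 := u 1)"

text \<open>The coefficient vector, in this frame, of a tangent vector at \<open>p\<close>.\<close>

definition hc_coeff :: "pt \<Rightarrow> pt \<Rightarrow> pt"
  where "hc_coeff p v = (\<lambda>_. 0)(0 := v 0, 1 := v 4, 2 := v 3 - v 0 * p 4,
    3 := v 1 / 2 - (v 0 / 2) * (p 4)\<^sup>2 - p 4 * (v 3 - v 0 * p 4), 4 := v 0 * p 3 - v 2)"

definition hc_bracket :: "pt \<Rightarrow> pt \<Rightarrow> pt"
  where "hc_bracket u v = (\<lambda>_. 0)(2 := u 1 * v 0 - u 0 * v 1, 3 := u 1 * v 2 - u 2 * v 1,
    4 := u 0 * v 2 - u 2 * v 0)"

lemma Rn5_eqI: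
  assumes "u \<in> Rn 5" "v \<in> Rn 5" "u 0 = v 0" "u 1 = v 1" "u 2 = v 2" "u 3 = v 3" "u 4 = v 4"
  shows "u = v"
proof
  fix k :: nat
  consider "k = 0" | "k = 1" | "k = 2" | "k = 3" | "k = 4" | "k \<ge> 5" by linarith
  then show "u k = v k" using assms by cases (auto simp: Rn_iff)
qed

lemma hc_in_Rn: "hc_field u p \<in> Rn 5" "hc_coeff p v \<in> Rn 5" "hc_bracket u v \<in> Rn 5"
  by (auto simp: hc_field_def hc_coeff_def hc_bracket_def Rn_iff)

lemma smooth_hc_field: "vector_field 5 (Rn 5) (hc_field u)"
proof -
  note O = openin_Rn[of 5]
  have "smooth_fun 5 (Rn 5) (\<lambda>p. hc_field u p k)" for k
  proof -
    consider "k = 0" | "k = 1" | "k = 2" | "k = 3" | "k = 4" | "k \<ge> 5" by linarith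
    then show ?thesis
      by cases (auto simp: hc_field_def power2_eq_square intro!: smooth_fun_add[OF O] smooth_fun_diff[OF O]
        smooth_fun_mult[OF O] smooth_fun_const[OF O] smooth_fun_coordinate[OF O])
  qed
  then show ?thesis using hc_in_Rn(1) by (auto simp: smooth_map_def)
qed

lemma dird_hc_field:
  "dird 5 (\<lambda>p. hc_field v p 0) p w = 0"
  "dird 5 (\<lambda>p. hc_field v p 1) p w = w 4 * (2 * v 0 * p 4 + 2 * v 2)"
  "dird 5 (\<lambda>p. hc_field v p 2) p w = w 3 * v 0"
  "dird 5 (\<lambda>p. hc_field v p 3) p w = w 4 * v 0"
  "dird 5 (\<lambda>p. hc_field v p 4) p w = 0"
proof -
  show "dird 5 (\<lambda>p. hc_field v p 0) p w = 0" "dird 5 (\<lambda>p. hc_field v p 4) p w = 0"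
    by (simp_all add: hc_field_def dird_const)
  show "dird 5 (\<lambda>p. hc_field v p 1) p w = w 4 * (2 * v 0 * p 4 + 2 * v 2)"
  proof -
    have "((\<lambda>t. v 0 * t\<^sup>2 + 2 * v 2 * t + 2 * v 3) has_real_derivative 2 * v 0 * p 4 + 2 * v 2) (at (p 4))"
      by (auto intro!: derivative_eq_intros)
    from dird_coordinate_function[where n = 5 and k = 4 and p = p and g = "\<lambda>t. v 0 * t\<^sup>2 + 2 * v 2 * t + 2 * v 3", OF _ this] show ?thesis by (simp add: hc_field_def)
  qed
  show "dird 5 (\<lambda>p. hc_field v p 2) p w = w 3 * v 0"
  proof -
    have "((\<lambda>t. v 0 * t - v 4) has_real_derivative v 0) (at (p 3))"
      by (auto intro!: derivative_eq_intros)
    from dird_coordinate_function[where n = 5 and k = 3 and p = p and g = "\<lambda>t. v 0 * t - v 4", OF _ this] show ?thesis by (simp add: hc_field_def)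
  qed
  show "dird 5 (\<lambda>p. hc_field v p 3) p w = w 4 * v 0"
  proof -
    have "((\<lambda>t. v 0 * t + v 2) has_real_derivative v 0) (at (p 4))"
      by (auto intro!: derivative_eq_intros)
    from dird_coordinate_function[where n = 5 and k = 4 and p = p and g = "\<lambda>t. v 0 * t + v 2", OF _ this] show ?thesis by (simp add: hc_field_def)
  qed
qed

lemma linear_hc_field: "linear (\<lambda>u. hc_field u p)"
  by (rule linearI) (rule Rn5_eqI; simp add: hc_field_def Rn_iff scaleR_fun_def algebra_simps)+

lemma linear_hc_coeff: "linear (hc_coeff p)"
  by (rule linearI) (rule Rn5_eqI; simp add: hc_coeff_def Rn_iff scaleR_fun_def field_simps)+

lemma hc_coeff_field: "u \<in> Rn 5 \<Longrightarrow> hc_coeff p (hc_field u p) = u"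
  by (rule Rn5_eqI) (simp_all add: hc_in_Rn, simp_all add: hc_coeff_def hc_field_def field_simps)

lemma hc_field_coeff: "v \<in> Rn 5 \<Longrightarrow> hc_field (hc_coeff p v) p = v"
  by (rule Rn5_eqI) (simp_all add: hc_in_Rn, simp_all add: hc_coeff_def hc_field_def field_simps power2_eq_square)

lemma hc_frame: "lie_frame 5 (Rn 5) hc_field hc_coeff hc_bracket"
proof (rule lie_frame.intro)
  note O = openin_Rn[of 5]
  show "smooth_map 5 (Rn 5) 5 (\<lambda>y. hc_coeff y (unitv i))" for i
  proof -
    have "smooth_fun 5 (Rn 5) (\<lambda>p. hc_coeff p (unitv i) k)" for k
    proof -
      consider "k = 0" | "k = 1" | "k = 2" | "k = 3" | "k = 4" | "k \<ge> 5" by linarith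
      then show ?thesis
        by cases (auto simp: hc_coeff_def power2_eq_square
          simp del: times_divide_eq_left times_divide_eq_right intro!: smooth_fun_add[OF O] smooth_fun_diff[OF O]
          smooth_fun_mult[OF O] smooth_fun_const[OF O] smooth_fun_coordinate[OF O])
    qed
    then show ?thesis using hc_in_Rn(2) by (auto simp: smooth_map_def)
  qed
  show "lie_bracket 5 (hc_field u) (hc_field v) y = hc_field (hc_bracket u v) y" if "y \<in> Rn 5" for u v y
  proof (rule Rn5_eqI)
    show "lie_bracket 5 (hc_field u) (hc_field v) y \<in> Rn 5"
      by (rule lie_bracket_in_Rn[OF O smooth_hc_field smooth_hc_field that])
  qed (simp_all only: hc_in_Rn lie_bracket_apply dird_hc_field, 
      simp_all add: hc_field_def hc_bracket_def algebra_simps)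
qed (simp_all add: linear_hc_field linear_hc_coeff smooth_hc_field hc_coeff_field hc_field_coeff hc_in_Rn)

text \<open>The coefficient vectors of the members of the weak derived flag.\<close>

definition hc_flag :: "nat \<Rightarrow> pt set"
  where "hc_flag i = (if i = 0 then {0} else if i = 1 then {u \<in> Rn 5. u 2 = 0 \<and> u 3 = 0 \<and> u 4 = 0}
    else if i = 2 then {u \<in> Rn 5. u 3 = 0 \<and> u 4 = 0} else Rn 5)"

lemma subspace_hc_flag: "subspace (hc_flag i)"
  by (auto simp: hc_flag_def subspace_def Rn_iff scaleR_fun_def)

lemma hc_flag_subset: "hc_flag i \<subseteq> Rn 5"
  by (auto simp: hc_flag_def Rn_iff)

lemma hc_field_unitv:
  "hc_field (unitv 0) p = (\<lambda>_. 0)(0 := 1, 1 := (p 4)\<^sup>2, 2 := p 3, 3 := p 4)"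
  "hc_field (unitv 1) p = (\<lambda>_. 0)(4 := 1)"
  by (rule Rn5_eqI; simp add: hc_field_def unitv_def Rn_iff)+

lemma hilbert_cartan_span: "hilbert_cartan p = span {hc_field (unitv 0) p, hc_field (unitv 1) p}"
  by (simp only: hilbert_cartan_def hc_field_unitv)

lemma hilbert_cartan_frame: "hilbert_cartan p = (\<lambda>u. hc_field u p) ` hc_flag 1"
proof
  have "unitv 0 \<in> hc_flag 1" "unitv 1 \<in> hc_flag 1"
    by (auto simp: hc_flag_def unitv_def Rn_iff)
  then show "hilbert_cartan p \<subseteq> (\<lambda>u. hc_field u p) ` hc_flag 1"
    unfolding hilbert_cartan_span
    by (intro span_minimal linear_subspace_image[OF linear_hc_field subspace_hc_flag]) auto
  show "(\<lambda>u. hc_field u p) ` hc_flag 1 \<subseteq> hilbert_cartan p"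
  proof clarify
    fix u assume u: "u \<in> hc_flag 1"
    have "hc_field u p = u 0 *\<^sub>R hc_field (unitv 0) p + u 1 *\<^sub>R hc_field (unitv 1) p"
      using u by (intro Rn5_eqI)
        (simp_all add: hc_field_def unitv_def hc_flag_def scaleR_fun_def Rn_iff)
    then show "hc_field u p \<in> hilbert_cartan p"
      unfolding hilbert_cartan_span
      by (simp add: span_add span_scale span_base)
  qed
qed

lemma weak_flag_hilbert_cartan:
  assumes "p \<in> Rn 5"
  shows "weak_flag 5 (Rn 5) hilbert_cartan i p = (\<lambda>u. hc_field u p) ` hc_flag i"
  using assms
proof (induction i arbitrary: p rule: less_induct)
  case (less i)
  interpret hc: lie_frame 5 "Rn 5" hc_field hc_coeff hc_bracket by (rule hc_frame)
  consider "i = 0" | "i = 1" | j where "i = Suc (Suc j)" by (metis One_nat_def not0_implies_Suc)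
  then show ?case
  proof cases
    case 1
    have "(\<lambda>u. hc_field u p) ` {0} = {0}"
      using linear_0[OF linear_hc_field, of p] by (simp only: image_insert image_empty)
    moreover have "hc_flag 0 = {0}" by (simp add: hc_flag_def)
    ultimately show ?thesis using 1 by (simp only: weak_flag.simps(1))
  next
    case 2
    then show ?thesis by (simp add: hilbert_cartan_frame)
  next
    case 3
    have IH: "weak_flag 5 (Rn 5) hilbert_cartan (Suc j) y = (\<lambda>u. hc_field u y) ` hc_flag (Suc j)"
      if "y \<in> Rn 5" for y using less.IH[of "Suc j" y] 3 that by simp
    have up: "weak_flag 5 (Rn 5) hilbert_cartan (Suc (Suc j)) p \<subseteq> (\<lambda>u. hc_field u p) ` hc_flag (Suc (Suc j))"
    proof (rule hc.weak_flag_step[OF hc_flag_subset _ hc_flag_subset])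
      show "hc_flag 1 \<subseteq> hc_flag (Suc (Suc j))" "hc_flag (Suc j) \<subseteq> hc_flag (Suc (Suc j))"
        by (auto simp: hc_flag_def Rn_iff)
      show "hc_bracket u v \<in> hc_flag (Suc (Suc j))" if "u \<in> hc_flag 1" "v \<in> hc_flag (Suc j)" for u v
        using that by (cases "j = 0") (auto simp: hc_flag_def hc_bracket_def Rn_iff)
    qed (use IH less.prems hilbert_cartan_frame subspace_hc_flag in auto)
    let ?w = "weak_flag 5 (Rn 5) hilbert_cartan (Suc (Suc j)) p"
    have sub: "subspace ?w" by simp
    have inc: "hc_field v p \<in> ?w" if "v \<in> hc_flag (Suc j)" for v
    proof (rule hc.weak_flag_increasing[OF hc_flag_subset _ hc_flag_subset _ subspace_hc_flag _ _ that less.prems])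
      show "unitv 0 \<in> hc_flag 1" by (auto simp: hc_flag_def unitv_def Rn_iff)
      show "unitv 0 \<noteq> 0" by (auto simp: unitv_def fun_eq_iff)
    qed (use IH hilbert_cartan_frame in auto)
    have br: "hc_field (hc_bracket u v) p \<in> ?w" if "u \<in> hc_flag 1" "v \<in> hc_flag (Suc j)" for u v
      by (rule hc.weak_flag_bracket[OF hc_flag_subset _ hc_flag_subset _ that less.prems])
        (use IH hilbert_cartan_frame in auto)
    have e: "unitv 0 \<in> hc_flag 1" "unitv 1 \<in> hc_flag 1" "unitv 0 \<in> hc_flag (Suc j)"
      by (auto simp: hc_flag_def unitv_def Rn_iff)
    have "hc_field u p \<in> ?w" if u: "u \<in> hc_flag (Suc (Suc j))" for u
    proof (cases "j = 0")
      case True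
      define v where "v = u - u 2 *\<^sub>R hc_bracket (unitv 1) (unitv 0)"
      have "v \<in> hc_flag (Suc j)"
        using u True by (auto simp: v_def hc_flag_def hc_bracket_def unitv_def scaleR_fun_def Rn_iff)
      moreover have "hc_field u p = hc_field v p + u 2 *\<^sub>R hc_field (hc_bracket (unitv 1) (unitv 0)) p"
        unfolding v_def linear_diff[OF linear_hc_field] linear_scale[OF linear_hc_field] by simp
      ultimately show ?thesis
        using inc br[OF e(2,3)] subspace_add[OF sub] subspace_scale[OF sub] by simp
    next
      case False
      define v where "v = u - u 3 *\<^sub>R hc_bracket (unitv 1) (unitv 2) - u 4 *\<^sub>R hc_bracket (unitv 0) (unitv 2)"
      have 2: "unitv 2 \<in> hc_flag (Suc j)" using False by (auto simp: hc_flag_def unitv_def Rn_iff)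
      have "v \<in> hc_flag (Suc j)"
        using u False by (auto simp: v_def hc_flag_def hc_bracket_def unitv_def scaleR_fun_def Rn_iff)
      moreover have "hc_field u p = hc_field v p + u 3 *\<^sub>R hc_field (hc_bracket (unitv 1) (unitv 2)) p
          + u 4 *\<^sub>R hc_field (hc_bracket (unitv 0) (unitv 2)) p"
        unfolding v_def linear_diff[OF linear_hc_field] linear_scale[OF linear_hc_field] by simp
      ultimately show ?thesis
        using inc br[OF e(2) 2] br[OF e(1) 2] subspace_add[OF sub] subspace_scale[OF sub] by simp
    qed
    then show ?thesis using up 3 by blast
  qed
qed

lemma dim_inj_linear_image:
  fixes f :: "'a::real_vector \<Rightarrow> 'b::real_vector"
  assumes f: "linear f" and K: "subspace K" and inj: "inj_on f K"
  shows "dim (f ` K) = dim K"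
proof -
  obtain C where C: "C \<subseteq> K" "independent C" "K \<subseteq> span C" "card C = dim K"
    by (rule basis_exists)
  have span: "span C = K" using C(3) span_minimal[OF C(1) K] by (rule subset_antisym[rotated])
  have "independent (f ` C)"
    by (rule linear_independent_injective_image[OF f C(2)]) (use inj span in simp)
  then have "dim (span (f ` C)) = card (f ` C)" by (rule dim_span_eq_card_independent)
  moreover have "card (f ` C) = card C" by (rule card_image[OF inj_on_subset[OF inj C(1)]])
  ultimately show ?thesis using linear_span_image[OF f, of C] span C(4) by simp
qed

lemma hilbert_cartan_nonholonomic: "nonholonomic_distribution 5 (Rn 5) 2 hilbert_cartan"
  unfolding nonholonomic_distribution_def
proof (intro conjI)
  have inj: "inj_on (\<lambda>u. hc_field u p) (hc_flag i)" for p i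
  proof (rule inj_on_inverseI)
    fix u assume "u \<in> hc_flag i"
    then have "u \<in> Rn 5" using hc_flag_subset by blast
    then show "hc_coeff p (hc_field u p) = u" by (rule hc_coeff_field)
  qed
  have dim: "dim ((\<lambda>u. hc_field u p) ` hc_flag i) = dim (hc_flag i)" for p i
    by (rule dim_inj_linear_image[OF linear_hc_field subspace_hc_flag inj])
  show "\<forall>i. \<exists>r. \<forall>x\<in>Rn 5. dim (weak_flag 5 (Rn 5) hilbert_cartan i x) = r"
    using weak_flag_hilbert_cartan dim by simp
  show "\<exists>s. \<forall>x\<in>Rn 5. weak_flag 5 (Rn 5) hilbert_cartan s x = Rn 5"
  proof (intro exI ballI)
    fix x assume x: "x \<in> Rn 5"
    have "(\<lambda>u. hc_field u x) ` Rn 5 = Rn 5"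
    proof
      show "Rn 5 \<subseteq> (\<lambda>u. hc_field u x) ` Rn 5"
      proof
        fix v assume "v \<in> Rn 5"
        then have "v = hc_field (hc_coeff x v) x" by (simp only: hc_field_coeff)
        then show "v \<in> (\<lambda>u. hc_field u x) ` Rn 5" using hc_in_Rn(2) by (rule image_eqI)
      qed
    qed (use hc_in_Rn(1) in blast)
    then show "weak_flag 5 (Rn 5) hilbert_cartan 3 x = Rn 5"
      unfolding weak_flag_hilbert_cartan[OF x] by (simp add: hc_flag_def)
  qed
  show "distribution 5 (Rn 5) 2 hilbert_cartan"
    unfolding distribution_def
  proof (intro conjI ballI openin_Rn)
    fix x assume x: "x \<in> Rn 5"
    have eq: "hilbert_cartan y = span ((\<lambda>i. hc_field (unitv i) y) ` {..<2})" for y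
    proof -
      have "(\<lambda>i. hc_field (unitv i) y) ` {..<2} = {hc_field (unitv 0) y, hc_field (unitv 1) y}"
        by (auto simp: numeral_2_eq_2 lessThan_Suc)
      then show ?thesis by (simp add: hilbert_cartan_span)
    qed
    have "dim (hilbert_cartan y) = 2" for y
    proof -
      let ?X = "hc_field (unitv 0) y" and ?Y = "hc_field (unitv 1) y"
      have ap: "?X 0 = 1" "?Y 0 = 0" "?Y 4 = 1" by (simp_all add: hc_field_def unitv_def)
      have "?X \<notin> span {?Y}"
        using ap by (auto simp: span_singleton scaleR_fun_def dest: fun_cong[where x = 0])
      moreover have "?Y \<noteq> 0" using ap(3) by (auto dest: fun_cong[where x = 4])
      ultimately have "independent {?X, ?Y}" by (intro independent_insertI) (auto simp: independent_empty)
      then have "dim (span {?X, ?Y}) = card {?X, ?Y}"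
        by (rule dim_span_eq_card_independent)
      moreover have "?X \<noteq> ?Y" using ap by (auto dest: fun_cong[where x = 0])
      ultimately show ?thesis by (simp add: hilbert_cartan_span)
    qed
    then show "\<exists>W X. open_Rn 5 W \<and> x \<in> W \<and> W \<subseteq> Rn 5 \<and> (\<forall>i<2::nat. vector_field 5 W (X i)) \<and>
        (\<forall>y\<in>W. hilbert_cartan y = span ((\<lambda>i. X i y) ` {..<2}) \<and> dim (hilbert_cartan y) = 2)"
      using x eq smooth_hc_field openin_Rn
      by (intro exI[of _ "Rn 5"] exI[of _ "\<lambda>i. hc_field (unitv i)"]) auto
  qed
qed

subsection \<open>Integrating a homomorphism to the Hilbert--Cartan algebra\<close>

lemma (in lie_frame) homomorphism_integrates:
  assumes all: "U = Rn n" and lin: "linear \<Lambda>"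
    and hom: "\<And>u v. u \<in> Rn n \<Longrightarrow> v \<in> Rn n \<Longrightarrow> \<Lambda> (B u v) = hc_bracket (\<Lambda> u) (\<Lambda> v)"
  obtains P where "smooth_map n U 5 P"
    "\<And>u y. u \<in> Rn n \<Longrightarrow> y \<in> U \<Longrightarrow> differential n P y (F u y) = hc_field (\<Lambda> u) (P y)"
proof -
  note O = open_U
  have l: "\<Lambda> (a + b) k = \<Lambda> a k + \<Lambda> b k" "\<Lambda> (r *\<^sub>R a) k = r * \<Lambda> a k" for a b r k
    by (simp add: linear_add[OF lin], subst linear_scale[OF lin], simp add: scaleR_fun_def)
  have B: "\<Lambda> (B u v) 0 = 0" "\<Lambda> (B u v) 1 = 0" "\<Lambda> (B u v) 2 = \<Lambda> u 1 * \<Lambda> v 0 - \<Lambda> u 0 * \<Lambda> v 1"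
    "\<Lambda> (B u v) 3 = \<Lambda> u 1 * \<Lambda> v 2 - \<Lambda> u 2 * \<Lambda> v 1" "\<Lambda> (B u v) 4 = \<Lambda> u 0 * \<Lambda> v 2 - \<Lambda> u 2 * \<Lambda> v 0"
    if "u \<in> Rn n" "v \<in> Rn n" for u v
    using hom[OF that] by (simp_all add: hc_bracket_def)
  have aff: "dird n (\<lambda>y. f y * c + d) y w = dird n f y w * c" if "smooth_fun n U f" "y \<in> U" for f c d y w
  proof -
    have "dird n (\<lambda>y. f y * c + d) y w = dird n (\<lambda>y. f y * c) y w + dird n (\<lambda>y. d) y w"
      by (rule dird_add[OF O smooth_fun_mult[OF O that(1) smooth_fun_const[OF O]] smooth_fun_const[OF O] that(2)])
    also have "\<dots> = dird n f y w * c"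
      using dird_mult[OF O that(1) smooth_fun_const[OF O] that(2)] by (simp add: dird_const)
    finally show ?thesis .
  qed
  obtain X where X: "smooth_fun n U X" "\<And>u y. u \<in> Rn n \<Longrightarrow> y \<in> U \<Longrightarrow> dird n X y (F u y) = \<Lambda> u 0"
  proof (rule potential[OF all, of "\<lambda>u y. \<Lambda> u 0"])
    show "linear (\<lambda>u. \<Lambda> u 0)" by (rule linearI) (simp_all add: l)
  qed (auto simp: dird_const B smooth_fun_const[OF O])
  obtain Z2 where Z2: "smooth_fun n U Z2" "\<And>u y. u \<in> Rn n \<Longrightarrow> y \<in> U \<Longrightarrow> dird n Z2 y (F u y) = \<Lambda> u 1"
  proof (rule potential[OF all, of "\<lambda>u y. \<Lambda> u 1"])
    show "linear (\<lambda>u. \<Lambda> u 1)" by (rule linearI) (simp_all add: l)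
    show "dird n (\<lambda>y. \<Lambda> v 1) y (F u y) - dird n (\<lambda>y. \<Lambda> u 1) y (F v y) = \<Lambda> (B u v) 1"
      if "u \<in> Rn n" "v \<in> Rn n" for u v y
      unfolding B(2)[OF that] dird_const by simp
  qed (auto simp: smooth_fun_const[OF O])
  obtain Z1 where Z1: "smooth_fun n U Z1"
    "\<And>u y. u \<in> Rn n \<Longrightarrow> y \<in> U \<Longrightarrow> dird n Z1 y (F u y) = Z2 y * \<Lambda> u 0 + \<Lambda> u 2"
  proof (rule potential[OF all, of "\<lambda>u y. Z2 y * \<Lambda> u 0 + \<Lambda> u 2"])
    show "linear (\<lambda>u. Z2 y * \<Lambda> u 0 + \<Lambda> u 2)" for y by (rule linearI) (simp_all add: l algebra_simps)
    show "dird n (\<lambda>y. Z2 y * \<Lambda> v 0 + \<Lambda> v 2) y (F u y) - dird n (\<lambda>y. Z2 y * \<Lambda> u 0 + \<Lambda> u 2) y (F v y) =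
        Z2 y * \<Lambda> (B u v) 0 + \<Lambda> (B u v) 2"
      if "u \<in> Rn n" "v \<in> Rn n" "y \<in> U" for u v y
      unfolding aff[OF Z2(1) that(3)] Z2(2)[OF that(1,3)] Z2(2)[OF that(2,3)] B[OF that(1,2)] by simp
  qed (auto intro!: smooth_fun_add[OF O] smooth_fun_mult[OF O] smooth_fun_const[OF O] Z2(1))
  obtain Z where Z: "smooth_fun n U Z"
    "\<And>u y. u \<in> Rn n \<Longrightarrow> y \<in> U \<Longrightarrow> dird n Z y (F u y) = Z1 y * \<Lambda> u 0 + - \<Lambda> u 4"
  proof (rule potential[OF all, of "\<lambda>u y. Z1 y * \<Lambda> u 0 + - \<Lambda> u 4"])
    show "linear (\<lambda>u. Z1 y * \<Lambda> u 0 + - \<Lambda> u 4)" for y by (rule linearI) (simp_all add: l algebra_simps)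
    show "dird n (\<lambda>y. Z1 y * \<Lambda> v 0 + - \<Lambda> v 4) y (F u y) - dird n (\<lambda>y. Z1 y * \<Lambda> u 0 + - \<Lambda> u 4) y (F v y) =
        Z1 y * \<Lambda> (B u v) 0 + - \<Lambda> (B u v) 4"
      if "u \<in> Rn n" "v \<in> Rn n" "y \<in> U" for u v y
      unfolding aff[OF Z1(1) that(3)] Z1(2)[OF that(1,3)] Z1(2)[OF that(2,3)] B[OF that(1,2)]
      by (simp add: algebra_simps)
  qed (auto intro!: smooth_fun_diff[OF O] smooth_fun_mult[OF O] smooth_fun_const[OF O] Z1(1))
  have sq: "smooth_fun n U (\<lambda>y. Z2 y * c + d)" for c d
    by (intro smooth_fun_add[OF O] smooth_fun_mult[OF O] smooth_fun_const[OF O] Z2(1))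
  obtain Y where Y: "smooth_fun n U Y" "\<And>u y. u \<in> Rn n \<Longrightarrow> y \<in> U \<Longrightarrow>
      dird n Y y (F u y) = Z2 y * (Z2 y * \<Lambda> u 0 + 2 * \<Lambda> u 2) + 2 * \<Lambda> u 3"
  proof (rule potential[OF all, of "\<lambda>u y. Z2 y * (Z2 y * \<Lambda> u 0 + 2 * \<Lambda> u 2) + 2 * \<Lambda> u 3"])
    show "linear (\<lambda>u. Z2 y * (Z2 y * \<Lambda> u 0 + 2 * \<Lambda> u 2) + 2 * \<Lambda> u 3)" for y
      by (rule linearI) (simp_all add: l algebra_simps)
    have d: "dird n (\<lambda>y. Z2 y * (Z2 y * c + b) + a) y w = dird n Z2 y w * (2 * Z2 y * c + b)"
      if "y \<in> U" for a b c y w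
    proof -
      have "dird n (\<lambda>y. Z2 y * (Z2 y * c + b) + a) y w =
          dird n (\<lambda>y. Z2 y * (Z2 y * c + b)) y w + dird n (\<lambda>y. a) y w"
        by (rule dird_add[OF O smooth_fun_mult[OF O Z2(1) sq] smooth_fun_const[OF O] that])
      also have "\<dots> = dird n Z2 y w * (2 * Z2 y * c + b)"
        unfolding dird_mult[OF O Z2(1) sq that] aff[OF Z2(1) that] dird_const by (simp add: algebra_simps)
      finally show ?thesis .
    qed
    show "dird n (\<lambda>y. Z2 y * (Z2 y * \<Lambda> v 0 + 2 * \<Lambda> v 2) + 2 * \<Lambda> v 3) y (F u y) -
        dird n (\<lambda>y. Z2 y * (Z2 y * \<Lambda> u 0 + 2 * \<Lambda> u 2) + 2 * \<Lambda> u 3) y (F v y) =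
        Z2 y * (Z2 y * \<Lambda> (B u v) 0 + 2 * \<Lambda> (B u v) 2) + 2 * \<Lambda> (B u v) 3"
      if "u \<in> Rn n" "v \<in> Rn n" "y \<in> U" for u v y
      unfolding d[OF that(3)] Z2(2)[OF that(1,3)] Z2(2)[OF that(2,3)] B[OF that(1,2)]
      by (simp add: algebra_simps)
  qed (auto intro!: smooth_fun_add[OF O] smooth_fun_mult[OF O] smooth_fun_const[OF O] Z2(1))
  define P :: "pt \<Rightarrow> pt" where "P y = (\<lambda>_. 0)(0 := X y, 1 := Y y, 2 := Z y, 3 := Z1 y, 4 := Z2 y)" for y
  have "smooth_fun n U (\<lambda>y. P y k)" for k :: nat
  proof -
    consider "k = 0" | "k = 1" | "k = 2" | "k = 3" | "k = 4" | "k \<ge> 5" by linarith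
    then show ?thesis by cases (simp_all add: P_def X Y Z Z1 Z2 smooth_fun_const[OF O])
  qed
  then have P: "smooth_map n U 5 P" by (auto simp: smooth_map_def P_def Rn_iff)
  show thesis
  proof (rule that[OF P])
    fix u y assume u: "u \<in> Rn n" and y: "y \<in> U"
    show "differential n P y (F u y) = hc_field (\<Lambda> u) (P y)"
    proof (rule Rn5_eqI[OF differential_in_Rn[OF O P y] hc_in_Rn(1)])
      show "differential n P y (F u y) 0 = hc_field (\<Lambda> u) (P y) 0"
        using X(2)[OF u y] by (simp add: differential_dird P_def hc_field_def)
      show "differential n P y (F u y) 1 = hc_field (\<Lambda> u) (P y) 1"
        using Y(2)[OF u y] by (simp add: differential_dird P_def hc_field_def power2_eq_square algebra_simps)
      show "differential n P y (F u y) 2 = hc_field (\<Lambda> u) (P y) 2"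
        using Z(2)[OF u y] by (simp add: differential_dird P_def hc_field_def)
      show "differential n P y (F u y) 3 = hc_field (\<Lambda> u) (P y) 3"
        using Z1(2)[OF u y] by (simp add: differential_dird P_def hc_field_def)
      show "differential n P y (F u y) 4 = hc_field (\<Lambda> u) (P y) 4"
        using Z2(2)[OF u y] by (simp add: differential_dird P_def hc_field_def)
    qed
  qed
qed

section \<open>Homogeneous components in a graded Lie algebra\<close>

text \<open>The projection of all sequences to \<open>\<real>\<^sup>n\<close>.\<close>

definition truncation :: "nat \<Rightarrow> pt \<Rightarrow> pt"
  where "truncation n v = (\<lambda>i. if i < n then v i else 0)"

text \<open>\<open>c\<close> is the family of homogeneous components of \<open>v\<close>. The entries of \<open>v\<close> beyond the dimension
  are discarded first, so that the components are linear maps on the whole type.\<close>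

definition decomposition :: "nat \<Rightarrow> (nat \<Rightarrow> pt set) \<Rightarrow> pt \<Rightarrow> (nat \<Rightarrow> pt) \<Rightarrow> bool"
  where "decomposition n g v c \<longleftrightarrow> (\<forall>i. c i \<in> g i) \<and> finite {i. c i \<noteq> 0} \<and>
    truncation n v = (\<Sum>i\<in>{i. c i \<noteq> 0}. c i)"

definition component :: "nat \<Rightarrow> (nat \<Rightarrow> pt set) \<Rightarrow> nat \<Rightarrow> pt \<Rightarrow> pt"
  where "component n g i v = (THE c. decomposition n g v c) i"

lemma truncation_Rn: "v \<in> Rn n \<Longrightarrow> truncation n v = v"
  by (auto simp: truncation_def Rn_iff fun_eq_iff)

lemma truncation_in_Rn: "truncation n v \<in> Rn n"
  by (auto simp: truncation_def Rn_iff)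

lemma span_pair: "v \<in> span {x, y} \<Longrightarrow> \<exists>a b. v = a *\<^sub>R x + b *\<^sub>R y" for x y :: "'a::real_vector"
  by (auto simp: span_insert span_singleton algebra_simps)

lemma span_triple:
  fixes x y z :: "'a::real_vector"
  assumes "v \<in> span {x, y, z}"
  shows "\<exists>a b c. v = a *\<^sub>R x + b *\<^sub>R y + c *\<^sub>R z"
proof -
  have "v \<in> span (insert z {x, y})" using assms by (simp add: insert_commute)
  then obtain c where "v - c *\<^sub>R z \<in> span {x, y}" unfolding span_insert by blast
  then obtain a b where "v - c *\<^sub>R z = a *\<^sub>R x + b *\<^sub>R y" using span_pair by blast
  then have "v = a *\<^sub>R x + b *\<^sub>R y + c *\<^sub>R z" by (simp add: algebra_simps)
  then show ?thesis by blast
qed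

locale graded_algebra =
  fixes n :: nat and g :: "nat \<Rightarrow> pt set" and br :: "pt \<Rightarrow> pt \<Rightarrow> pt"
  assumes graded: "graded_nilpotent_lie_algebra n g br"
begin

lemma bilinear_br: "bilinear br"
  and br_in_Rn: "u \<in> Rn n \<Longrightarrow> v \<in> Rn n \<Longrightarrow> br u v \<in> Rn n"
  and br_self: "u \<in> Rn n \<Longrightarrow> br u u = 0"
  and g0: "g 0 = {0}"
  and subspace_g: "subspace (g i)"
  and g_subset: "g i \<subseteq> Rn n"
  and br_degree: "u \<in> g i \<Longrightarrow> v \<in> g j \<Longrightarrow> br u v \<in> g (i + j)"
  using graded by (auto simp: graded_nilpotent_lie_algebra_def lie_algebra_def)

lemma br_antisym:
  assumes "u \<in> Rn n" "v \<in> Rn n"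
  shows "br v u = - br u v"
proof -
  have "br (u + v) (u + v) = 0"
    by (rule br_self) (rule subspace_add[OF subspace_Rn assms])
  then have "br u v + br v u = 0"
    using br_self[OF assms(1)] br_self[OF assms(2)]
    by (simp add: bilinear_ladd[OF bilinear_br] bilinear_radd[OF bilinear_br] add.commute)
  then show ?thesis by (simp add: eq_neg_iff_add_eq_0 add.commute)
qed

lemma unique_decomposition: "\<exists>!c. decomposition n g v c"
proof -
  have "\<forall>v\<in>Rn n. \<exists>!c. (\<forall>i. c i \<in> g i) \<and> finite {i. c i \<noteq> 0} \<and> v = (\<Sum>i\<in>{i. c i \<noteq> 0}. c i)"
    using graded unfolding graded_nilpotent_lie_algebra_def by (elim conjE)
  then show ?thesis unfolding decomposition_def using truncation_in_Rn by (rule bspec)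
qed

lemma component_spec:
  "component n g i v \<in> g i" "finite {i. component n g i v \<noteq> 0}"
  "truncation n v = (\<Sum>i\<in>{i. component n g i v \<noteq> 0}. component n g i v)"
proof -
  have "decomposition n g v (\<lambda>i. component n g i v)"
    unfolding component_def by (rule theI'[OF unique_decomposition])
  then show "component n g i v \<in> g i" "finite {i. component n g i v \<noteq> 0}"
    "truncation n v = (\<Sum>i\<in>{i. component n g i v \<noteq> 0}. component n g i v)"
    by (auto simp: decomposition_def)
qed

lemma component_unique:
  assumes "\<And>i. c i \<in> g i" "finite T" "\<And>i. i \<notin> T \<Longrightarrow> c i = 0" "truncation n v = (\<Sum>i\<in>T. c i)"
  shows "component n g i v = c i"
proof -
  have sub: "{i. c i \<noteq> 0} \<subseteq> T" using assms(3) by auto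
  then have "(\<Sum>i\<in>{i. c i \<noteq> 0}. c i) = (\<Sum>i\<in>T. c i)"
    by (intro sum.mono_neutral_left assms(2)) auto
  then have "decomposition n g v c"
    using assms(1,2,4) finite_subset[OF sub] by (auto simp: decomposition_def)
  from the1_equality[where P = "decomposition n g v" and a = c, OF unique_decomposition this] show ?thesis by (simp add: component_def)
qed

lemma component_bound:
  obtains N where "\<And>i. i > N \<Longrightarrow> component n g i v = 0"
    "\<And>N'. N' \<ge> N \<Longrightarrow> truncation n v = (\<Sum>i\<le>N'. component n g i v)"
proof -
  obtain N where N: "\<forall>i\<in>{i. component n g i v \<noteq> 0}. i \<le> N"
    using component_spec(2)[of v] by (meson finite_nat_set_iff_bounded_le)
  show thesis
  proof (rule that)
    show "component n g i v = 0" if "i > N" for i using N that by force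
    show "truncation n v = (\<Sum>i\<le>N'. component n g i v)" if "N' \<ge> N" for N'
      unfolding component_spec(3)[of v] using N that by (intro sum.mono_neutral_left) force+
  qed
qed

lemma linear_component: "linear (component n g i)"
proof (rule linearI)
  fix v w
  obtain N where N: "\<And>i. i > N \<Longrightarrow> component n g i v = 0"
    "\<And>N'. N' \<ge> N \<Longrightarrow> truncation n v = (\<Sum>i\<le>N'. component n g i v)" using component_bound[of v] by blast
  obtain N2 where N2: "\<And>i. i > N2 \<Longrightarrow> component n g i w = 0"
    "\<And>N'. N' \<ge> N2 \<Longrightarrow> truncation n w = (\<Sum>i\<le>N'. component n g i w)" using component_bound[of w] by blast
  show "component n g i (v + w) = component n g i v + component n g i w"
  proof (rule component_unique[where T = "{..max N N2}"])
    have "truncation n (v + w) = truncation n v + truncation n w" by (auto simp: truncation_def fun_eq_iff)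
    then show "truncation n (v + w) = (\<Sum>i\<le>max N N2. component n g i v + component n g i w)"
      using N(2)[of "max N N2"] N2(2)[of "max N N2"] by (simp add: sum.distrib)
    show "component n g i v + component n g i w \<in> g i" for i
      by (intro subspace_add subspace_g component_spec(1))
  qed (use N(1) N2(1) in auto)
next
  fix r :: real and v
  obtain N where N: "\<And>i. i > N \<Longrightarrow> component n g i v = 0"
    "\<And>N'. N' \<ge> N \<Longrightarrow> truncation n v = (\<Sum>i\<le>N'. component n g i v)" using component_bound[of v] by blast
  show "component n g i (r *\<^sub>R v) = r *\<^sub>R component n g i v"
  proof (rule component_unique[where T = "{..N}"])
    have "truncation n (r *\<^sub>R v) = r *\<^sub>R truncation n v" by (auto simp: truncation_def scaleR_fun_def fun_eq_iff)
    then show "truncation n (r *\<^sub>R v) = (\<Sum>i\<le>N. r *\<^sub>R component n g i v)"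
      using N(2)[of N] by (simp add: scaleR_sum_right)
    show "r *\<^sub>R component n g i v \<in> g i" for i
      by (intro subspace_scale subspace_g component_spec(1))
  qed (use N(1) in auto)
qed

lemma component_homogeneous:
  assumes "u \<in> g i"
  shows "component n g k u = (if k = i then u else 0)"
proof (rule component_unique[where T = "{i}"])
  show "truncation n u = (\<Sum>k\<in>{i}. if k = i then u else 0)"
    using assms g_subset truncation_Rn by auto
  show "(if k = i then u else 0) \<in> g k" for k
  proof (cases "k = i")
    case False
    then show ?thesis using subspace_0[OF subspace_g] by (simp only: if_False)
  qed (use assms in simp)
qed auto

lemma component_bracket:
  assumes "u \<in> Rn n" "v \<in> Rn n"
  shows "component n g k (br u v) = (\<Sum>i\<le>k. br (component n g i u) (component n g (k - i) v))"
proof -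
  let ?a = "\<lambda>i. component n g i u" and ?b = "\<lambda>i. component n g i v"
  obtain N1 where N1: "\<And>i. i > N1 \<Longrightarrow> ?a i = 0" "\<And>N'. N' \<ge> N1 \<Longrightarrow> truncation n u = (\<Sum>i\<le>N'. ?a i)"
    using component_bound[of u] by blast
  obtain N2 where N2: "\<And>i. i > N2 \<Longrightarrow> ?b i = 0" "\<And>N'. N' \<ge> N2 \<Longrightarrow> truncation n v = (\<Sum>i\<le>N'. ?b i)"
    using component_bound[of v] by blast
  define N where "N = max N1 N2"
  have zero: "br (?a i) (?b j) = 0" if "i > N \<or> j > N" for i j
    using that N1(1)[of i] N2(1)[of j]
    by (auto simp: N_def bilinear_lzero[OF bilinear_br] bilinear_rzero[OF bilinear_br])
  show ?thesis
  proof (rule component_unique[where T = "{..N + N}"])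
    show "(\<Sum>i\<le>k. br (?a i) (?b (k - i))) \<in> g k" for k
    proof (rule subspace_sum[OF subspace_g])
      fix i assume "i \<in> {..k}"
      then show "br (?a i) (?b (k - i)) \<in> g k"
        using br_degree[OF component_spec(1)[of i u] component_spec(1)[of "k - i" v]] by simp
    qed
    show "(\<Sum>i\<le>k. br (?a i) (?b (k - i))) = 0" if "k \<notin> {..N + N}" for k
      using that by (intro sum.neutral ballI zero) auto
    have "u = (\<Sum>i\<le>N. ?a i)" "v = (\<Sum>i\<le>N. ?b i)"
      using N1(2)[of N] N2(2)[of N] truncation_Rn assms by (auto simp: N_def)
    then have "br u v = (\<Sum>(i, j)\<in>{..N} \<times> {..N}. br (?a i) (?b j))"
      using bilinear_sum[OF bilinear_br, of ?a "{..N}" ?b "{..N}"] by simp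
    also have "\<dots> = (\<Sum>(i, j)\<in>{(i, j). i + j \<le> N + N}. br (?a i) (?b j))"
    proof (rule sum.mono_neutral_left)
      show "finite {(i, j). i + j \<le> N + N}"
        by (rule finite_subset[of _ "{..N + N} \<times> {..N + N}"]) auto
    qed (auto intro!: zero)
    also have "\<dots> = (\<Sum>k\<le>N + N. \<Sum>i\<le>k. br (?a i) (?b (k - i)))"
      by (rule sum.triangle_reindex_eq)
    finally show "truncation n (br u v) = (\<Sum>k\<le>N + N. \<Sum>i\<le>k. br (?a i) (?b (k - i)))"
      using truncation_Rn[OF br_in_Rn[OF assms]] by simp
  qed simp
qed

lemma component_bracket_low:
  assumes "u \<in> Rn n" "v \<in> Rn n"
  shows "component n g 1 (br u v) = 0"
    "component n g 2 (br u v) = br (component n g 1 u) (component n g 1 v)"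
    "component n g 3 (br u v) = br (component n g 1 u) (component n g 2 v) + br (component n g 2 u) (component n g 1 v)"
proof -
  have z: "component n g 0 w = 0" for w
    using component_spec(1)[of 0 w] g0 by simp
  show "component n g 1 (br u v) = 0"
    "component n g 2 (br u v) = br (component n g 1 u) (component n g 1 v)"
    "component n g 3 (br u v) = br (component n g 1 u) (component n g 2 v) + br (component n g 2 u) (component n g 1 v)"
    unfolding component_bracket[OF assms]
    by (simp_all add: numeral_eq_Suc z bilinear_lzero[OF bilinear_br] bilinear_rzero[OF bilinear_br])
qed

text \<open>If the components of degrees \<open>-1\<close>, \<open>-2\<close>, \<open>-3\<close> have the bases that the growth \<open>(2, 1, 2)\<close> dictates,
  then dividing by the ideal of the lower degrees gives the algebra of the Hilbert--Cartan frame.\<close>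

lemma hilbert_cartan_quotient:
  fixes E :: "nat \<Rightarrow> pt"
  assumes E01: "E 0 \<in> g 1" "E 1 \<in> g 1" and E: "E 2 = br (E 1) (E 0)" "E 3 = br (E 1) (E 2)" "E 4 = br (E 0) (E 2)"
    and indep: "independent (E ` {..<5})" "inj_on E {..<5}"
    and gen: "\<And>v. v \<in> Rn n \<Longrightarrow> component n g 1 v \<in> span {E 0, E 1}"
      "\<And>v. v \<in> Rn n \<Longrightarrow> component n g 2 v \<in> span {E 2}"
      "\<And>v. v \<in> Rn n \<Longrightarrow> component n g 3 v \<in> span {E 3, E 4}"
  obtains \<mu> where "linear \<mu>" "\<And>u v. u \<in> Rn n \<Longrightarrow> v \<in> Rn n \<Longrightarrow> \<mu> (br u v) = hc_bracket (\<mu> u) (\<mu> v)"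
    "\<And>k. k < 5 \<Longrightarrow> \<mu> (E k) = unitv k"
proof -
  from linear_independent_extend[OF indep(1), of "\<lambda>v. unitv (inv_into {..<5} E v)"]
  obtain \<rho> where "linear \<rho> \<and> (\<forall>v\<in>E ` {..<5}. \<rho> v = unitv (inv_into {..<5} E v))" ..
  then have lin: "linear \<rho>" and \<rho>: "\<And>k. k < 5 \<Longrightarrow> \<rho> (E k) = unitv k"
    using indep(2) by auto
  define \<mu> where "\<mu> v = \<rho> (component n g 1 v + component n g 2 v + component n g 3 v)" for v
  have "linear \<mu>"
    unfolding \<mu>_def
    by (rule linearI) (simp_all add: linear_add[OF lin] linear_scale[OF lin] linear_add[OF linear_component]
        linear_scale[OF linear_component] algebra_simps)
  have E2: "E 2 \<in> g 2" using br_degree[OF E01(2,1)] E(1) by (simp add: numeral_eq_Suc)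
  have E34: "E 3 \<in> g 3" "E 4 \<in> g 3"
    using br_degree[OF E01(2) E2] br_degree[OF E01(1) E2] E(2,3) by (simp_all add: numeral_eq_Suc)
  have R: "E 0 \<in> Rn n" "E 1 \<in> Rn n" "E 2 \<in> Rn n"
    using E01 E2 g_subset by blast+
  have coeffs: "\<exists>a. component n g 1 v = a 0 *\<^sub>R E 0 + a 1 *\<^sub>R E 1 \<and> component n g 2 v = a 2 *\<^sub>R E 2 \<and>
      component n g 3 v = a 3 *\<^sub>R E 3 + a 4 *\<^sub>R E 4 \<and> a \<in> Rn 5 \<and> \<mu> v = a" if v: "v \<in> Rn n" for v
  proof -
    obtain a0 a1 where a01: "component n g 1 v = a0 *\<^sub>R E 0 + a1 *\<^sub>R E 1"
      using span_pair[OF gen(1)[OF v]] by blast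
    obtain a2 where a2: "component n g 2 v = a2 *\<^sub>R E 2"
      using gen(2)[OF v] by (auto simp: span_singleton)
    obtain a3 a4 where a34: "component n g 3 v = a3 *\<^sub>R E 3 + a4 *\<^sub>R E 4"
      using span_pair[OF gen(3)[OF v]] by blast
    define a :: pt where "a = (\<lambda>_. 0)(0 := a0, 1 := a1, 2 := a2, 3 := a3, 4 := a4)"
    have "\<mu> v = a0 *\<^sub>R unitv 0 + a1 *\<^sub>R unitv 1 + a2 *\<^sub>R unitv 2 + (a3 *\<^sub>R unitv 3 + a4 *\<^sub>R unitv 4)"
      unfolding \<mu>_def a01 a2 a34 by (simp add: linear_add[OF lin] linear_scale[OF lin] \<rho>)
    also have "\<dots> = a"
      by (rule Rn5_eqI) (simp_all add: a_def unitv_def scaleR_fun_def Rn_iff)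
    finally have "\<mu> v = a" .
    then show ?thesis
      using a01 a2 a34 by (intro exI[of _ a]) (simp add: a_def Rn_iff)
  qed
  have "\<mu> (br u v) = hc_bracket (\<mu> u) (\<mu> v)" if uv: "u \<in> Rn n" "v \<in> Rn n" for u v
  proof -
    obtain a where a: "component n g 1 u = a 0 *\<^sub>R E 0 + a 1 *\<^sub>R E 1" "component n g 2 u = a 2 *\<^sub>R E 2" "\<mu> u = a"
      using coeffs[OF uv(1)] by blast
    obtain b where b: "component n g 1 v = b 0 *\<^sub>R E 0 + b 1 *\<^sub>R E 1" "component n g 2 v = b 2 *\<^sub>R E 2" "\<mu> v = b"
      using coeffs[OF uv(2)] by blast
    note bil = bilinear_ladd[OF bilinear_br] bilinear_radd[OF bilinear_br]
      bilinear_lmul[OF bilinear_br] bilinear_rmul[OF bilinear_br]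
    have anti: "br (E 0) (E 1) = - E 2" "br (E 2) (E 1) = - E 3" "br (E 2) (E 0) = - E 4"
      "br (E 0) (E 0) = 0" "br (E 1) (E 1) = 0"
      using br_antisym[OF R(2,1)] br_antisym[OF R(2,3)] br_antisym[OF R(1,3)] E br_self R by auto
    have "component n g 2 (br u v) = (a 1 * b 0 - a 0 * b 1) *\<^sub>R E 2"
      unfolding component_bracket_low[OF uv] a b
      by (simp add: bil anti E(1)[symmetric] algebra_simps del: One_nat_def)
    moreover have "component n g 3 (br u v) = (a 1 * b 2 - a 2 * b 1) *\<^sub>R E 3 + (a 0 * b 2 - a 2 * b 0) *\<^sub>R E 4"
      unfolding component_bracket_low[OF uv] a b
      by (simp add: bil anti E(2,3)[symmetric] algebra_simps del: One_nat_def)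
    ultimately have "\<mu> (br u v) = (a 1 * b 0 - a 0 * b 1) *\<^sub>R unitv 2 +
        ((a 1 * b 2 - a 2 * b 1) *\<^sub>R unitv 3 + (a 0 * b 2 - a 2 * b 0) *\<^sub>R unitv 4)"
      unfolding \<mu>_def component_bracket_low(1)[OF uv] by (simp add: linear_add[OF lin] linear_scale[OF lin] \<rho>)
    also have "\<dots> = hc_bracket a b"
      by (rule Rn5_eqI) (simp_all add: hc_bracket_def unitv_def scaleR_fun_def Rn_iff)
    finally show ?thesis using a b by simp
  qed
  moreover have "\<mu> (E k) = unitv k" if k: "k < 5" for k :: nat
  proof -
    consider "k = 0" | "k = 1" | "k = 2" | "k = 3" | "k = 4" using k by linarith
    then show ?thesis
      unfolding \<mu>_def using E01 E2 E34 \<rho>[OF k] by cases (simp_all add: component_homogeneous)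
  qed
  ultimately show thesis using \<open>linear \<mu>\<close> that by blast
qed

end

section \<open>Extensions of the Hilbert--Cartan distribution\<close>

subsection \<open>Restriction to open subsets\<close>

lemma smooth_sections_subset:
  assumes "X \<in> sections n W E" "open_Rn n W" "open_Rn n V" "V \<subseteq> W"
    and "\<And>y. y \<in> V \<Longrightarrow> E y = E' y"
  shows "X \<in> sections n V E'"
  using assms smooth_map_subset[OF _ assms(2-4)] unfolding sections_def by blast

lemma weak_flag_open_subset:
  assumes U: "open_Rn n U" "U \<subseteq> M" and y: "y \<in> U"
  shows "weak_flag n U D i y = weak_flag n M D i y"
  using y
proof (induction i arbitrary: y)
  case (Suc i)
  show ?case
  proof (cases i)
    case i: (Suc j)
    have IH: "weak_flag n U D (Suc j) y = weak_flag n M D (Suc j) y" if "y \<in> U" for y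
      using Suc.IH[OF that] i by simp
    have "{lie_bracket n X Y y | X Y W. open_Rn n W \<and> y \<in> W \<and> W \<subseteq> U \<and>
        X \<in> sections n W D \<and> Y \<in> sections n W (weak_flag n U D (Suc j))} =
      {lie_bracket n X Y y | X Y W. open_Rn n W \<and> y \<in> W \<and> W \<subseteq> M \<and>
        X \<in> sections n W D \<and> Y \<in> sections n W (weak_flag n M D (Suc j))}" (is "?A = ?B")
    proof
      show "?A \<subseteq> ?B"
      proof clarify
        fix X Y W assume W: "open_Rn n W" "y \<in> W" "W \<subseteq> U"
          "X \<in> sections n W D" "Y \<in> sections n W (weak_flag n U D (Suc j))"
        have "Y \<in> sections n W (weak_flag n M D (Suc j))"
          by (rule smooth_sections_subset[OF W(5,1,1) order_refl]) (use IH W(3) in blast)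
        then show "\<exists>X' Y' W. lie_bracket n X Y y = lie_bracket n X' Y' y \<and> open_Rn n W \<and>
          y \<in> W \<and> W \<subseteq> M \<and> X' \<in> sections n W D \<and> Y' \<in> sections n W (weak_flag n M D (Suc j))"
          using W U(2) by blast
      qed
      show "?B \<subseteq> ?A"
      proof clarify
        fix X Y W assume W: "open_Rn n W" "y \<in> W" "W \<subseteq> M"
          "X \<in> sections n W D" "Y \<in> sections n W (weak_flag n M D (Suc j))"
        have WU: "open_Rn n (W \<inter> U)" using W(1) U(1) by (rule openin_Int)
        have "Y \<in> sections n (W \<inter> U) (weak_flag n U D (Suc j))"
          by (rule smooth_sections_subset[OF W(5,1) WU]) (use IH in auto)
        moreover have "X \<in> sections n (W \<inter> U) D"
          by (rule smooth_sections_subset[OF W(4,1) WU]) auto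
        moreover have "y \<in> W \<inter> U" "W \<inter> U \<subseteq> U" using W(2) Suc.prems by auto
        ultimately show "\<exists>X' Y' W. lie_bracket n X Y y = lie_bracket n X' Y' y \<and> open_Rn n W \<and>
          y \<in> W \<and> W \<subseteq> U \<and> X' \<in> sections n W D \<and> Y' \<in> sections n W (weak_flag n U D (Suc j))"
          using WU by blast
      qed
    qed
    then show ?thesis unfolding i by (simp only: weak_flag.simps)
  qed simp
qed simp

lemma nonholonomic_open_subset:
  assumes nh: "nonholonomic_distribution n M k D" and U: "open_Rn n U" "U \<subseteq> M"
  shows "nonholonomic_distribution n U k D"
  unfolding nonholonomic_distribution_def
proof (intro conjI)
  show "\<forall>i. \<exists>r. \<forall>x\<in>U. dim (weak_flag n U D i x) = r"
    using nh U(2) weak_flag_open_subset[OF U] unfolding nonholonomic_distribution_def by (metis subsetD)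
  show "\<exists>s. \<forall>x\<in>U. weak_flag n U D s x = Rn n"
    using nh U(2) weak_flag_open_subset[OF U] unfolding nonholonomic_distribution_def by (metis subsetD)
  show "distribution n U k D"
    unfolding distribution_def
  proof (intro conjI ballI U(1))
    fix x assume x: "x \<in> U"
    then have "x \<in> M" using U(2) by blast
    then obtain W X where W: "open_Rn n W" "x \<in> W" "W \<subseteq> M" "\<forall>i<k. vector_field n W (X i)"
        "\<forall>y\<in>W. D y = span ((\<lambda>i. X i y) ` {..<k}) \<and> dim (D y) = k"
      using nh unfolding nonholonomic_distribution_def distribution_def by blast
    have WU: "open_Rn n (W \<inter> U)" using W(1) U(1) by (rule openin_Int)
    have "\<forall>i<k. vector_field n (W \<inter> U) (X i)"
      using W(4) smooth_map_subset[OF _ W(1) WU] by auto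
    then show "\<exists>W X. open_Rn n W \<and> x \<in> W \<and> W \<subseteq> U \<and> (\<forall>i<k. vector_field n W (X i)) \<and>
        (\<forall>y\<in>W. D y = span ((\<lambda>i. X i y) ` {..<k}) \<and> dim (D y) = k)"
    proof (intro exI conjI)
      show "\<forall>y\<in>W \<inter> U. D y = span ((\<lambda>i. X i y) ` {..<k}) \<and> dim (D y) = k" using W(5) by blast
    qed (use WU W(2) x in auto)
  qed
qed

lemma distribution_in_Rn:
  assumes "distribution n M k D" "y \<in> M"
  shows "D y \<subseteq> Rn n"
proof -
  obtain W X where "open_Rn n W" "y \<in> W" "W \<subseteq> M" "\<forall>i<k. vector_field n W (X i)"
      "\<forall>y\<in>W. D y = span ((\<lambda>i. X i y) ` {..<k}) \<and> dim (D y) = k"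
    using assms unfolding distribution_def by blast
  then have W: "y \<in> W" "\<forall>i<k. vector_field n W (X i)" "D y = span ((\<lambda>i. X i y) ` {..<k})" by auto
  show ?thesis
    unfolding W(3)
  proof (rule span_minimal[OF _ subspace_Rn])
    show "(\<lambda>i. X i y) ` {..<k} \<subseteq> Rn n"
      using W(2) smooth_map_in_Rn[OF _ W(1)] by auto
  qed
qed

lemma locally_equivalent_open_subset:
  assumes D: "distribution n M k D" and U: "open_Rn n U" "U \<subseteq> M" "x \<in> U"
  shows "locally_equivalent_at x n M D n U D"
  unfolding locally_equivalent_at_def
proof (intro exI conjI ballI)
  have inv: "inv_into U (\<lambda>x. x) y = y" if "y \<in> U" for y
    using that by (simp add: inv_into_def) (metis (mono_tags) someI_ex)
  have "smooth_map n U n (inv_into U (\<lambda>x. x))"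
    unfolding smooth_map_def
  proof (intro conjI allI impI)
    show "inv_into U (\<lambda>x. x) ` U \<subseteq> Rn n" using inv openin_in_Rn[OF U(1)] by auto
    show "smooth_fun n U (\<lambda>x. inv_into U (\<lambda>x. x) x k)" for k
      by (rule smooth_fun_cong[OF U(1) smooth_fun_coordinate[OF U(1)]]) (simp add: inv)
  qed
  then show "diffeomorphism n U n U (\<lambda>x. x)"
    using smooth_map_id[OF U(1)] by (auto simp: diffeomorphism_def bij_betw_def)
  show "differential n (\<lambda>x. x) y ` D y = D y" if "y \<in> U" for y
  proof -
    have "D y \<subseteq> Rn n" using distribution_in_Rn[OF D] that U(2) by blast
    then have "differential n (\<lambda>x. x) y v = v" if "v \<in> D y" for v
      using that by (intro differential_id) blast
    then show ?thesis by simp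
  qed
qed (use U in auto)

subsection \<open>A homomorphism of frames onto the Hilbert--Cartan frame is an integrable extension\<close>

lemma integrable_extension_hilbert_cartan:
  fixes s :: "nat \<Rightarrow> pt"
  assumes frame: "lie_frame n U F \<Theta> B" and nh: "nonholonomic_distribution n U 2 D"
    and D: "\<And>y. y \<in> U \<Longrightarrow> D y = (\<lambda>u. F u y) ` span {s 0, s 1}"
    and D2: "\<And>y. y \<in> U \<Longrightarrow> weak_flag n U D 2 y \<subseteq> (\<lambda>u. F u y) ` span {s 0, s 1, s 2}"
    and s: "\<And>k. k < 5 \<Longrightarrow> s k \<in> Rn n"
    and \<Lambda>: "linear \<Lambda>" "\<And>k. k < 5 \<Longrightarrow> \<Lambda> (s k) = unitv k"
    and \<pi>: "smooth_map n U 5 \<pi>"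
    and rel: "\<And>u y. u \<in> Rn n \<Longrightarrow> y \<in> U \<Longrightarrow> differential n \<pi> y (F u y) = hc_field (\<Lambda> u) (\<pi> y)"
  shows "integrable_extension n U D 5 (Rn 5) hilbert_cartan \<pi>"
proof -
  interpret lie_frame n U F \<Theta> B by (rule frame)
  have span_sub: "span {s 0, s 1} \<subseteq> span {s 0, s 1, s 2}" "span {s 0, s 1, s 2} \<subseteq> Rn n"
    by (rule span_mono, blast, rule span_minimal[OF _ subspace_Rn]) (use s in auto)
  have \<Lambda>3: "\<exists>a b c. u = a *\<^sub>R s 0 + b *\<^sub>R s 1 + c *\<^sub>R s 2 \<and> \<Lambda> u = a *\<^sub>R unitv 0 + b *\<^sub>R unitv 1 + c *\<^sub>R unitv 2"
    if "u \<in> span {s 0, s 1, s 2}" for u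
  proof -
    from span_triple[OF that] obtain a b c where u: "u = a *\<^sub>R s 0 + b *\<^sub>R s 1 + c *\<^sub>R s 2" by blast
    have "\<Lambda> u = a *\<^sub>R unitv 0 + b *\<^sub>R unitv 1 + c *\<^sub>R unitv 2"
      unfolding u by (simp add: linear_add[OF \<Lambda>(1)] linear_scale[OF \<Lambda>(1)] \<Lambda>(2) del: One_nat_def)
    with u show ?thesis by blast
  qed
  have \<Lambda>_zero: "u = 0" if u: "u \<in> span {s 0, s 1, s 2}" and z: "hc_field (\<Lambda> u) p = 0" for u p
  proof -
    obtain a b c where abc: "u = a *\<^sub>R s 0 + b *\<^sub>R s 1 + c *\<^sub>R s 2"
      "\<Lambda> u = a *\<^sub>R unitv 0 + b *\<^sub>R unitv 1 + c *\<^sub>R unitv 2" using \<Lambda>3[OF u] by blast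
    have "\<Lambda> u \<in> Rn 5" unfolding abc(2) by (simp add: Rn_iff scaleR_fun_def unitv_def)
    then have "\<Lambda> u = 0"
      using hc_coeff_field[of "\<Lambda> u" p] z linear_0[OF linear_hc_coeff, of p] by simp
    then have "\<Lambda> u 0 = 0" "\<Lambda> u 1 = 0" "\<Lambda> u 2 = 0" by simp_all
    then have "a = 0" "b = 0" "c = 0" unfolding abc(2) by (simp_all add: scaleR_fun_def unitv_def)
    then show ?thesis using abc(1) by simp
  qed
  have bij: "bij_betw (differential n \<pi> y) (D y) (hilbert_cartan (\<pi> y))" if y: "y \<in> U" for y
    unfolding bij_betw_def
  proof
    show "inj_on (differential n \<pi> y) (D y)"
    proof (rule inj_onI)
      fix v w assume "v \<in> D y" "w \<in> D y" and eq: "differential n \<pi> y v = differential n \<pi> y w"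
      then obtain a b where ab: "a \<in> span {s 0, s 1}" "b \<in> span {s 0, s 1}" "v = F a y" "w = F b y"
        using D[OF y] by blast
      then have R: "a \<in> Rn n" "b \<in> Rn n" using span_sub by blast+
      have "hc_field (\<Lambda> a) (\<pi> y) = hc_field (\<Lambda> b) (\<pi> y)"
        using eq rel[OF R(1) y] rel[OF R(2) y] ab(3,4) by simp
      then have "hc_field (\<Lambda> (a - b)) (\<pi> y) = 0"
        by (simp add: linear_diff[OF \<Lambda>(1)] linear_diff[OF linear_hc_field])
      moreover have "a - b \<in> span {s 0, s 1, s 2}" using span_sub ab(1,2) by (blast intro: span_diff)
      ultimately have "a - b = 0" by (rule \<Lambda>_zero[rotated])
      then show "v = w" using ab(3,4) by simp
    qed
    show "differential n \<pi> y ` D y = hilbert_cartan (\<pi> y)"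
    proof
      show "differential n \<pi> y ` D y \<subseteq> hilbert_cartan (\<pi> y)"
      proof clarify
        fix v assume "v \<in> D y"
        then obtain u where u: "u \<in> span {s 0, s 1}" "v = F u y" using D[OF y] by blast
        obtain a b where ab: "u = a *\<^sub>R s 0 + b *\<^sub>R s 1" using span_pair[OF u(1)] by blast
        have "\<Lambda> u = a *\<^sub>R unitv 0 + b *\<^sub>R unitv 1"
          unfolding ab by (simp add: linear_add[OF \<Lambda>(1)] linear_scale[OF \<Lambda>(1)] \<Lambda>(2) del: One_nat_def)
        then have "\<Lambda> u \<in> hc_flag 1" by (simp add: hc_flag_def Rn_iff scaleR_fun_def unitv_def)
        then show "differential n \<pi> y v \<in> hilbert_cartan (\<pi> y)"
          using rel[of u y] u span_sub y unfolding hilbert_cartan_frame by auto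
      qed
      show "hilbert_cartan (\<pi> y) \<subseteq> differential n \<pi> y ` D y"
      proof
        fix w assume "w \<in> hilbert_cartan (\<pi> y)"
        then obtain c where c: "c \<in> hc_flag 1" "w = hc_field c (\<pi> y)"
          unfolding hilbert_cartan_frame by blast
        define u where "u = c 0 *\<^sub>R s 0 + c 1 *\<^sub>R s 1"
        have u: "u \<in> span {s 0, s 1}" unfolding u_def by (intro span_add span_scale span_base) auto
        have "\<Lambda> u = c 0 *\<^sub>R unitv 0 + c 1 *\<^sub>R unitv 1"
          unfolding u_def by (simp add: linear_add[OF \<Lambda>(1)] linear_scale[OF \<Lambda>(1)] \<Lambda>(2) del: One_nat_def)
        also have "\<dots> = c"
          using c(1) by (intro Rn5_eqI) (simp_all add: hc_flag_def Rn_iff scaleR_fun_def unitv_def)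
        finally have "w = differential n \<pi> y (F u y)"
          using rel[of u y] u span_sub y c(2) by auto
        then show "w \<in> differential n \<pi> y ` D y" using D[OF y] u by blast
      qed
    qed
  qed
  have surj: "differential n \<pi> y ` Rn n = Rn 5" if y: "y \<in> U" for y
  proof
    show "differential n \<pi> y ` Rn n \<subseteq> Rn 5" using differential_in_Rn[OF open_U \<pi> y] by blast
    show "Rn 5 \<subseteq> differential n \<pi> y ` Rn n"
    proof
      fix w assume w: "w \<in> Rn 5"
      define c where "c = hc_coeff (\<pi> y) w"
      have c: "c \<in> Rn 5" "hc_field c (\<pi> y) = w"
        unfolding c_def using hc_in_Rn(2) hc_field_coeff[OF w] by auto
      define u where "u = (\<Sum>k<5. c k *\<^sub>R s k)"
      have u: "u \<in> Rn n"
        unfolding u_def by (intro subspace_sum[OF subspace_Rn] subspace_scale[OF subspace_Rn] s) simp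
      have "\<Lambda> u = (\<Sum>k<5. c k *\<^sub>R unitv k)"
        unfolding u_def by (simp add: linear_sum[OF \<Lambda>(1)] linear_scale[OF \<Lambda>(1)] \<Lambda>(2))
      then have "\<Lambda> u = c" using unitv_expansion[OF c(1)] by simp
      then have "differential n \<pi> y (F u y) = w" using rel[OF u y] c(2) by simp
      then show "w \<in> differential n \<pi> y ` Rn n" using F_in_Rn[OF u y] by blast
    qed
  qed
  have vertical: "weak_flag n U D 2 y \<inter> {v \<in> Rn n. differential n \<pi> y v = 0} = {0}" if y: "y \<in> U" for y
  proof
    show "weak_flag n U D 2 y \<inter> {v \<in> Rn n. differential n \<pi> y v = 0} \<subseteq> {0}"
    proof clarify
      fix v assume v: "v \<in> weak_flag n U D 2 y" "differential n \<pi> y v = 0"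
      then obtain u where u: "u \<in> span {s 0, s 1, s 2}" "v = F u y" using D2[OF y] by blast
      then have "hc_field (\<Lambda> u) (\<pi> y) = 0" using rel[of u y] span_sub y v(2) by auto
      then have "u = 0" by (rule \<Lambda>_zero[OF u(1)])
      then show "v = 0" using u(2) linear_0[OF linear_F[OF y]] by simp
    qed
    have "0 \<in> weak_flag n U D 2 y" by (simp add: numeral_2_eq_2 span_zero)
    then show "{0} \<subseteq> weak_flag n U D 2 y \<inter> {v \<in> Rn n. differential n \<pi> y v = 0}"
      using linear_0[OF linear_differential] subspace_0[OF subspace_Rn] by blast
  qed
  have "\<pi> ` U \<subseteq> Rn 5" using \<pi> by (simp add: smooth_map_def)
  then show ?thesis
    unfolding integrable_extension_def
    using nh hilbert_cartan_nonholonomic \<pi> surj bij vertical by blast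
qed

section \<open>Flat distributions\<close>

text \<open>The left-invariant frame, pulled back by a local equivalence \<open>\<phi>\<close>.\<close>

lemma flat_frame:
  assumes G: "lie_group n G"
    and eq: "locally_equivalent_at x n M D n (carrier G) (left_invariant_distribution n G S)"
    and S: "S \<subseteq> Rn n" and D: "\<And>y. y \<in> M \<Longrightarrow> D y \<subseteq> Rn n"
  obtains U F \<Theta> \<phi> where "lie_frame n U F \<Theta> (group_bracket n G)" "x \<in> U" "U \<subseteq> M"
    "\<And>y. y \<in> U \<Longrightarrow> D y = (\<lambda>u. F u y) ` S" "smooth_map n U n \<phi>"
    "\<And>u y. u \<in> Rn n \<Longrightarrow> y \<in> U \<Longrightarrow> differential n \<phi> y (F u y) = left_invariant_field n G u (\<phi> y)"
proof -
  obtain U V \<phi> where U: "open_Rn n U" "x \<in> U" "U \<subseteq> M"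
    and V: "open_Rn n V" "V \<subseteq> Rn n" and \<phi>: "diffeomorphism n U n V \<phi>"
    and D\<phi>: "\<And>y. y \<in> U \<Longrightarrow> differential n \<phi> y ` D y = left_invariant_distribution n G S (\<phi> y)"
    using eq carrier_G[OF G] unfolding locally_equivalent_at_def by auto
  note frame = lie_frame.restrict[OF left_invariant_frame[OF G] V]
  note inv = diffeomorphism_inverse[OF \<phi> U(1) V(1)]
  let ?F = "\<lambda>u y. differential n (inv_into U \<phi>) (\<phi> y) (left_invariant_field n G u (\<phi> y))"
  have rel: "differential n \<phi> y (?F u y) = left_invariant_field n G u (\<phi> y)" if "u \<in> Rn n" "y \<in> U" for u y
    using inv(4)[OF that(2) lie_frame.F_in_Rn[OF frame that(1) inv(1)[OF that(2)]]] .
  have "D y = (\<lambda>u. ?F u y) ` S" if y: "y \<in> U" for y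
  proof -
    have "D y = (\<lambda>v. differential n (inv_into U \<phi>) (\<phi> y) (differential n \<phi> y v)) ` D y"
    proof -
      have "D y \<subseteq> Rn n" using D U(3) y by blast
      then have "differential n (inv_into U \<phi>) (\<phi> y) (differential n \<phi> y v) = v" if "v \<in> D y" for v
        using inv(3)[OF y] that by blast
      then show ?thesis by simp
    qed
    also have "\<dots> = differential n (inv_into U \<phi>) (\<phi> y) ` (differential n \<phi> y ` D y)"
      by (simp add: image_image)
    finally show ?thesis
      unfolding D\<phi>[OF y] left_invariant_distribution_def by (simp add: image_image)
  qed
  moreover have "smooth_map n U n \<phi>" using \<phi> by (simp add: diffeomorphism_def)
  ultimately show thesis
    using that[OF lie_frame.pullback[OF frame \<phi> U(1)] U(2,3) _ _ rel] by blast
qed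

text \<open>A family of \<open>m\<close> vectors is independent if a linear image of its span covers a space of dimension
  at least \<open>m\<close>.\<close>

lemma independent_of_dim:
  fixes s :: "nat \<Rightarrow> 'a::real_vector" and f :: "'a \<Rightarrow> 'b::real_vector"
  assumes f: "linear f" and V: "V \<subseteq> f ` span (s ` {..<m})" and dim: "m \<le> dim V"
  shows "independent (s ` {..<m})" "inj_on s {..<m}"
proof -
  obtain T where T: "T \<subseteq> s ` {..<m}" "independent T" "s ` {..<m} \<subseteq> span T" "card T = dim (s ` {..<m})"
    by (rule basis_exists)
  have fin: "finite T" by (rule finite_subset[OF T(1)]) simp
  have "span (s ` {..<m}) \<subseteq> span T" by (rule span_minimal[OF T(3) subspace_span])
  then have "V \<subseteq> f ` span T" using V by blast
  then have "V \<subseteq> span (f ` T)" by (simp add: linear_span_image[OF f])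
  then have "dim V \<le> card (f ` T)" using fin by (intro dim_le_card) auto
  also have "\<dots> \<le> card T" by (rule card_image_le[OF fin])
  finally have m: "m \<le> card T" using dim by simp
  have "card T \<le> card (s ` {..<m})" by (rule card_mono[OF _ T(1)]) simp
  moreover have le: "card (s ` {..<m}) \<le> m" using card_image_le[of "{..<m}" s] by simp
  ultimately have card: "card T = card (s ` {..<m})" "card (s ` {..<m}) = m" using m by simp_all
  have "T = s ` {..<m}" by (rule card_subset_eq[OF _ T(1) card(1)]) simp
  then show "independent (s ` {..<m})" using T(2) by simp
  show "inj_on s {..<m}" by (rule eq_card_imp_inj_on) (simp_all add: card)
qed

theorem theorem3:
  fixes n :: nat and M :: "pt set" and D :: dist
  assumes "nonholonomic_distribution n M 2 D"
    and "\<forall>x\<in>M. growth n M D x 1 = 2 \<and> growth n M D x 2 = 1 \<and> growth n M D x 3 = 2"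
    and "flat n M D"
  shows "\<forall>x\<in>M. \<exists>m N E. successive_extension m N E \<and> locally_equivalent_at x n M D m N E"
proof
  fix x assume x: "x \<in> M"
  have distD: "distribution n M 2 D" using assms(1) by (simp add: nonholonomic_distribution_def)
  obtain g br G \<psi> where graded: "graded_nilpotent_lie_algebra n g br" and G: "lie_group n G"
    and \<psi>: "lie_algebra_isomorphism n G br \<psi>"
    and eq: "\<forall>x\<in>M. locally_equivalent_at x n M D n (carrier G) (left_invariant_distribution n G {u \<in> Rn n. \<psi> u \<in> g 1})"
    using assms(3) unfolding flat_def by blast
  interpret A: graded_algebra n g br by (rule graded_algebra.intro[OF graded])
  define S where "S = {u \<in> Rn n. \<psi> u \<in> g 1}"
  let ?B = "group_bracket n G"
  have lin: "linear \<psi>" and \<psi>bij: "bij_betw \<psi> (Rn n) (Rn n)"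
    and hom: "\<And>u v. u \<in> Rn n \<Longrightarrow> v \<in> Rn n \<Longrightarrow> \<psi> (?B u v) = br (\<psi> u) (\<psi> v)"
    using \<psi> by (auto simp: lie_algebra_isomorphism_def)
  have \<psi>R: "\<psi> u \<in> Rn n" if "u \<in> Rn n" for u using \<psi>bij that by (auto simp: bij_betw_def)
  have inj: "u = v" if "\<psi> u = \<psi> v" "u \<in> Rn n" "v \<in> Rn n" for u v
    using \<psi>bij that by (auto simp: bij_betw_def inj_on_def)
  have SR: "S \<subseteq> Rn n" by (auto simp: S_def)
  have subS: "subspace S"
    using subspace_Rn[of n] A.subspace_g[of 1]
    by (simp add: S_def subspace_def linear_0[OF lin] linear_add[OF lin] linear_scale[OF lin])
  have eq_x: "locally_equivalent_at x n M D n (carrier G) (left_invariant_distribution n G S)"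
    using eq x unfolding S_def by blast
  obtain U F \<Theta> \<phi> where frame: "lie_frame n U F \<Theta> ?B" and xU: "x \<in> U" and UM: "U \<subseteq> M"
    and D_F: "\<And>y. y \<in> U \<Longrightarrow> D y = (\<lambda>u. F u y) ` S" and \<phi>: "smooth_map n U n \<phi>"
    and rel\<phi>: "\<And>u y. u \<in> Rn n \<Longrightarrow> y \<in> U \<Longrightarrow> differential n \<phi> y (F u y) = left_invariant_field n G u (\<phi> y)"
    using flat_frame[where M = M and D = D, OF G eq_x SR distribution_in_Rn[OF distD]] by blast
  interpret Fr: lie_frame n U F \<Theta> ?B by (rule frame)
  have flag: "weak_flag n U D i y = weak_flag n M D i y" if "y \<in> U" for i y
    by (rule weak_flag_open_subset[OF Fr.open_U UM that])

  have "dim (span ({} :: pt set)) = 0"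
    using dim_span_eq_card_independent[OF independent_empty] by (simp only: card.empty)
  then have "dim (weak_flag n M D 0 x) = 0" by (simp only: span_empty weak_flag.simps(1))
  then have dims: "dim (D x) = 2" "dim (weak_flag n U D 2 x) = 3" "dim (weak_flag n U D 3 x) = 5"
    using assms(2)[rule_format, OF x] flag[OF xU] by (auto simp: growth_def)

  have "inj_on (\<lambda>u. F u x) S"
    by (rule inj_on_inverseI[where g = "\<Theta> x"]) (use Fr.\<Theta>_F[OF xU] SR in blast)
  then have "dim S = 2"
    using dims(1) dim_inj_linear_image[OF Fr.linear_F[OF xU] subS] D_F[OF xU] by simp
  then obtain C where C: "C \<subseteq> S" "S \<subseteq> span C" "card C = 2"
    using basis_exists[of S] by metis
  then obtain a b where ab: "C = {a, b}" by (meson card_2_iff)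
  define s :: "nat \<Rightarrow> pt" where "s k = (if k = 0 then a else if k = 1 then b else if k = 2 then ?B b a
    else if k = 3 then ?B b (?B b a) else ?B a (?B b a))" for k
  have abS: "a \<in> S" "b \<in> S" using C(1) ab by auto
  have sR: "s k \<in> Rn n" for k
    using abS SR by (auto simp: s_def intro!: Fr.B_in_Rn)
  have S_span: "S = span {s 0, s 1}"
    using C(2) span_minimal[OF C(1) subS] ab by (simp add: s_def)
  define E where "E k = \<psi> (s k)" for k
  have E: "E 2 = br (E 1) (E 0)" "E 3 = br (E 1) (E 2)" "E 4 = br (E 0) (E 2)"
    using hom[OF sR[of 1] sR[of 0]] hom[OF sR[of 1] sR[of 2]] hom[OF sR[of 0] sR[of 2]]
    by (simp_all add: E_def s_def)
  have ER: "E k \<in> Rn n" for k unfolding E_def by (rule \<psi>R[OF sR])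
  have E01: "E 0 \<in> g 1" "E 1 \<in> g 1" using abS by (auto simp: E_def s_def S_def)
  have g1: "g 1 \<subseteq> span {E 0, E 1}"
  proof
    fix w assume w: "w \<in> g 1"
    then obtain u where u: "u \<in> Rn n" "w = \<psi> u"
      using \<psi>bij A.g_subset[of 1] by (auto simp: bij_betw_def)
    then have "u \<in> span {s 0, s 1}" using w S_span by (auto simp: S_def)
    then have "\<psi> u \<in> span (\<psi> ` {s 0, s 1})" unfolding linear_span_image[OF lin] by blast
    then show "w \<in> span {E 0, E 1}" using u(2) by (simp add: E_def)
  qed
  have br_expand: "br (u0 *\<^sub>R E 0 + u1 *\<^sub>R E 1) (v0 *\<^sub>R E 0 + v1 *\<^sub>R E 1 + v2 *\<^sub>R E 2) =
      (u1 * v0 - u0 * v1) *\<^sub>R E 2 + (u1 * v2) *\<^sub>R E 3 + (u0 * v2) *\<^sub>R E 4" for u0 u1 v0 v1 v2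
  proof -
    have "br (E 0) (E 1) = - E 2" "br (E 0) (E 0) = 0" "br (E 1) (E 1) = 0"
      using A.br_antisym[OF ER[of 1] ER[of 0]] A.br_self[OF ER] E(1) by auto
    then show ?thesis
      by (simp add: bilinear_ladd[OF A.bilinear_br] bilinear_radd[OF A.bilinear_br]
        bilinear_lmul[OF A.bilinear_br] bilinear_rmul[OF A.bilinear_br] E[symmetric] algebra_simps del: One_nat_def)
  qed
  have B_expand: "?B (u0 *\<^sub>R s 0 + u1 *\<^sub>R s 1) (v0 *\<^sub>R s 0 + v1 *\<^sub>R s 1 + v2 *\<^sub>R s 2) =
      (u1 * v0 - u0 * v1) *\<^sub>R s 2 + (u1 * v2) *\<^sub>R s 3 + (u0 * v2) *\<^sub>R s 4" for u0 u1 v0 v1 v2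
  proof -
    define u where "u = u0 *\<^sub>R s 0 + u1 *\<^sub>R s 1"
    define v where "v = v0 *\<^sub>R s 0 + v1 *\<^sub>R s 1 + v2 *\<^sub>R s 2"
    define w where "w = (u1 * v0 - u0 * v1) *\<^sub>R s 2 + (u1 * v2) *\<^sub>R s 3 + (u0 * v2) *\<^sub>R s 4"
    have R: "u \<in> Rn n" "v \<in> Rn n" "w \<in> Rn n"
      unfolding u_def v_def w_def by (intro subspace_add[OF subspace_Rn] subspace_scale[OF subspace_Rn] sR)+
    have "\<psi> (?B u v) = \<psi> w"
      unfolding hom[OF R(1,2)] unfolding u_def v_def w_def linear_add[OF lin] linear_scale[OF lin] E_def[symmetric]
      by (rule br_expand)
    then show ?thesis
      using inj[OF _ Fr.B_in_Rn[OF R(1,2)] R(3)] unfolding u_def v_def w_def by blast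
  qed

  \<comment> \<open>The second and third members of the flag are bounded by the fields that the brackets of \<open>s 0\<close> and \<open>s 1\<close>
    generate; the ranks then give the independence of the five vectors.\<close>
  define K2 where "K2 = span {s 0, s 1, s 2}"
  define K3 where "K3 = span (s ` {..<5})"
  have sK3: "s k \<in> K3" if "k < 5" for k unfolding K3_def using that by (intro span_base) auto
  have sub: "subspace K2" "subspace K3" "K2 \<subseteq> Rn n" "S \<subseteq> K2" "K2 \<subseteq> K3"
  proof -
    show K: "subspace K2" "subspace K3" by (simp_all add: K2_def K3_def)
    show "K2 \<subseteq> Rn n" unfolding K2_def by (rule span_minimal[OF _ subspace_Rn]) (use sR in blast)
    show "K2 \<subseteq> K3" unfolding K2_def by (rule span_minimal[OF _ K(2)]) (simp add: sK3)
    show "S \<subseteq> K2" unfolding S_span K2_def by (rule span_mono) auto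
  qed
  have flag1: "weak_flag n U D (Suc 0) y \<subseteq> (\<lambda>u. F u y) ` S" if "y \<in> U" for y using D_F[OF that] by simp
  have flag2: "weak_flag n U D (Suc (Suc 0)) y \<subseteq> (\<lambda>u. F u y) ` K2" if "y \<in> U" for y
  proof (rule Fr.weak_flag_step[OF SR _ SR flag1 subS subS sub(1) sub(4) sub(4) _ that])
    show "?B u v \<in> K2" if "u \<in> S" "v \<in> S" for u v
    proof -
      obtain u0 u1 v0 v1 where "u = u0 *\<^sub>R s 0 + u1 *\<^sub>R s 1" "v = v0 *\<^sub>R s 0 + v1 *\<^sub>R s 1"
        using \<open>u \<in> S\<close> \<open>v \<in> S\<close> span_pair unfolding S_span by metis
      then have "?B u v = (u1 * v0 - u0 * v1) *\<^sub>R s 2" using B_expand[of u0 u1 v0 v1 0] by simp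
      then show ?thesis unfolding K2_def by (simp add: span_scale span_base)
    qed
  qed (use D_F in auto)
  have "weak_flag n U D (Suc (Suc (Suc 0))) x \<subseteq> (\<lambda>u. F u x) ` K3"
  proof (rule Fr.weak_flag_step[OF SR _ sub(3) flag2 subS sub(1,2) _ sub(5) _ xU])
    show "?B u v \<in> K3" if "u \<in> S" "v \<in> K2" for u v
    proof -
      obtain u0 u1 where u: "u = u0 *\<^sub>R s 0 + u1 *\<^sub>R s 1" using \<open>u \<in> S\<close> span_pair unfolding S_span by metis
      obtain v0 v1 v2 where v: "v = v0 *\<^sub>R s 0 + v1 *\<^sub>R s 1 + v2 *\<^sub>R s 2" using span_triple \<open>v \<in> K2\<close> unfolding K2_def by blast
      show ?thesis unfolding u v B_expand
        by (intro subspace_add[OF sub(2)] subspace_scale[OF sub(2)] sK3) auto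
    qed
  qed (use D_F sub in auto)
  then have "weak_flag n U D 3 x \<subseteq> (\<lambda>u. F u x) ` span (s ` {..<5})" by (simp add: K3_def numeral_3_eq_3)
  from independent_of_dim[OF Fr.linear_F[OF xU] this] dims(3)
  have indep_s: "independent (s ` {..<5})" "inj_on s {..<5}" by simp_all
  have "span (s ` {..<5}) \<subseteq> Rn n" by (rule span_minimal[OF _ subspace_Rn]) (use sR in blast)
  then have inj_span: "inj_on \<psi> (span (s ` {..<5}))" using inj by (blast intro: inj_onI)
  have E_image: "E ` {..<5} = \<psi> ` (s ` {..<5})" by (auto simp: E_def)
  have indep_E: "independent (E ` {..<5})"
    unfolding E_image by (rule linear_independent_injective_image[OF lin indep_s(1) inj_span])
  have inj_E: "inj_on E {..<5}"
    using indep_s(2) inj sR by (auto simp: inj_on_def E_def)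

  \<comment> \<open>Vectors with prescribed components of degrees \<open>-2\<close> and \<open>-3\<close> bound every member of the flag. As some
    member is the whole tangent space, no other vectors exist.\<close>
  define K where "K = {u \<in> Rn n. component n g 2 (\<psi> u) \<in> span {E 2} \<and> component n g 3 (\<psi> u) \<in> span {E 3, E 4}}"
  have comp_lin: "linear (\<lambda>u. component n g i (\<psi> u))" for i
    using linear_compose[OF lin A.linear_component] by (simp add: o_def)
  have subK: "subspace K"
    using subspace_Rn[of n] subspace_span[of "{E 2}"] subspace_span[of "{E 3, E 4}"]
    by (simp add: K_def subspace_def linear_0[OF comp_lin] linear_add[OF comp_lin] linear_scale[OF comp_lin])
  have KR: "K \<subseteq> Rn n" by (auto simp: K_def)
  have SK: "S \<subseteq> K"
    using A.component_homogeneous[of _ 1] by (auto simp: S_def K_def span_zero)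
  have BK: "?B u v \<in> K" if u: "u \<in> S" and v: "v \<in> K" for u v
  proof -
    have R: "u \<in> Rn n" "v \<in> Rn n" using u v SR KR by auto
    have u1: "component n g 1 (\<psi> u) = \<psi> u" "component n g 2 (\<psi> u) = 0"
      using u A.component_homogeneous[of "\<psi> u" 1] by (auto simp: S_def)
    obtain u0 u1' where pu: "\<psi> u = u0 *\<^sub>R E 0 + u1' *\<^sub>R E 1" using u g1 span_pair by (auto simp: S_def) blast
    obtain v0 v1 where pv1: "component n g 1 (\<psi> v) = v0 *\<^sub>R E 0 + v1 *\<^sub>R E 1"
      using A.component_spec(1)[of 1 "\<psi> v"] g1 span_pair by blast
    obtain v2 where pv2: "component n g 2 (\<psi> v) = v2 *\<^sub>R E 2"
      using v by (auto simp: K_def span_singleton)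
    note low = A.component_bracket_low[OF \<psi>R[OF R(1)] \<psi>R[OF R(2)]]
    have "component n g 2 (\<psi> (?B u v)) = br (\<psi> u) (component n g 1 (\<psi> v))"
      unfolding hom[OF R] low(2) u1 ..
    also have "\<dots> = (u1' * v0 - u0 * v1) *\<^sub>R E 2"
      unfolding pu pv1 using br_expand[of u0 u1' v0 v1 0] by simp
    finally have "component n g 2 (\<psi> (?B u v)) \<in> span {E 2}" by (simp add: span_scale span_base)
    moreover have "component n g 3 (\<psi> (?B u v)) = br (\<psi> u) (component n g 2 (\<psi> v))"
      unfolding hom[OF R] low(3) u1 by (simp add: bilinear_lzero[OF A.bilinear_br])
    then have "component n g 3 (\<psi> (?B u v)) = (u1' * v2) *\<^sub>R E 3 + (u0 * v2) *\<^sub>R E 4"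
      unfolding pu pv2 using br_expand[of u0 u1' 0 0 v2] by simp
    then have "component n g 3 (\<psi> (?B u v)) \<in> span {E 3, E 4}"
      by (simp add: span_add span_scale span_base)
    ultimately show ?thesis using Fr.B_in_Rn[OF R] by (simp add: K_def)
  qed
  have flagK: "weak_flag n U D (Suc i) y \<subseteq> (\<lambda>u. F u y) ` K" if "y \<in> U" for i y
    using that
  proof (induction i arbitrary: y)
    case 0
    then show ?case using flag1 SK by blast
  next
    case (Suc i)
    show ?case
      by (rule Fr.weak_flag_step[OF SR _ KR Suc.IH subS subK subK SK order_refl BK Suc.prems])
        (use D_F in auto)
  qed
  obtain j where "weak_flag n M D j x = Rn n"
    using assms(1) x unfolding nonholonomic_distribution_def by blast
  then have full: "weak_flag n U D j x = Rn n" using flag[OF xU] by simp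
  have "Rn n \<subseteq> (\<lambda>u. F u x) ` K"
  proof (cases j)
    \<comment> \<open>The flag starts with the zero distribution, which can be everything only in dimension 0.\<close>
    case 0
    then have "Rn n = {0}" using full by simp
    then show ?thesis using subspace_0[OF subK] linear_0[OF Fr.linear_F[OF xU]] by auto
  next
    case (Suc i)
    then show ?thesis using flagK[OF xU, of i] full by simp
  qed
  have RK: "u \<in> K" if "u \<in> Rn n" for u
  proof -
    have "F u x \<in> (\<lambda>u. F u x) ` K"
      using \<open>Rn n \<subseteq> (\<lambda>u. F u x) ` K\<close> Fr.F_in_Rn[OF that xU] by blast
    then obtain v where "v \<in> K" "F u x = F v x" by blast
    then show ?thesis using Fr.\<Theta>_F[OF xU that] Fr.\<Theta>_F[OF xU, of v] KR by auto
  qed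
  have gen: "component n g 1 w \<in> span {E 0, E 1}" "component n g 2 w \<in> span {E 2}"
    "component n g 3 w \<in> span {E 3, E 4}" if w: "w \<in> Rn n" for w
  proof -
    show "component n g 1 w \<in> span {E 0, E 1}" using A.component_spec(1) g1 by blast
    obtain u where "u \<in> Rn n" "w = \<psi> u" using \<psi>bij w by (auto simp: bij_betw_def)
    then show "component n g 2 w \<in> span {E 2}" "component n g 3 w \<in> span {E 3, E 4}"
      using RK[of u] by (auto simp: K_def)
  qed
  obtain \<mu> where \<mu>: "linear \<mu>" "\<And>u v. u \<in> Rn n \<Longrightarrow> v \<in> Rn n \<Longrightarrow> \<mu> (br u v) = hc_bracket (\<mu> u) (\<mu> v)"
    "\<And>k. k < 5 \<Longrightarrow> \<mu> (E k) = unitv k"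
    using A.hilbert_cartan_quotient[OF E01 E indep_E inj_E gen] by blast
  define \<Lambda> where "\<Lambda> = (\<lambda>u. \<mu> (\<psi> u))"
  have \<Lambda>: "linear \<Lambda>" using linear_compose[OF lin \<mu>(1)] by (simp add: \<Lambda>_def o_def)
  have \<Lambda>hom: "\<Lambda> (?B u v) = hc_bracket (\<Lambda> u) (\<Lambda> v)" if "u \<in> Rn n" "v \<in> Rn n" for u v
    unfolding \<Lambda>_def hom[OF that] by (rule \<mu>(2)[OF \<psi>R[OF that(1)] \<psi>R[OF that(2)]])
  have \<Lambda>s: "\<Lambda> (s k) = unitv k" if "k < 5" for k using \<mu>(3)[OF that] by (simp add: \<Lambda>_def E_def)
  obtain P where P: "smooth_map n (Rn n) 5 P"
    "\<And>u a. u \<in> Rn n \<Longrightarrow> a \<in> Rn n \<Longrightarrow> differential n P a (left_invariant_field n G u a) = hc_field (\<Lambda> u) (P a)"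
    using lie_frame.homomorphism_integrates[OF left_invariant_frame[OF G] refl \<Lambda> \<Lambda>hom] by blast
  have im: "\<phi> ` U \<subseteq> Rn n" using \<phi> by (simp add: smooth_map_def)
  have "integrable_extension n U D 5 (Rn 5) hilbert_cartan (\<lambda>y. P (\<phi> y))"
  proof (rule integrable_extension_hilbert_cartan[OF frame nonholonomic_open_subset[OF assms(1) Fr.open_U UM] _ _ sR \<Lambda> \<Lambda>s])
    show "D y = (\<lambda>u. F u y) ` span {s 0, s 1}" if "y \<in> U" for y using D_F[OF that] S_span by simp
    show "weak_flag n U D 2 y \<subseteq> (\<lambda>u. F u y) ` span {s 0, s 1, s 2}" if "y \<in> U" for y
      using flag2[OF that] by (simp add: K2_def numeral_2_eq_2)
    show "smooth_map n U 5 (\<lambda>y. P (\<phi> y))" by (rule smooth_map_compose[OF Fr.open_U openin_Rn \<phi> im P(1)])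
    show "differential n (\<lambda>y. P (\<phi> y)) y (F u y) = hc_field (\<Lambda> u) (P (\<phi> y))" if "u \<in> Rn n" "y \<in> U" for u y
      using differential_compose[OF Fr.open_U openin_Rn \<phi> im P(1) that(2)] rel\<phi>[OF that] P(2)[OF that(1)] im that(2)
      by auto
  qed
  then have "successive_extension n U D" by (rule successive_extension.step[OF successive_extension.base])
  then show "\<exists>m N E. successive_extension m N E \<and> locally_equivalent_at x n M D m N E"
    using locally_equivalent_open_subset[OF distD Fr.open_U UM xU] by blast
qed

end
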